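(* Let $V_0=\nu$ be a valuation of finite rank of a field $K$ such that there is an algebraically closed field $\mathbf k\subset R_{V_0}$ with $R_{V_0}/m_{V_0}\cong\mathbf k$. Let $f(z)\in R_{V_0}[z]$ be unitary and irreducible in $K[z]$, and let $W$ be a pseudo valuation of $K[z]$ which extends $V_0$ with $I(W)_\infty=(f(z))$. Then there exists a (finite or infinite) realization $V_1,V_2,\dots$ of the algorithm with respect to $W$, all of whose key polynomials are in $R_\nu[z]$, which produces the first simple admissible family $\mathcal S^{(1)}$ of an admissible family $\mathcal S=\mathcal S^{(1)}\cup\cdots\cup\mathcal S^{(t)}$ determining $W$; that is, there is an admissible family $\mathcal S=\mathcal S^{(1)}\cup\cdots\cup\mathcal S^{(t)}$ determining $W$ whose first simple admissible family $\mathcal S^{(1)}$ is $(V_1,V_2,\dots)$.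
   Context: Conventions. "Unitary" means monic. For a valuation $V$, $R_V$, $m_V$, $G_V$ denote valuation ring, maximal ideal, value group. A pseudo valuation on a domain $B$ is a map $V:B\to G_V\cup\{\infty\}$, $G_V$ a totally ordered abelian group, such that $I(V)_\infty=\{g\in B: V(g)=\infty\}$ is a prime ideal and $V$ induces a valuation with value group $G_V$ on the quotient field of $B/I(V)_\infty$. Equivalence. For a (pseudo) valuation $V$ of $K[z]$: $g\sim h$ in $V$ if $V(g-h)>\min\{V(g),V(h)\}$ or $V(g)=V(h)=\infty$; $h\mid g$ in $V$ if $g\sim ah$ in $V$ for some $a\in K[z]$; $g$ is equivalence irreducible in $V$ if $g\mid ab$ in $V$ implies $g\mid a$ or $g\mid b$ in $V$. Inductive valuations. Put $\phi_1=z$ and $V_1=[V_0;V_1(\phi_1)=\mu_1]$, i.e. $V_1(\sum a_iz^i)=\min_i(V_0(a_i)+i\mu_1)$. For $k\ge2$, $\phi_k\in K[z]$ is a key polynomial over $V_{k-1}$ with key value $\mu_k$ if: (1) $\phi_k$ is equivalence irreducible in $V_{k-1}$; (2) if $\phi_k\mid g$ in $V_{k-1}$ then $\deg_z\phi_k\le\deg_z g$; (3) $\phi_k$ is monic of positive degree; (4) $\mu_k>V_{k-1}(\phi_k)$; (5) $\deg_z\phi_k\ge\deg_z\phi_{k-1}$; (6) $\phi_k\sim\phi_{k-1}$ in $V_{k-1}$ is false. Then $V_k=[V_{k-1};V_k(\phi_k)=\mu_k]$ is defined by $V_k(g)=\min_i(V_{k-1}(g_i)+i\mu_k)$ where $g=\sum_i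 g_i\phi_k^i$ with $\deg_z g_i<\deg_z\phi_k$. Key values lie in an ordered abelian group containing the previous value group; $\mu_k=\infty$ is allowed only for the last stage. It is known that $\deg_z\phi_{i}$ divides $\deg_z\phi_{i+1}$ and that each $g\in K[z]$ has a unique expansion $g=\sum_j a_j\phi_1^{m_{1,j}}\cdots\phi_k^{m_{k,j}}$, $a_j\in K$, $0\le m_{i,j}<\deg_z\phi_{i+1}/\deg_z\phi_i$ for $i<k$; $g$ is homogeneous in $V_k$ if all terms have the same $V_k$-value. Approximants. Writing $f=\sum f_j\phi_k^j$ with $\deg_z f_j<\deg_z\phi_k$, $\mathrm{proj}(V_k)=\alpha-\beta$, where $\alpha$ and $\beta$ are the largest and smallest exponents $j$ with $V_k(f)=V_k(f_j\phi_k^j)$ (zero has value $\infty$). $V_k$ is a $k$-th approximant to $f$ over $V_0$ if it is obtained by stages $V_1=[V_0;V_1(\phi_1)=\mu_1]$ with $\phi_1=z$, and, for $2\le i\le k$, $V_i=[V_{i-1};V_i(\phi_i)=\mu_i]$ with $\phi_i$ a key polynomial over $V_{i-1}$ with key value $\mu_i$ which is homogeneous in $V_{i-1}$, and $\mathrm{proj}(V_k)>0$. A sequence of approximants $V_1,V_2,\dots$ is one with $V_i=[V_{i-1};V_i(\phi_i)=\mu_i]$ an $i$-th approximant for each $i$. Realization of the algorithm (with respect to $W$): a finite or infinite sequence of approximants $V_1,V_2,\dots$ to $f$ over $V_0$ with $V_i=[V_{i-1};V_i(\phi_i)=W(\phi_i)]$ for all $i$, $\phi_1=z$, and for $i\ge2$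 $\phi_i=\phi_{i-1}^{n_{i-1}}-c_{i-1}\phi_1^{j_1(i-1)}\cdots\phi_{i-2}^{j_{i-2}(i-1)}$, with $c_{i-1}\in R_{V_0}$, $n_{i-1}=[G_{V_{i-1}}:G_{V_{i-2}}]$, $0\le j_l(m)<n_l$ for all $l,m$. Admissible families (Vaquié). A simple admissible family is a family $\mathcal S^{(s)}=(\mu_i^{(s)})_{i\in I^{(s)}}$ of valuations (the very last one possibly a pseudo valuation) of $K[z]$ with key polynomials $\phi_i^{(s)}$ and values $\gamma_i^{(s)}$, where $I^{(s)}=B^{(s)}\coprod A^{(s)}$, $B^{(s)}=\{1,\dots,n^{(s)}\}$ is finite and $A^{(s)}$ (possibly empty, in which case the family is called discrete) is a totally ordered set without largest element, all of whose elements are larger than those of $B^{(s)}$; for $2\le i\in B^{(s)}$, $\mu_i^{(s)}=[\mu_{i-1}^{(s)};\mu_i^{(s)}(\phi_i^{(s)})=\gamma_i^{(s)}]$, and for $\alpha\in A^{(s)}$, $\mu_\alpha^{(s)}=[\mu_{n^{(s)}}^{(s)};\mu_\alpha^{(s)}(\phi_\alpha^{(s)})=\gamma_\alpha^{(s)}]$ with $\deg_z\phi_\alpha^{(s)}=\deg_z\phi_{n^{(s)}}^{(s)}$ (inductive augmentations by key polynomials). An admissible family for $W$ is a union $\mathcal S=\mathcal S^{(1)}\cup\dots\cup\mathcal S^{(t)}$ of simple admissible families (indexed in order), with: $\mu_1^{(1)}=[\nu;\mu_1^{(1)}(\phi_1^{(1)})=\gamma_1]$, $\deg_z\phi_1^{(1)}=1$;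 for $s\ge2$, $\mu_1^{(s)}$ is a limit augmented valuation for $(\mu_\alpha^{(s-1)})_{\alpha\in A^{(s-1)}}$; $\mu_i(g)\le\mu_j(g)\le W(g)$ for all $i<j$ and $g\in K[z]$; and $\mu_i(\phi_i)=W(\phi_i)$ for all $i$. It determines $W$ if its last element is $W$. Limit augmented valuation: for $\mathcal C=(\mu_\alpha)_{\alpha\in A}$, let $\tilde\Sigma(\mathcal C)=\{g\in K[z]:\mu_\alpha(g)<W(g)\text{ for all }\alpha\in A\}$ and let $\Sigma(\mathcal C)$ be the set of monic elements of $\tilde\Sigma(\mathcal C)$ of minimal degree (these are limit key polynomials). For $\phi\in\Sigma(\mathcal C)$ the limit augmented valuation $\mu=[\mathcal C;\mu(\phi)=W(\phi)]$ is $\mu(g)=\max_{\alpha\in A}\{\min_i\{\mu_\alpha(g_i)+iW(\phi)\}\}$ where $g=\sum g_i\phi^i$, $\deg_z g_i<\deg_z\phi$. *)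

theory Defs
  imports "HOL-Computational_Algebra.Polynomial_Factorial"
begin

section \<open>Ordered groups with a largest element adjoined\<close>

datatype 'g vext = Fin 'g | Infty

instantiation vext :: (linorder) linorder
begin

fun less_eq_vext :: "'a vext \<Rightarrow> 'a vext \<Rightarrow> bool" where
  "less_eq_vext x Infty = True"
| "less_eq_vext Infty (Fin b) = False"
| "less_eq_vext (Fin a) (Fin b) = (a \<le> b)"

definition less_vext :: "'a vext \<Rightarrow> 'a vext \<Rightarrow> bool" where
  "less_vext x y \<longleftrightarrow> x \<le> y \<and> \<not> y \<le> x"

instance
proof
  fix x y z :: "'a vext"
  show "x < y \<longleftrightarrow> x \<le> y \<and> \<not> y \<le> x" by (rule less_vext_def)
  show "x \<le> x" by (cases x) auto
  show "x \<le> y \<Longrightarrow> y \<le> z \<Longrightarrow> x \<le> z" by (cases x; cases y; cases z) auto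
  show "x \<le> y \<Longrightarrow> y \<le> x \<Longrightarrow> x = y" by (cases x; cases y) auto
  show "x \<le> y \<or> y \<le> x" by (cases x; cases y) auto
qed

end

instantiation vext :: (comm_monoid_add) comm_monoid_add
begin

definition zero_vext :: "'a vext" where "zero_vext = Fin 0"

fun plus_vext :: "'a vext \<Rightarrow> 'a vext \<Rightarrow> 'a vext" where
  "plus_vext (Fin a) (Fin b) = Fin (a + b)"
| "plus_vext x y = Infty"

instance
proof
  fix x y z :: "'a vext"
  show "x + y + z = x + (y + z)" by (cases x; cases y; cases z) (auto simp: add.assoc)
  show "x + y = y + x" by (cases x; cases y) (auto simp: add.commute)
  show "0 + x = x" by (cases x) (auto simp: zero_vext_def)
qed

end

text \<open>The multiple \<open>n x\<close>; note that \<open>0 Infty = 0\<close>.\<close>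

definition nmul :: "nat \<Rightarrow> 'a::comm_monoid_add \<Rightarrow> 'a" where
  "nmul n x = (\<Sum>i<n. x)"

section \<open>Valuations and pseudo valuations\<close>

text \<open>All values are taken in one ambient ordered abelian group \<open>'g\<close>; the value group of \<open>V\<close> is
  the subgroup \<open>value_group V\<close> of \<open>'g\<close>.\<close>

definition pseudo_valuation ::
  "('b::idom \<Rightarrow> 'g::linordered_ab_group_add vext) \<Rightarrow> bool" where
  "pseudo_valuation V \<longleftrightarrow>
     V 0 = Infty \<and> V 1 = 0 \<and>
     (\<forall>x y. V (x * y) = V x + V y) \<and>
     (\<forall>x y. min (V x) (V y) \<le> V (x + y))"

definition valuation :: "('b::idom \<Rightarrow> 'g::linordered_ab_group_add vext) \<Rightarrow> bool" where
  "valuation V \<longleftrightarrow> pseudo_valuation V \<and> (\<forall>x. V x = Infty \<longrightarrow> x = 0)"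

definition infty_ideal :: "('b::idom \<Rightarrow> 'g::linordered_ab_group_add vext) \<Rightarrow> 'b set" where
  "infty_ideal V = {x. V x = Infty}"

lemma infty_ideal_prime:
  assumes "pseudo_valuation V"
  shows "0 \<in> infty_ideal V" "1 \<notin> infty_ideal V"
    "x \<in> infty_ideal V \<Longrightarrow> y \<in> infty_ideal V \<Longrightarrow> x + y \<in> infty_ideal V"
    "x \<in> infty_ideal V \<Longrightarrow> a * x \<in> infty_ideal V"
    "x * y \<in> infty_ideal V \<Longrightarrow> x \<in> infty_ideal V \<or> y \<in> infty_ideal V"
proof -
  note ax = assms[unfolded pseudo_valuation_def]
  show "0 \<in> infty_ideal V" "1 \<notin> infty_ideal V"
    using ax by (auto simp: infty_ideal_def zero_vext_def)
  show "x + y \<in> infty_ideal V" if "x \<in> infty_ideal V" "y \<in> infty_ideal V"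
  proof -
    have "min (V x) (V y) \<le> V (x + y)" using ax by blast
    with that show ?thesis by (cases "V (x + y)") (auto simp: infty_ideal_def)
  qed
  show "a * x \<in> infty_ideal V" if "x \<in> infty_ideal V"
    using ax that by (cases "V a") (auto simp: infty_ideal_def)
  show "x \<in> infty_ideal V \<or> y \<in> infty_ideal V" if "x * y \<in> infty_ideal V"
    using ax that by (cases "V x"; cases "V y") (auto simp: infty_ideal_def)
qed

text \<open>The finite values of the valuation induced by \<open>V\<close> on the quotient field of
  \<open>B / infty_ideal V\<close>.\<close>

definition value_group :: "('b::idom \<Rightarrow> 'g::linordered_ab_group_add vext) \<Rightarrow> 'g set" where
  "value_group V = {a - b | a b. Fin a \<in> range V \<and> Fin b \<in> range V}"

definition val_ring :: "('k::field \<Rightarrow> 'g::linordered_ab_group_add vext) \<Rightarrow> 'k set" where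
  "val_ring V = {x. 0 \<le> V x}"

definition val_maxideal :: "('k::field \<Rightarrow> 'g::linordered_ab_group_add vext) \<Rightarrow> 'k set" where
  "val_maxideal V = {x. 0 < V x}"

definition in_val_ring_poly ::
  "('k::field \<Rightarrow> 'g::linordered_ab_group_add vext) \<Rightarrow> 'k poly \<Rightarrow> bool" where
  "in_val_ring_poly V p \<longleftrightarrow> (\<forall>i. coeff p i \<in> val_ring V)"

definition convex_subgroup :: "'g::linordered_ab_group_add set \<Rightarrow> 'g set \<Rightarrow> bool" where
  "convex_subgroup G H \<longleftrightarrow>
     H \<subseteq> G \<and> 0 \<in> H \<and> (\<forall>x\<in>H. \<forall>y\<in>H. x - y \<in> H) \<and>
     (\<forall>x\<in>H. \<forall>y\<in>G. 0 \<le> y \<and> y \<le> x \<longrightarrow> y \<in> H)"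

definition finite_rank :: "('b::idom \<Rightarrow> 'g::linordered_ab_group_add vext) \<Rightarrow> bool" where
  "finite_rank V \<longleftrightarrow> finite {H. convex_subgroup (value_group V) H}"

text \<open>The index \<open>[G : H]\<close>, as the number of cosets (\<open>0\<close> if there are infinitely many).\<close>

definition group_index :: "'g::ab_group_add set \<Rightarrow> 'g set \<Rightarrow> nat" where
  "group_index G H = card ((\<lambda>x. (+) x ` H) ` G)"

definition subfield_set :: "'k::field set \<Rightarrow> bool" where
  "subfield_set F \<longleftrightarrow>
     0 \<in> F \<and> 1 \<in> F \<and> (\<forall>x\<in>F. \<forall>y\<in>F. x - y \<in> F \<and> x * y \<in> F) \<and> (\<forall>x\<in>F. inverse x \<in> F)"

definition alg_closed_subfield :: "'k::field set \<Rightarrow> bool" where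
  "alg_closed_subfield F \<longleftrightarrow>
     subfield_set F \<and>
     (\<forall>p. (\<forall>i. coeff p i \<in> F) \<and> 0 < degree p \<longrightarrow> (\<exists>x\<in>F. poly p x = 0))"

text \<open>An isomorphism \<open>R_V / m_V \<cong> F\<close>, given by the ring homomorphism from \<open>R_V\<close> onto \<open>F\<close> with
  kernel \<open>m_V\<close> which it induces.  It is not required to be the inverse of the natural map
  \<open>F \<rightarrow> R_V / m_V\<close>.\<close>

definition residue_field_iso ::
  "('k::field \<Rightarrow> 'g::linordered_ab_group_add vext) \<Rightarrow> 'k set \<Rightarrow> bool" where
  "residue_field_iso V F \<longleftrightarrow>
     (\<exists>\<pi>. \<pi> ` val_ring V = F \<and> \<pi> 1 = (1::'k) \<and>
          (\<forall>x\<in>val_ring V. \<forall>y\<in>val_ring V. \<pi> (x + y) = \<pi> x + \<pi> y \<and> \<pi> (x * y) = \<pi> x * \<pi> y) \<and>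
          {x \<in> val_ring V. \<pi> x = 0} = val_maxideal V)"

section \<open>Equivalence with respect to a (pseudo) valuation\<close>

definition equiv_in ::
  "('k::field poly \<Rightarrow> 'g::linordered_ab_group_add vext) \<Rightarrow> 'k poly \<Rightarrow> 'k poly \<Rightarrow> bool" where
  "equiv_in V g h \<longleftrightarrow> V (g - h) > min (V g) (V h) \<or> (V g = Infty \<and> V h = Infty)"

definition divides_in ::
  "('k::field poly \<Rightarrow> 'g::linordered_ab_group_add vext) \<Rightarrow> 'k poly \<Rightarrow> 'k poly \<Rightarrow> bool" where
  "divides_in V h g \<longleftrightarrow> (\<exists>a. equiv_in V g (a * h))"

definition equiv_irreducible ::
  "('k::field poly \<Rightarrow> 'g::linordered_ab_group_add vext) \<Rightarrow> 'k poly \<Rightarrow> bool" where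
  "equiv_irreducible V g \<longleftrightarrow>
     (\<forall>a b. divides_in V g (a * b) \<longrightarrow> divides_in V g a \<or> divides_in V g b)"

section \<open>Expansions in powers of a polynomial\<close>

definition adic_coeff :: "'k::field poly \<Rightarrow> 'k poly \<Rightarrow> nat \<Rightarrow> 'k poly" where
  "adic_coeff \<phi> g i = (g div \<phi> ^ i) mod \<phi>"

text \<open>The exponents occurring in \<open>g = \<Sum>i. g\<^sub>i \<phi>\<^sup>i\<close> are \<open>0, \<dots>, degree g div degree \<phi>\<close>.\<close>

definition adic_range :: "'k::field poly \<Rightarrow> 'k poly \<Rightarrow> nat set" where
  "adic_range \<phi> g = {..degree g div degree \<phi>}"

lemma adic_coeff_degree: "0 < degree \<phi> \<Longrightarrow> degree (adic_coeff \<phi> g i) < degree \<phi>"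
  unfolding adic_coeff_def by (metis degree_mod_less' degree_0 mod_by_0 neq0_conv)

lemma adic_partial_expansion:
  "g = (\<Sum>i<n. adic_coeff \<phi> g i * \<phi> ^ i) + (g div \<phi> ^ n) * \<phi> ^ n"
proof (induction n)
  case 0
  show ?case by simp
next
  case (Suc n)
  have "g div \<phi> ^ n = (g div \<phi> ^ n) div \<phi> * \<phi> + adic_coeff \<phi> g n"
    by (simp add: adic_coeff_def)
  also have "(g div \<phi> ^ n) div \<phi> = g div \<phi> ^ Suc n"
    by (metis poly_div_mult_right power_Suc2)
  finally have "(g div \<phi> ^ n) * \<phi> ^ n
      = adic_coeff \<phi> g n * \<phi> ^ n + (g div \<phi> ^ Suc n) * \<phi> ^ Suc n"
    by (simp add: algebra_simps)
  with Suc.IH show ?case by (simp add: add.assoc)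
qed

lemma adic_expansion:
  assumes "0 < degree \<phi>"
  shows "g = (\<Sum>i\<in>adic_range \<phi> g. adic_coeff \<phi> g i * \<phi> ^ i)"
proof -
  let ?n = "Suc (degree g div degree \<phi>)"
  have "degree g < ?n * degree \<phi>"
    using assms by (metis dividend_less_div_times mult_Suc)
  also have "\<dots> = degree (\<phi> ^ ?n)"
    using assms by (subst degree_power_eq) auto
  finally have "g div \<phi> ^ ?n = 0" by (rule div_poly_less)
  with adic_partial_expansion[where g = g and n = ?n and \<phi> = \<phi>] show ?thesis
    by (simp add: adic_range_def lessThan_Suc_atMost)
qed

lemma adic_coeff_unique:
  assumes "0 < degree \<phi>" "\<And>i. degree (c i) < degree \<phi>" "g = (\<Sum>i<n. c i * \<phi> ^ i)" "i < n"
  shows "adic_coeff \<phi> g i = c i"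
  using assms(2-)
proof (induction n arbitrary: g c i)
  case 0
  then show ?case by simp
next
  case (Suc n)
  define h where "h = (\<Sum>i<n. c (Suc i) * \<phi> ^ i)"
  have g: "g = h * \<phi> + c 0"
    unfolding h_def Suc.prems(2) sum.lessThan_Suc_shift
    by (simp add: sum_distrib_left sum_distrib_right mult_ac)
  have nz: "\<phi> \<noteq> 0" using assms(1) by auto
  have c0: "c 0 mod \<phi> = c 0" "c 0 div \<phi> = 0"
    using Suc.prems(1)[of 0] by (auto intro: mod_poly_less div_poly_less)
  have gd: "g div \<phi> = h" "g mod \<phi> = c 0"
    using nz c0 unfolding g by simp_all
  show ?case
  proof (cases i)
    case 0
    then show ?thesis using gd by (simp add: adic_coeff_def)
  next
    case (Suc k)
    have "adic_coeff \<phi> g i = adic_coeff \<phi> h k"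
      unfolding adic_coeff_def Suc using gd by (simp add: poly_div_mult_right)
    also have "\<dots> = c (Suc k)"
      using Suc.IH[of "\<lambda>i. c (Suc i)" h k] Suc.prems Suc h_def by auto
    finally show ?thesis using Suc by simp
  qed
qed

section \<open>Inductive valuations\<close>

text \<open>\<open>augment V \<phi> \<mu>\<close> is \<open>[V; V'(\<phi>) = \<mu>]\<close>.\<close>

definition augment ::
  "('k::field poly \<Rightarrow> 'g::linordered_ab_group_add vext) \<Rightarrow> 'k poly \<Rightarrow> 'g vext
     \<Rightarrow> 'k poly \<Rightarrow> 'g vext" where
  "augment V \<phi> \<mu> g = Min ((\<lambda>i. V (adic_coeff \<phi> g i) + nmul i \<mu>) ` adic_range \<phi> g)"

text \<open>\<open>[V0; V'(\<phi>) = \<mu>]\<close> for a valuation \<open>V0\<close> of the field \<open>K\<close> and \<open>\<phi>\<close> of degree \<open>1\<close>, so that all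
  \<open>\<phi>\<close>-adic coefficients are constant polynomials.\<close>

definition base_augment ::
  "('k::field \<Rightarrow> 'g::linordered_ab_group_add vext) \<Rightarrow> 'k poly \<Rightarrow> 'g vext
     \<Rightarrow> 'k poly \<Rightarrow> 'g vext" where
  "base_augment V0 \<phi> \<mu> = augment (\<lambda>p. V0 (coeff p 0)) \<phi> \<mu>"

abbreviation zvar :: "'k::field poly" where
  "zvar \<equiv> [:0, 1:]"

lemma base_augment_zvar:
  "base_augment V0 zvar \<mu> g = Min ((\<lambda>i. V0 (coeff g i) + nmul i \<mu>) ` {..degree g})"
proof -
  have g: "g = (\<Sum>i<Suc (degree g). [:coeff g i:] * zvar ^ i)"
    by (simp add: lessThan_Suc_atMost poly_as_sum_of_monoms flip: monom_altdef)
  have "adic_coeff zvar g i = [:coeff g i:]" if "i \<le> degree g" for i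
    by (rule adic_coeff_unique[OF _ _ g]) (use that in auto)
  then show ?thesis
    unfolding base_augment_def augment_def by (auto simp: adic_range_def intro!: arg_cong[of _ _ Min])
qed

text \<open>\<open>\<phi>\<close> is a key polynomial over \<open>V\<close> with key value \<open>\<mu>\<close>, where \<open>\<phi>'\<close> is the preceding key
  polynomial, i.e. that of \<open>V\<close>.  In the minimality condition \<open>g = 0\<close> is excluded: every polynomial
  divides \<open>0\<close> in \<open>V\<close>, and \<open>degree 0 = 0\<close> here.\<close>

definition key_polynomial ::
  "('k::field poly \<Rightarrow> 'g::linordered_ab_group_add vext) \<Rightarrow> 'k poly \<Rightarrow> 'k poly \<Rightarrow> 'g vext \<Rightarrow> bool"
  where
  "key_polynomial V \<phi>' \<phi> \<mu> \<longleftrightarrow>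
     equiv_irreducible V \<phi> \<and>
     (\<forall>g. g \<noteq> 0 \<and> divides_in V \<phi> g \<longrightarrow> degree \<phi> \<le> degree g) \<and>
     lead_coeff \<phi> = 1 \<and> 0 < degree \<phi> \<and>
     \<mu> > V \<phi> \<and>
     degree \<phi>' \<le> degree \<phi> \<and>
     \<not> equiv_in V \<phi> \<phi>'"

text \<open>The exponent vectors \<open>(m\<^sub>1, \<dots>, m\<^sub>k)\<close> admissible in expansions with respect to
  \<open>\<phi>\<^sub>1, \<dots>, \<phi>\<^sub>k\<close>, extended by zero.\<close>

definition std_exponents :: "(nat \<Rightarrow> 'k::field poly) \<Rightarrow> nat \<Rightarrow> (nat \<Rightarrow> nat) set" where
  "std_exponents \<phi> k =
     {m. (\<forall>i. i \<notin> {1..k} \<longrightarrow> m i = 0) \<and>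
         (\<forall>i\<in>{1..<k}. m i < degree (\<phi> (Suc i)) div degree (\<phi> i))}"

definition std_term ::
  "(nat \<Rightarrow> 'k::field poly) \<Rightarrow> nat \<Rightarrow> 'k \<Rightarrow> (nat \<Rightarrow> nat) \<Rightarrow> 'k poly" where
  "std_term \<phi> k a m = smult a (\<Prod>i=1..k. \<phi> i ^ m i)"

definition homogeneous ::
  "(nat \<Rightarrow> 'k::field poly) \<Rightarrow> nat \<Rightarrow> ('k poly \<Rightarrow> 'g::linordered_ab_group_add vext)
     \<Rightarrow> 'k poly \<Rightarrow> bool" where
  "homogeneous \<phi> k V g \<longleftrightarrow>
     (\<exists>a. finite {m. a m \<noteq> 0} \<and> {m. a m \<noteq> 0} \<subseteq> std_exponents \<phi> k \<and>
          g = (\<Sum>m | a m \<noteq> 0. std_term \<phi> k (a m) m) \<and>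
          (\<forall>m m'. a m \<noteq> 0 \<and> a m' \<noteq> 0 \<longrightarrow>
             V (std_term \<phi> k (a m) m) = V (std_term \<phi> k (a m') m')))"

section \<open>Approximants\<close>

text \<open>The exponents range over \<open>0, \<dots>, degree f div degree \<phi>\<close> and include those with zero
  coefficient, which matter when \<open>V f = Infty\<close>; for instance the projection is \<open>1\<close> if \<open>f = \<phi>\<close> has
  value \<open>Infty\<close>.\<close>

definition proj_exponents ::
  "'k::field poly \<Rightarrow> 'k poly \<Rightarrow> ('k poly \<Rightarrow> 'g::linordered_ab_group_add vext) \<Rightarrow> nat set" where
  "proj_exponents f \<phi> V = {j \<in> adic_range \<phi> f. V f = V (adic_coeff \<phi> f j * \<phi> ^ j)}"

definition proj ::
  "'k::field poly \<Rightarrow> 'k poly \<Rightarrow> ('k poly \<Rightarrow> 'g::linordered_ab_group_add vext) \<Rightarrow> nat" where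
  "proj f \<phi> V = Max (proj_exponents f \<phi> V) - Min (proj_exponents f \<phi> V)"

text \<open>\<open>V k\<close>, obtained by the stages \<open>V 1, \<dots>, V k\<close> with key polynomials \<open>\<phi> i\<close> and key values \<open>\<mu> i\<close>,
  is a \<open>k\<close>-th approximant to \<open>f\<close> over \<open>V0\<close>.\<close>

definition approximant ::
  "('k::field \<Rightarrow> 'g::linordered_ab_group_add vext) \<Rightarrow> 'k poly \<Rightarrow> (nat \<Rightarrow> 'k poly)
     \<Rightarrow> (nat \<Rightarrow> 'g vext) \<Rightarrow> (nat \<Rightarrow> 'k poly \<Rightarrow> 'g vext) \<Rightarrow> nat \<Rightarrow> bool" where
  "approximant V0 f \<phi> \<mu> V k \<longleftrightarrow>
     1 \<le> k \<and>
     \<phi> 1 = zvar \<and> V 1 = base_augment V0 (\<phi> 1) (\<mu> 1) \<and>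
     (\<forall>i\<in>{2..k}.
        key_polynomial (V (i - 1)) (\<phi> (i - 1)) (\<phi> i) (\<mu> i) \<and>
        homogeneous \<phi> (i - 1) (V (i - 1)) (\<phi> i) \<and>
        V i = augment (V (i - 1)) (\<phi> i) (\<mu> i)) \<and>
     (\<forall>i\<in>{1..<k}. \<mu> i \<noteq> Infty) \<and>
     0 < proj f (\<phi> k) (V k)"

definition sequence_index_set :: "nat set \<Rightarrow> bool" where
  "sequence_index_set I \<longleftrightarrow> I = {1..} \<or> (\<exists>N\<ge>1. I = {1..N})"

section \<open>Realizations of the algorithm\<close>

text \<open>\<open>stage_index V0 V m = [G\<^bsub>V\<^sub>m\<^esub> : G\<^bsub>V\<^sub>m\<^sub>-\<^sub>1\<^esub>]\<close> for \<open>m \<ge> 1\<close>.\<close>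

definition stage_index ::
  "('k::field \<Rightarrow> 'g::linordered_ab_group_add vext) \<Rightarrow> (nat \<Rightarrow> 'k poly \<Rightarrow> 'g vext) \<Rightarrow> nat \<Rightarrow> nat"
  where
  "stage_index V0 V m =
     group_index (value_group (V m)) (if m = 1 then value_group V0 else value_group (V (m - 1)))"

definition realization ::
  "('k::field \<Rightarrow> 'g::linordered_ab_group_add vext) \<Rightarrow> ('k poly \<Rightarrow> 'g vext) \<Rightarrow> 'k poly
     \<Rightarrow> nat set \<Rightarrow> (nat \<Rightarrow> 'k poly) \<Rightarrow> (nat \<Rightarrow> 'k poly \<Rightarrow> 'g vext) \<Rightarrow> bool" where
  "realization V0 W f I \<phi> V \<longleftrightarrow>
     sequence_index_set I \<and>
     (\<forall>i\<in>I. approximant V0 f \<phi> (\<lambda>m. W (\<phi> m)) V i) \<and>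
     (\<exists>c j. \<forall>i\<in>I. 2 \<le> i \<longrightarrow>
        c (i - 1) \<in> val_ring V0 \<and>
        (\<forall>l\<in>{1..i - 2}. j l (i - 1) < stage_index V0 V l) \<and>
        \<phi> i = \<phi> (i - 1) ^ stage_index V0 V (i - 1)
              - smult (c (i - 1)) (\<Prod>l=1..i - 2. \<phi> l ^ j l (i - 1)))"

section \<open>Admissible families\<close>

text \<open>The index set \<open>B \<amalg> A\<close> of a simple family is rendered as a subset of \<open>nat + 'i\<close>:
  \<open>B = {1..fam_n S}\<close> on the left and \<open>A = fam_A S\<close> on the right.\<close>

record ('p, 'g, 'i) simple_family =
  fam_n :: nat
  fam_A :: "'i set"
  fam_val :: "nat + 'i \<Rightarrow> 'p \<Rightarrow> 'g vext"
  fam_key :: "nat + 'i \<Rightarrow> 'p"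
  fam_gamma :: "nat + 'i \<Rightarrow> 'g vext"

definition fam_index :: "('p, 'g, 'i) simple_family \<Rightarrow> (nat + 'i) set" where
  "fam_index S = Inl ` {1..fam_n S} \<union> Inr ` fam_A S"

fun index_less :: "nat + 'i::linorder \<Rightarrow> nat + 'i \<Rightarrow> bool" where
  "index_less (Inl i) (Inl j) = (i < j)"
| "index_less (Inl i) (Inr b) = True"
| "index_less (Inr a) (Inl j) = False"
| "index_less (Inr a) (Inr b) = (a < b)"

definition simple_admissible ::
  "('k::field poly, 'g::linordered_ab_group_add, 'i::linorder) simple_family \<Rightarrow> bool" where
  "simple_admissible S \<longleftrightarrow>
     1 \<le> fam_n S \<and>
     (\<forall>\<alpha>\<in>fam_A S. \<exists>\<beta>\<in>fam_A S. \<alpha> < \<beta>) \<and>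
     (\<forall>x\<in>fam_index S. pseudo_valuation (fam_val S x)) \<and>
     (\<forall>x\<in>fam_index S. \<forall>y\<in>fam_index S. index_less x y \<longrightarrow> valuation (fam_val S x)) \<and>
     (\<forall>i\<in>{2..fam_n S}.
        key_polynomial (fam_val S (Inl (i - 1))) (fam_key S (Inl (i - 1)))
          (fam_key S (Inl i)) (fam_gamma S (Inl i)) \<and>
        fam_val S (Inl i) =
          augment (fam_val S (Inl (i - 1))) (fam_key S (Inl i)) (fam_gamma S (Inl i))) \<and>
     (\<forall>\<alpha>\<in>fam_A S.
        key_polynomial (fam_val S (Inl (fam_n S))) (fam_key S (Inl (fam_n S)))
          (fam_key S (Inr \<alpha>)) (fam_gamma S (Inr \<alpha>)) \<and>
        degree (fam_key S (Inr \<alpha>)) = degree (fam_key S (Inl (fam_n S))) \<and>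
        fam_val S (Inr \<alpha>) =
          augment (fam_val S (Inl (fam_n S))) (fam_key S (Inr \<alpha>)) (fam_gamma S (Inr \<alpha>)))"

definition limit_key_candidates ::
  "('k::field poly \<Rightarrow> 'g::linordered_ab_group_add vext) \<Rightarrow> 'i set
     \<Rightarrow> ('i \<Rightarrow> 'k poly \<Rightarrow> 'g vext) \<Rightarrow> 'k poly set" where
  "limit_key_candidates W A \<mu> = {g. \<forall>\<alpha>\<in>A. \<mu> \<alpha> g < W g}"

definition limit_key_polys ::
  "('k::field poly \<Rightarrow> 'g::linordered_ab_group_add vext) \<Rightarrow> 'i set
     \<Rightarrow> ('i \<Rightarrow> 'k poly \<Rightarrow> 'g vext) \<Rightarrow> 'k poly set" where
  "limit_key_polys W A \<mu> =
     {\<phi> \<in> limit_key_candidates W A \<mu>.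
        lead_coeff \<phi> = 1 \<and> (\<forall>g\<in>limit_key_candidates W A \<mu>. degree \<phi> \<le> degree g)}"

text \<open>\<open>\<mu>' = [(\<mu> \<alpha>)\<^bsub>\<alpha>\<in>A\<^esub>; \<mu>'(\<phi>) = W(\<phi>)]\<close>; the condition includes that the maximum defining
  \<open>\<mu>' g\<close> is attained.\<close>

definition limit_augmented ::
  "('k::field poly \<Rightarrow> 'g::linordered_ab_group_add vext) \<Rightarrow> 'i set
     \<Rightarrow> ('i \<Rightarrow> 'k poly \<Rightarrow> 'g vext) \<Rightarrow> 'k poly \<Rightarrow> ('k poly \<Rightarrow> 'g vext) \<Rightarrow> bool" where
  "limit_augmented W A \<mu> \<phi> \<mu>' \<longleftrightarrow>
     \<phi> \<in> limit_key_polys W A \<mu> \<and>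
     (\<forall>g. (\<exists>\<alpha>\<in>A. \<mu>' g = augment (\<mu> \<alpha>) \<phi> (W \<phi>) g) \<and>
          (\<forall>\<alpha>\<in>A. augment (\<mu> \<alpha>) \<phi> (W \<phi>) g \<le> \<mu>' g))"

definition admissible_family ::
  "('k::field \<Rightarrow> 'g::linordered_ab_group_add vext) \<Rightarrow> ('k poly \<Rightarrow> 'g vext) \<Rightarrow> nat
     \<Rightarrow> (nat \<Rightarrow> ('k poly, 'g, 'i::linorder) simple_family) \<Rightarrow> bool" where
  "admissible_family \<nu> W t S \<longleftrightarrow>
     1 \<le> t \<and>
     (\<forall>s\<in>{1..t}. simple_admissible (S s)) \<and>
     lead_coeff (fam_key (S 1) (Inl 1)) = 1 \<and> degree (fam_key (S 1) (Inl 1)) = 1 \<and>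
     fam_val (S 1) (Inl 1) = base_augment \<nu> (fam_key (S 1) (Inl 1)) (fam_gamma (S 1) (Inl 1)) \<and>
     (\<forall>s\<in>{2..t}.
        limit_augmented W (fam_A (S (s - 1))) (\<lambda>\<alpha>. fam_val (S (s - 1)) (Inr \<alpha>))
          (fam_key (S s) (Inl 1)) (fam_val (S s) (Inl 1)) \<and>
        fam_gamma (S s) (Inl 1) = W (fam_key (S s) (Inl 1))) \<and>
     (\<forall>s\<in>{1..t}. \<forall>s'\<in>{1..t}. \<forall>x\<in>fam_index (S s). \<forall>y\<in>fam_index (S s').
        s < s' \<or> (s = s' \<and> index_less x y) \<longrightarrow>
        (\<forall>g. fam_val (S s) x g \<le> fam_val (S s') y g)) \<and>
     (\<forall>s\<in>{1..t}. \<forall>x\<in>fam_index (S s). \<forall>g. fam_val (S s) x g \<le> W g) \<and>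
     (\<forall>s\<in>{1..t}. \<forall>x\<in>fam_index (S s).
        fam_val (S s) x (fam_key (S s) x) = W (fam_key (S s) x))"

definition family_determines ::
  "('k::field poly \<Rightarrow> 'g::linordered_ab_group_add vext) \<Rightarrow> nat
     \<Rightarrow> (nat \<Rightarrow> ('k poly, 'g, 'i::linorder) simple_family) \<Rightarrow> bool" where
  "family_determines W t S \<longleftrightarrow> fam_A (S t) = {} \<and> fam_val (S t) (Inl (fam_n (S t))) = W"

text \<open>The simple family \<open>S\<close> is the sequence \<open>(V i)\<^bsub>i\<in>I\<^esub>\<close> with key polynomials \<open>\<phi> i\<close>, cut after
  the index \<open>fam_n S\<close> into its parts \<open>B\<close> and \<open>A\<close>.\<close>

definition family_is_sequence ::
  "('k::field poly, 'g, nat) simple_family \<Rightarrow> nat set \<Rightarrow> (nat \<Rightarrow> 'k poly)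
     \<Rightarrow> (nat \<Rightarrow> 'k poly \<Rightarrow> 'g vext) \<Rightarrow> bool" where
  "family_is_sequence S I \<phi> V \<longleftrightarrow>
     {1..fam_n S} \<subseteq> I \<and> fam_A S = I - {1..fam_n S} \<and>
     (\<forall>i\<in>{1..fam_n S}. fam_val S (Inl i) = V i \<and> fam_key S (Inl i) = \<phi> i) \<and>
     (\<forall>i\<in>fam_A S. fam_val S (Inr i) = V i \<and> fam_key S (Inr i) = \<phi> i)"

end

(*
  Every valuation that occurs is a truncation of W: for a monic phi, trunc phi g is the minimum of
  W (g_i phi^i) over the phi-adic expansion of g.  If trunc phi is a valuation and psi is a monic
  polynomial of least degree with trunc phi psi < W psi, then psi divides g in trunc phi exactly if
  trunc phi g < W g; this makes psi a key polynomial over trunc phi with trunc psi as augmentation.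

  In the algorithm let n be the order of W phi_m modulo the values of polynomials of degree below
  deg phi_m.  Below degree n deg phi_m the terms of the phi_m-adic expansion have distinct values, so
  trunc phi_m and W agree there.  Some monomial c phi_1^j_1 ... phi_(m-1)^j_(m-1) has the value of
  phi_m^n, and since W is algebraic over a valuation with algebraically closed residue field, c can
  be scaled by a unit so that the difference has larger value: it is phi_(m+1).

  If the algorithm does not stop, the degrees of the phi_m are eventually constant, and the stages
  from there on form the continuous part of the first family.  Later families are built by taking
  psi of maximal value among the successors of least degree, or, if there is no maximum, a cofinal
  sequence of them, followed by a limit key polynomial; the degree up to which the truncation agrees
  with W then increases strictly, which gives termination.  Finite rank provides cofinal sequences
  that are countable.
*)

theory Submission
  imports Defs "HOL-Library.Nat_Bijection"
begin

section \<open>Values\<close>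

text \<open>A truncation at \<open>\<phi>\<close> is multiplicative once \<open>W (a * b)\<close> is
  unchanged by reducing \<open>a * b\<close> modulo \<open>\<phi>\<close>, for \<open>a\<close>,
  \<open>b\<close> of degree below that of \<open>\<phi>\<close>. This involves three polynomials at
  a time. So it suffices that for each finite set of low-degree polynomials some valuation below
  \<open>W\<close>, strictly so at \<open>\<phi>\<close>, agrees with \<open>W\<close> on that set.
  For ordinary key polynomials one valuation serves all sets; for limit key polynomials it varies
  with the set. Algebraicity enters because K[z]/(f) has finite dimension: every polynomial
  satisfies an equation over K modulo \<open>f\<close>. Comparing values of its terms gives torsion
  of the values over those of \<open>\<nu>\<close>, which also carries finite rank over to
  \<open>W\<close>; reducing its coefficients gives the residues. Integrality of \<open>f\<close>
  enters through \<open>0 \<le> W zvar\<close>. It starts the chain of bounds of monomials by the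
  next key value, which keep every constant c in the valuation ring. The recursion is bounded
  because \<open>f\<close> has value \<open>Infty\<close> under \<open>W\<close> but a finite one
  under a truncation at a key of finite value, so agreement cannot pass \<open>degree f\<close>
  before \<open>W\<close> is reached.\<close>

lemma vext_simps [simp]:
  "x \<le> Infty" "Infty \<le> x \<longleftrightarrow> x = Infty" "x < Infty \<longleftrightarrow> x \<noteq> Infty" "\<not> Infty < x"
  "Fin a < Fin b \<longleftrightarrow> a < b" "x + Infty = Infty" "Infty + x = Infty"
  by (cases x; auto simp: less_vext_def)+

lemma not_Infty_iff: "x \<noteq> Infty \<longleftrightarrow> (\<exists>a. x = Fin a)"
  by (cases x) auto

lemma plus_eq_Infty [simp]: "x + y = Infty \<longleftrightarrow> x = Infty \<or> y = Infty"
  by (cases x; cases y) auto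

lemma zero_neq_Infty [simp]: "0 \<noteq> Infty" "Infty \<noteq> 0"
  by (auto simp: zero_vext_def)

instance vext :: (linordered_ab_group_add) ordered_comm_monoid_add
proof
  fix a b c :: "'a vext"
  show "a \<le> b \<Longrightarrow> c + a \<le> c + b"
    by (cases a; cases b; cases c) auto
qed

lemma vext_add_cancel:
  fixes x y a :: "'g::linordered_ab_group_add vext"
  assumes "a \<noteq> Infty"
  shows "a + x \<le> a + y \<longleftrightarrow> x \<le> y" "a + x < a + y \<longleftrightarrow> x < y" "a + x = a + y \<longleftrightarrow> x = y"
    "x + a \<le> y + a \<longleftrightarrow> x \<le> y" "x + a < y + a \<longleftrightarrow> x < y" "x + a = y + a \<longleftrightarrow> x = y"
  using assms by (cases x; cases y; cases a; auto)+

lemma vext_add_less_le: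
  fixes a b c d :: "'g::linordered_ab_group_add vext"
  assumes "a < b" "c \<le> d" "c \<noteq> Infty"
  shows "a + c < b + d" "c + a < d + b"
proof -
  show "a + c < b + d"
    using assms by (cases a; cases b; cases c; cases d) (auto simp: add_less_le_mono)
  then show "c + a < d + b" by (simp add: add.commute)
qed

lemma vext_min_add:
  fixes a b c :: "'g::linordered_ab_group_add vext"
  shows "min a b + c = min (a + c) (b + c)"
  by (metis add_right_mono min_absorb1 min_absorb2 linear)

lemma nmul_0 [simp]: "nmul 0 x = 0" and nmul_Suc: "nmul (Suc n) x = nmul n x + x"
  by (simp_all add: nmul_def)

lemma nmul_1 [simp]: "nmul (Suc 0) x = x"
  by (simp add: nmul_Suc)

lemma nmul_add: "nmul (m + n) x = nmul m x + nmul n x"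
  by (induction n) (simp_all add: nmul_Suc add.assoc)

lemma nmul_mult: "nmul (m * n) x = nmul m (nmul n x)"
  by (induction m) (simp_all add: nmul_Suc nmul_add add.commute)

lemma nmul_diff: "nmul n (x - y) = nmul n x - nmul n (y :: 'g::ab_group_add)"
  by (simp add: nmul_def sum_subtractf)

lemma nmul_minus: "nmul n (- x) = - nmul n (x :: 'g::ab_group_add)"
  by (simp add: nmul_def sum_negf)

lemma nmul_zero [simp]: "nmul n 0 = 0"
  by (simp add: nmul_def)

lemma nmul_Fin: "nmul n (Fin x) = Fin (nmul n x)"
  by (induction n) (simp_all add: nmul_Suc zero_vext_def)

lemma nmul_mono: "x \<le> y \<Longrightarrow> nmul n x \<le> nmul n (y :: 'g::ordered_comm_monoid_add)"
  by (simp add: nmul_def sum_mono)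

lemma nmul_strict_mono:
  fixes x y :: "'g::linordered_ab_group_add"
  assumes "x < y" "0 < n"
  shows "nmul n x < nmul n y"
  using assms by (auto simp: nmul_def intro!: sum_strict_mono)

lemma nmul_less_iff:
  fixes x y :: "'g::linordered_ab_group_add"
  assumes "0 < n"
  shows "nmul n x < nmul n y \<longleftrightarrow> x < y"
  by (metis assms nmul_mono nmul_strict_mono not_le)

lemma nmul_nonneg: "0 \<le> x \<Longrightarrow> 0 \<le> nmul n (x :: 'g::ordered_comm_monoid_add)"
  by (simp add: nmul_def sum_nonneg)

lemma nmul_mono_left:
  fixes x :: "'g::ordered_comm_monoid_add"
  assumes "m \<le> n" "0 \<le> x"
  shows "nmul m x \<le> nmul n x"
proof -
  obtain k where "n = m + k" using assms(1) le_Suc_ex by blast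
  then show ?thesis
    using nmul_nonneg[OF assms(2), of k] by (simp add: nmul_add add_increasing2)
qed

section \<open>Pseudo valuations\<close>

context
  fixes V :: "'b::idom \<Rightarrow> 'g::linordered_ab_group_add vext"
  assumes V: "pseudo_valuation V"
begin

lemma pv_0 [simp]: "V 0 = Infty"
  and pv_1 [simp]: "V 1 = 0"
  and pv_mult: "V (x * y) = V x + V y"
  and pv_add: "min (V x) (V y) \<le> V (x + y)"
  using V by (auto simp: pseudo_valuation_def)

lemma pv_minus: "V (- x) = V x"
proof -
  have "V (- 1) + V (- 1) = 0" by (simp flip: pv_mult)
  then have "V (- 1) = 0"
  proof (cases "V (- 1)")
    case (Fin a)
    with \<open>V (- 1) + V (- 1) = 0\<close> have "a + a = 0" by (simp add: zero_vext_def)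
    then show ?thesis by (simp add: Fin zero_vext_def)
  qed simp
  then show ?thesis using pv_mult[of "- 1" x] by simp
qed

lemma pv_diff: "min (V x) (V y) \<le> V (x - y)"
  using pv_add[of x "- y"] by (simp add: pv_minus)

lemma pv_add_strict: "v < V x \<Longrightarrow> v < V y \<Longrightarrow> v < V (x + y)"
  by (rule less_le_trans[OF _ pv_add]) (simp only: min_less_iff_conj)

lemma pv_diff_strict: "v < V x \<Longrightarrow> v < V y \<Longrightarrow> v < V (x - y)"
  by (rule less_le_trans[OF _ pv_diff]) (simp only: min_less_iff_conj)

lemma pv_add_eq: "V x < V y \<Longrightarrow> V (x + y) = V x"
  using pv_add[of x y] pv_diff[of "x + y" y] by (auto simp: min_def split: if_splits)

lemma pv_add_eq': "V y < V x \<Longrightarrow> V (x + y) = V y"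
  using pv_add_eq[of y x] by (simp add: add.commute)

lemma pv_add_neq: "V x \<noteq> V y \<Longrightarrow> V (x + y) = min (V x) (V y)"
  using pv_add_eq[of x y] pv_add_eq'[of y x] by (cases "V x" "V y" rule: linorder_cases) auto

lemma pv_diff_eq: "V x < V (x - y) \<Longrightarrow> V y = V x"
  using pv_add_eq[of x "- (x - y)"] by (simp only: pv_minus) simp

text \<open>\<open>v \<noteq> Infty\<close> covers an empty or infinite \<open>A\<close>, where the
  sum is 0 and has value \<open>Infty\<close>.\<close>

lemma pv_sum_strict:
  assumes "v \<noteq> Infty" "\<And>i. i \<in> A \<Longrightarrow> v < V (g i)"
  shows "v < V (sum g A)"
  using assms(2)
proof (induction A rule: infinite_finite_induct)
  case (insert x A)
  have "v < V (g x)" "v < V (sum g A)"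
    using insert.prems by (auto intro!: insert.IH)
  then show ?case using insert.hyps by (simp add: pv_add_strict)
qed (use assms in auto)

lemma pv_power: "V (x ^ n) = nmul n (V x)"
  by (induction n) (simp_all add: nmul_Suc pv_mult add.commute)

end

section \<open>Augmentation by division with remainder\<close>

text \<open>Repeated division by \<open>\<phi>\<close> walks through the adic expansion from its
  constant term upwards. Together with \<open>augment_rec\<close> this replaces computations with
  indexed sums.\<close>

lemma poly_div_induct [consumes 1, case_names zero div]:
  fixes \<phi> :: "'k::field poly"
  assumes "0 < degree \<phi>" "P 0" "\<And>g. g \<noteq> 0 \<Longrightarrow> P (g div \<phi>) \<Longrightarrow> P g"
  shows "P g"
proof (induction "degree g" arbitrary: g rule: less_induct)
  case less
  show ?case
  proof (cases "g div \<phi> = 0")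
    case True
    then show ?thesis using assms(2,3) by (cases "g = 0") auto
  next
    case False
    then have "degree g \<noteq> 0" using assms(1) by (metis div_poly_less neq0_conv)
    then have "degree (g div \<phi>) < degree g"
      using assms(1) by (simp add: degree_div_less)
    then show ?thesis using less assms(2,3) by (cases "g = 0") auto
  qed
qed

lemma degree_div_poly:
  fixes \<phi> :: "'k::field poly"
  assumes "0 < degree \<phi>"
  shows "degree (g div \<phi>) = degree g - degree \<phi>"
proof (cases "degree g < degree \<phi>")
  case True
  then show ?thesis by (simp add: div_poly_less)
next
  case False
  have nz: "\<phi> \<noteq> 0" using assms by auto
  have "g div \<phi> \<noteq> 0"
  proof
    assume "g div \<phi> = 0"
    then have "g = g mod \<phi>" by (metis add_0 div_mult_mod_eq mult_zero_left)
    moreover have "degree (g mod \<phi>) < degree \<phi>"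
      using assms by (metis degree_0 degree_mod_less[OF nz])
    ultimately show False using False by simp
  qed
  then have "degree (g div \<phi> * \<phi>) = degree (g div \<phi>) + degree \<phi>"
    using nz by (simp add: degree_mult_eq)
  moreover have "degree (g mod \<phi>) < degree \<phi>"
    using assms by (metis degree_0 degree_mod_less[OF nz])
  ultimately have "degree (g div \<phi> * \<phi> + g mod \<phi>) = degree (g div \<phi>) + degree \<phi>"
    by (subst degree_add_eq_left) auto
  then show ?thesis by simp
qed

lemma degree_mod_poly: "0 < degree \<phi> \<Longrightarrow> degree (g mod \<phi>) < degree (\<phi> :: 'k::field poly)"
  using adic_coeff_degree[of \<phi> g 0] by (simp add: adic_coeff_def)

lemma adic_coeff_0: "adic_coeff \<phi> g 0 = g mod \<phi>"
  and adic_coeff_Suc: "adic_coeff \<phi> g (Suc i) = adic_coeff \<phi> (g div \<phi>) i"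
  by (simp_all add: adic_coeff_def poly_div_mult_right)

text \<open>Division by \<open>\<phi>\<close> shifts the adic coefficients down by one, and adding
  \<open>\<mu>\<close> is monotone, so it commutes with \<open>Min\<close>. When
  \<open>g div \<phi> = 0\<close>, \<open>V 0 = Infty\<close> makes the second argument of
  \<open>min\<close> harmless.\<close>

lemma augment_rec:
  fixes V :: "'k::field poly \<Rightarrow> 'g::linordered_ab_group_add vext"
  assumes "0 < degree \<phi>" "V 0 = Infty"
  shows "augment V \<phi> \<mu> g = min (V (g mod \<phi>)) (augment V \<phi> \<mu> (g div \<phi>) + \<mu>)"
proof (cases "degree g < degree \<phi>")
  case True
  then show ?thesis
    by (simp add: augment_def adic_range_def div_poly_less mod_poly_less adic_coeff_def assms)
next
  case False
  define k where "k = degree (g div \<phi>) div degree \<phi>"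
  have k: "degree g div degree \<phi> = Suc k"
    using False assms(1) by (simp add: k_def degree_div_poly le_div_geq)
  define F where "F = (\<lambda>i. V (adic_coeff \<phi> g i) + nmul i \<mu>)"
  have "augment V \<phi> \<mu> g = Min (F ` insert 0 (Suc ` {..k}))"
    by (simp add: augment_def F_def adic_range_def k flip: atMost_Suc_eq_insert_0)
  also have "\<dots> = min (F 0) (Min ((\<lambda>i. F (Suc i)) ` {..k}))"
    by (simp add: image_image)
  also have "(\<lambda>i. F (Suc i)) ` {..k}
      = (\<lambda>x. x + \<mu>) ` (\<lambda>i. V (adic_coeff \<phi> (g div \<phi>) i) + nmul i \<mu>) ` {..k}"
    by (simp add: image_image F_def adic_coeff_Suc nmul_Suc add.assoc)
  also have "Min \<dots> = augment V \<phi> \<mu> (g div \<phi>) + \<mu>"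
    unfolding augment_def adic_range_def k_def[symmetric]
    by (rule mono_Min_commute[symmetric]) (auto simp: mono_def add_right_mono)
  also have "F 0 = V (g mod \<phi>)" by (simp add: F_def adic_coeff_0)
  finally show ?thesis .
qed

lemma augment_small:
  fixes V :: "'k::field poly \<Rightarrow> 'g::linordered_ab_group_add vext"
  assumes "degree g < degree \<phi>"
  shows "augment V \<phi> \<mu> g = V g"
  using assms by (simp add: augment_def adic_range_def adic_coeff_def mod_poly_less)

text \<open>Only values below \<open>degree \<phi>\<close> enter. Hence augmenting a truncation that
  agrees with \<open>W\<close> in these degrees yields a truncation of \<open>W\<close> again,
  whatever the preceding key was.\<close>

lemma augment_cong:
  fixes V V' :: "'k::field poly \<Rightarrow> 'g::linordered_ab_group_add vext"
  assumes "0 < degree \<phi>" "\<And>g. degree g < degree \<phi> \<Longrightarrow> V g = V' g"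
  shows "augment V \<phi> \<mu> = augment V' \<phi> \<mu>"
  by (rule ext) (simp add: augment_def assms adic_coeff_degree)

section \<open>Truncations\<close>

locale pseudo_valuation_kernel =
  fixes W :: "'k::field poly \<Rightarrow> 'g::linordered_ab_group_add vext" and f :: "'k poly"
  assumes W: "pseudo_valuation W"
    and kernel: "infty_ideal W = {g. f dvd g}"
    and monic_f: "lead_coeff f = 1"
    and irreducible_f: "irreducible f"
begin

lemma W_Infty_iff: "W g = Infty \<longleftrightarrow> f dvd g"
  using kernel by (auto simp: infty_ideal_def)

lemma f_nonzero: "f \<noteq> 0"
  using irreducible_f by auto

lemma degree_f: "0 < degree f"
  using irreducible_f f_nonzero is_unit_iff_degree irreducible_not_unit by blast

lemma W_finite: "g \<noteq> 0 \<Longrightarrow> degree g < degree f \<Longrightarrow> W g \<noteq> Infty"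
  using W_Infty_iff dvd_imp_degree_le[of f g] by auto

definition trunc :: "'k poly \<Rightarrow> 'k poly \<Rightarrow> 'g vext" where
  "trunc \<phi> = augment W \<phi> (W \<phi>)"

text \<open>The bound by \<open>degree f\<close> makes \<open>W\<close> finite on all nonzero adic
  coefficients, so that \<open>trunc \<phi>\<close> is a valuation unless
  \<open>W \<phi> = Infty\<close>.\<close>

definition good :: "'k poly \<Rightarrow> bool" where
  "good \<phi> \<longleftrightarrow> lead_coeff \<phi> = 1 \<and> 0 < degree \<phi> \<and> degree \<phi> \<le> degree f \<and>
     pseudo_valuation (trunc \<phi>)"

lemma trunc_small: "degree g < degree \<phi> \<Longrightarrow> trunc \<phi> g = W g"
  by (simp add: trunc_def augment_small)

context
  fixes \<phi> :: "'k poly"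
  assumes deg: "0 < degree \<phi>"
begin

lemma trunc_rec: "trunc \<phi> g = min (W (g mod \<phi>)) (trunc \<phi> (g div \<phi>) + W \<phi>)"
  unfolding trunc_def by (rule augment_rec) (use deg pv_0[OF W] in auto)

lemma trunc_0 [simp]: "trunc \<phi> 0 = Infty"
  using deg pv_0[OF W] by (simp add: trunc_small)

lemma trunc_1 [simp]: "trunc \<phi> 1 = 0"
  using deg pv_1[OF W] by (simp add: trunc_small)

lemma trunc_le: "trunc \<phi> g \<le> W g"
  using deg
proof (induction g rule: poly_div_induct)
  case zero
  then show ?case using pv_0[OF W] by simp
next
  case (div g)
  have "trunc \<phi> g \<le> min (W (g mod \<phi>)) (W (g div \<phi> * \<phi>))"
    using div add_right_mono[of "trunc \<phi> (g div \<phi>)" "W (g div \<phi>)" "W \<phi>"]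
    by (subst trunc_rec) (auto simp: pv_mult[OF W] min_le_iff_disj)
  also have "\<dots> \<le> W (g mod \<phi> + g div \<phi> * \<phi>)" by (rule pv_add[OF W])
  finally show ?case by (simp add: add.commute)
qed

lemma trunc_mult_key: "trunc \<phi> (g * \<phi>) = trunc \<phi> g + W \<phi>"
  using deg pv_0[OF W] by (subst trunc_rec) auto

lemma trunc_key: "trunc \<phi> \<phi> = W \<phi>"
  using trunc_mult_key[of 1] by simp

lemma trunc_mult_key_power: "trunc \<phi> (g * \<phi> ^ n) = trunc \<phi> g + nmul n (W \<phi>)"
proof (induction n)
  case (Suc n)
  have "trunc \<phi> (g * \<phi> ^ Suc n) = trunc \<phi> ((g * \<phi> ^ n) * \<phi>)" by (simp add: mult_ac)
  then show ?case using Suc by (simp only: trunc_mult_key nmul_Suc add.assoc)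
qed simp

lemma trunc_add: "min (trunc \<phi> g) (trunc \<phi> h) \<le> trunc \<phi> (g + h)"
  using deg
proof (induction g arbitrary: h rule: poly_div_induct)
  case (div g)
  have "min (trunc \<phi> g) (trunc \<phi> h)
      = min (min (W (g mod \<phi>)) (W (h mod \<phi>)))
          (min (trunc \<phi> (g div \<phi>)) (trunc \<phi> (h div \<phi>)) + W \<phi>)"
    by (subst (1 2) trunc_rec) (simp add: vext_min_add min.assoc min.left_commute)
  also have "\<dots> \<le> min (W (g mod \<phi> + h mod \<phi>)) (trunc \<phi> (g div \<phi> + h div \<phi>) + W \<phi>)"
    using pv_add[OF W] div by (intro min.mono add_right_mono) auto
  also have "\<dots> = trunc \<phi> (g + h)"
    by (subst (2) trunc_rec) (simp add: poly_div_add_left poly_mod_add_left)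
  finally show ?case .
qed simp

end

section \<open>Multiplicativity of a truncation\<close>

context
  fixes \<phi> :: "'k poly"
  assumes deg: "0 < degree \<phi>"
    and mod_val: "\<And>a b. degree a < degree \<phi> \<Longrightarrow> degree b < degree \<phi> \<Longrightarrow> W ((a * b) mod \<phi>) = W (a * b)"
begin

text \<open>By \<open>mod_val\<close> the carry \<open>(a * b div \<phi>) * \<phi>\<close> is a
  difference of two polynomials of value \<open>W (a * b)\<close>. Its value is at least that, so
  the minimum is taken at the remainder.\<close>

lemma trunc_mult_small:
  assumes "degree a < degree \<phi>" "degree b < degree \<phi>"
  shows "trunc \<phi> (a * b) = W a + W b"
proof -
  have "degree (a * b) < degree \<phi> + degree \<phi>"
    using assms degree_mult_le[of a b] by linarith
  then have d: "degree (a * b div \<phi>) < degree \<phi>"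
    by (simp add: degree_div_poly deg)
  have "min (W (a * b)) (W (a * b mod \<phi>)) \<le> W (a * b - a * b mod \<phi>)"
    by (rule pv_diff[OF W])
  then have "W (a * b) \<le> W (a * b div \<phi> * \<phi>)"
    by (simp add: mod_val assms minus_mod_eq_div_mult)
  then show ?thesis
    by (subst trunc_rec[OF deg])
      (simp add: trunc_small d mod_val assms flip: pv_mult[OF W])
qed

text \<open>Bilinear reduction to \<open>trunc_mult_small\<close>: the inner statement expands
  \<open>h\<close> against a single coefficient, the outer induction expands
  \<open>g\<close>.\<close>

lemma trunc_mult_ge: "trunc \<phi> g + trunc \<phi> h \<le> trunc \<phi> (g * h)"
proof -
  have small: "trunc \<phi> a + trunc \<phi> h \<le> trunc \<phi> (a * h)" if a: "degree a < degree \<phi>" for a h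
    using deg
  proof (induction h rule: poly_div_induct)
    case (div h)
    have "trunc \<phi> a + trunc \<phi> h
        = min (W a + W (h mod \<phi>)) (trunc \<phi> a + trunc \<phi> (h div \<phi>) + W \<phi>)"
      by (subst (2) trunc_rec[OF deg])
        (simp add: trunc_small a vext_min_add add.commute[of "W a"] add.assoc add.left_commute)
    also have "\<dots> \<le> min (trunc \<phi> (a * (h mod \<phi>))) (trunc \<phi> (a * (h div \<phi>) * \<phi>))"
      using div a deg
      by (intro min.mono) (auto simp: trunc_mult_small degree_mod_poly trunc_mult_key intro: add_right_mono)
    also have "\<dots> \<le> trunc \<phi> (a * (h mod \<phi>) + a * (h div \<phi>) * \<phi>)"
      by (rule trunc_add[OF deg])
    also have "a * (h mod \<phi>) + a * (h div \<phi>) * \<phi> = a * h"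
      by (simp add: mult.assoc flip: distrib_left)
    finally show ?case .
  qed (simp add: deg)
  show ?thesis
    using deg
  proof (induction g rule: poly_div_induct)
    case (div g)
    have "trunc \<phi> g + trunc \<phi> h
        = min (trunc \<phi> (g mod \<phi>) + trunc \<phi> h) (trunc \<phi> (g div \<phi>) + trunc \<phi> h + W \<phi>)"
      by (subst trunc_rec[OF deg])
        (simp add: trunc_small degree_mod_poly deg vext_min_add add.assoc add.commute[of "W \<phi>"])
    also have "\<dots> \<le> min (trunc \<phi> ((g mod \<phi>) * h)) (trunc \<phi> ((g div \<phi>) * h * \<phi>))"
      using div deg
      by (intro min.mono small) (auto simp: degree_mod_poly trunc_mult_key intro: add_right_mono)
    also have "\<dots> \<le> trunc \<phi> ((g mod \<phi>) * h + (g div \<phi>) * h * \<phi>)"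
      by (rule trunc_add[OF deg])
    also have "(g mod \<phi>) * h + (g div \<phi>) * h * \<phi> = g * h"
      by (simp add: mult.assoc mult.left_commute[of _ h] mult.commute[of _ h] flip: distrib_left)
    finally show ?case .
  qed (simp add: deg)
qed

text \<open>The lowest terms \<open>a \<phi>\<^sup>i\<close> of minimal value determine the value of a product, since carries from lower
  degrees have strictly larger value.\<close>

lemma trunc_initial:
  assumes "trunc \<phi> g \<noteq> Infty"
  obtains i a b e where "degree a < degree \<phi>" "g = (a + b * \<phi>) * \<phi> ^ i + e"
    "trunc \<phi> g = W a + nmul i (W \<phi>)" "trunc \<phi> g < trunc \<phi> e"
    "trunc \<phi> g \<le> trunc \<phi> b + W \<phi> + nmul i (W \<phi>)"
proof -
  have "\<exists>i a b e. degree a < degree \<phi> \<and> g = (a + b * \<phi>) * \<phi> ^ i + e \<and>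
    trunc \<phi> g = W a + nmul i (W \<phi>) \<and> trunc \<phi> g < trunc \<phi> e \<and>
    trunc \<phi> g \<le> trunc \<phi> b + W \<phi> + nmul i (W \<phi>)"
    using deg assms
  proof (induction g rule: poly_div_induct)
    case zero
    then show ?case by (simp add: deg)
  next
    case (div g)
    note rec = trunc_rec[OF deg, of g]
    have ge: "trunc \<phi> g \<le> trunc \<phi> (g div \<phi>) + W \<phi>" by (subst rec) simp
    show ?case
    proof (cases "trunc \<phi> g = W (g mod \<phi>)")
      case True
      then show ?thesis
        using div.prems ge deg
        by (intro exI[of _ 0] exI[of _ "g mod \<phi>"] exI[of _ "g div \<phi>"])
          (auto simp: degree_mod_poly)
    next
      case False
      then have eq: "trunc \<phi> g = trunc \<phi> (g div \<phi>) + W \<phi>"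
        and less: "trunc \<phi> g < W (g mod \<phi>)"
        using rec by (auto simp: min_def split: if_splits)
      have fin: "W \<phi> \<noteq> Infty" "trunc \<phi> (g div \<phi>) \<noteq> Infty" using div.prems eq by auto
      obtain i a b e where *: "degree a < degree \<phi>" "g div \<phi> = (a + b * \<phi>) * \<phi> ^ i + e"
        "trunc \<phi> (g div \<phi>) = W a + nmul i (W \<phi>)" "trunc \<phi> (g div \<phi>) < trunc \<phi> e"
        "trunc \<phi> (g div \<phi>) \<le> trunc \<phi> b + W \<phi> + nmul i (W \<phi>)"
        using div.IH fin by metis
      have "g = (g div \<phi>) * \<phi> + g mod \<phi>" by simp
      then have "g = (a + b * \<phi>) * \<phi> ^ Suc i + (e * \<phi> + g mod \<phi>)"
        unfolding *(2) by (simp add: algebra_simps)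
      moreover have "trunc \<phi> g < trunc \<phi> (e * \<phi> + g mod \<phi>)"
      proof -
        have "trunc \<phi> g < min (trunc \<phi> (e * \<phi>)) (trunc \<phi> (g mod \<phi>))"
          using less * fin
          by (simp add: eq trunc_mult_key deg trunc_small degree_mod_poly vext_add_cancel)
        then show ?thesis using trunc_add[OF deg] less_le_trans by blast
      qed
      moreover have "trunc \<phi> g \<le> trunc \<phi> b + W \<phi> + nmul (Suc i) (W \<phi>)"
        using add_right_mono[OF *(5), of "W \<phi>"] by (simp add: eq nmul_Suc add.assoc)
      moreover have "trunc \<phi> g = W a + nmul (Suc i) (W \<phi>)"
        by (simp add: eq *(3) nmul_Suc add.assoc)
      ultimately show ?thesis using *(1) by blast
    qed
  qed
  then show ?thesis using that by blast
qed

text \<open>Strip off the initial powers of \<open>\<phi>\<close> and the parts of larger value. The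
  constant coefficient of the remaining product \<open>G * H\<close> is \<open>a * a'\<close> modulo
  \<open>\<phi>\<close>, of value \<open>W a + W a'\<close>, which bounds the value of the product
  from above.\<close>

lemma trunc_mult: "trunc \<phi> (g * h) = trunc \<phi> g + trunc \<phi> h"
proof (cases "trunc \<phi> g = Infty \<or> trunc \<phi> h = Infty")
  case True
  then show ?thesis using trunc_mult_ge[of g h] by auto
next
  case False
  obtain i a b e where 1: "degree a < degree \<phi>" "g = (a + b * \<phi>) * \<phi> ^ i + e"
    "trunc \<phi> g = W a + nmul i (W \<phi>)" "trunc \<phi> g < trunc \<phi> e"
    using False by (blast elim: trunc_initial)
  obtain j a' b' e' where 2: "degree a' < degree \<phi>" "h = (a' + b' * \<phi>) * \<phi> ^ j + e'"
    "trunc \<phi> h = W a' + nmul j (W \<phi>)" "trunc \<phi> h < trunc \<phi> e'"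
    using False by (blast elim: trunc_initial)
  define G H where "G = a + b * \<phi>" and "H = a' + b' * \<phi>"
  have "G * H = a * a' + (a * b' + b * H) * \<phi>"
    by (simp add: G_def H_def algebra_simps)
  then have "(G * H) mod \<phi> = (a * a') mod \<phi>" by simp
  then have "trunc \<phi> (G * H) \<le> W a + W a'"
    by (subst trunc_rec[OF deg]) (simp add: mod_val 1 2 pv_mult[OF W])
  then have "trunc \<phi> (G * H) + nmul (i + j) (W \<phi>) \<le> W a + W a' + nmul (i + j) (W \<phi>)"
    by (rule add_right_mono)
  then have main: "trunc \<phi> (G * H * \<phi> ^ (i + j)) \<le> trunc \<phi> g + trunc \<phi> h"
    by (simp add: trunc_mult_key_power deg 1(3) 2(3) nmul_add add.assoc add.left_commute)
  \<comment> \<open>The error made by replacing \<open>g\<close> and \<open>h\<close> by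
    \<open>g - e\<close> and \<open>h - e'\<close>; by \<open>trunc_mult_ge\<close> it has strictly
    larger value than the product should have.\<close>
  define r where "r = - (G * \<phi> ^ i) * e' + - e * h"
  \<comment> \<open>\<open>pv_minus\<close> is not yet available for \<open>trunc \<phi>\<close>;
    supermultiplicativity with the factor -1, applied twice, replaces it.\<close>
  have minus: "trunc \<phi> (- x) = trunc \<phi> x" for x
  proof -
    have *: "trunc \<phi> x \<le> trunc \<phi> (- x)" for x
      using trunc_mult_ge[of x "- 1"] deg by (simp add: trunc_small pv_minus[OF W] pv_1[OF W])
    show ?thesis using *[of x] *[of "- x"] by simp
  qed
  have Gi: "trunc \<phi> g \<le> trunc \<phi> (G * \<phi> ^ i)"
  proof -
    have "min (trunc \<phi> g) (trunc \<phi> (- e)) \<le> trunc \<phi> (g + - e)" by (rule trunc_add[OF deg])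
    then show ?thesis using 1(2,4) by (simp add: minus G_def)
  qed
  have "trunc \<phi> g + trunc \<phi> h < trunc \<phi> (- (G * \<phi> ^ i) * e')"
    using Gi 2(4) False
    by (intro less_le_trans[OF _ trunc_mult_ge] vext_add_less_le(2)) (auto simp: minus)
  moreover have "trunc \<phi> g + trunc \<phi> h < trunc \<phi> (- e * h)"
    using 1(4) False
    by (intro less_le_trans[OF _ trunc_mult_ge] vext_add_less_le(1)) (auto simp: minus)
  ultimately have r: "trunc \<phi> g + trunc \<phi> h < trunc \<phi> r"
    unfolding r_def by (intro less_le_trans[OF _ trunc_add[OF deg]]) (simp only: min_less_iff_conj)
  have "G * H * \<phi> ^ (i + j) = g * h + r"
    by (simp add: r_def 1(2) 2(2) G_def H_def power_add algebra_simps)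
  then have "min (trunc \<phi> (g * h)) (trunc \<phi> r) \<le> trunc \<phi> g + trunc \<phi> h"
    using main trunc_add[OF deg, of "g * h" r] by simp
  with r have "trunc \<phi> (g * h) \<le> trunc \<phi> g + trunc \<phi> h"
    by (auto simp: min_le_iff_disj)
  then show ?thesis using trunc_mult_ge[of g h] by simp
qed

lemma pseudo_valuation_trunc: "pseudo_valuation (trunc \<phi>)"
  unfolding pseudo_valuation_def using trunc_mult trunc_add deg by simp

end

lemma good_valuation:
  assumes "good \<phi>" "W \<phi> \<noteq> Infty"
  shows "valuation (trunc \<phi>)"
proof -
  have deg: "0 < degree \<phi>" "degree \<phi> \<le> degree f" using assms by (auto simp: good_def)
  have "trunc \<phi> g = Infty \<longrightarrow> g = 0" for g
    using deg(1)
  proof (induction g rule: poly_div_induct)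
    case (div g)
    show ?case
    proof
      assume "trunc \<phi> g = Infty"
      then have "W (g mod \<phi>) = Infty \<and> trunc \<phi> (g div \<phi>) + W \<phi> = Infty"
        using trunc_rec[OF deg(1), of g] by (auto simp: min_def split: if_splits)
      then have "W (g mod \<phi>) = Infty" "g div \<phi> = 0" using div assms(2) by auto
      moreover have "degree (g mod \<phi>) < degree f"
        using deg degree_mod_poly[of \<phi> g] by simp
      ultimately have "g mod \<phi> = 0" using W_finite by blast
      with \<open>g div \<phi> = 0\<close> show "g = 0" by (metis add_0 div_mult_mod_eq mult_zero_left)
    qed
  qed simp
  then show ?thesis using assms by (simp add: valuation_def good_def)
qed

text \<open>This is how a family ends: the degree bound forces a monic multiple of \<open>f\<close>
  to be \<open>f\<close>, and then only the remainder modulo \<open>f\<close> contributes to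
  \<open>W\<close>.\<close>

lemma good_Infty:
  assumes "good \<phi>" "W \<phi> = Infty"
  shows "\<phi> = f" "trunc \<phi> = W"
proof -
  have deg: "0 < degree \<phi>" "degree \<phi> \<le> degree f" and lc: "lead_coeff \<phi> = 1"
    using assms by (auto simp: good_def)
  obtain q where q: "\<phi> = f * q" using assms(2) W_Infty_iff by auto
  with lc have "q \<noteq> 0" by auto
  then have "degree q = 0" using deg q f_nonzero by (simp add: degree_mult_eq)
  then obtain c where "q = [:c:]" using degree_eq_zeroE by blast
  moreover have "lead_coeff q = 1" using q lc monic_f by (simp add: lead_coeff_mult)
  ultimately show "\<phi> = f" using q by (simp add: one_pCons)
  show "trunc \<phi> = W"
  proof
    fix g
    have "W (g div \<phi> * \<phi>) = Infty" using assms(2) by (simp add: pv_mult[OF W])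
    then have "W g = W (g mod \<phi>)"
      using pv_add[OF W, of "g mod \<phi>" "g div \<phi> * \<phi>"] pv_diff[OF W, of g "g div \<phi> * \<phi>"]
      by (simp add: minus_div_mult_eq_mod min_def)
    then show "trunc \<phi> g = W g" by (subst trunc_rec[OF deg(1)]) (simp add: assms(2))
  qed
qed

section \<open>Polynomials whose value increases\<close>

context
  fixes U :: "'k poly \<Rightarrow> 'g vext" and \<psi> :: "'k poly"
  assumes U: "pseudo_valuation U" and U_le: "\<And>g. U g \<le> W g" and U_less: "U \<psi> < W \<psi>"
begin

lemma W_mult_strict: "U q \<noteq> Infty \<Longrightarrow> U (q * \<psi>) < W (q * \<psi>)"
  using vext_add_less_le(2)[OF U_less U_le[of q]] by (simp add: pv_mult[OF U] pv_mult[OF W])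

text \<open>There is no cancellation between \<open>q * \<psi>\<close> and \<open>r\<close>. If
  \<open>U\<close> increased on their sum, then so would \<open>W\<close>, forcing
  \<open>W (q * \<psi>) = W r = U r = U (q * \<psi>)\<close>; but a multiple of
  \<open>\<psi>\<close> of finite value increases from \<open>U\<close> to \<open>W\<close>.\<close>

lemma division_value:
  assumes "U r = W r"
  shows "U (q * \<psi> + r) = min (U r) (U q + U \<psi>)"
proof (cases "U r = U (q * \<psi>)")
  case True
  then have ge: "U r \<le> U (q * \<psi> + r)" using pv_add[OF U, of "q * \<psi>" r] by simp
  have "\<not> U r < U (q * \<psi> + r)"
  proof
    assume less: "U r < U (q * \<psi> + r)"
    then have "W r < W (q * \<psi> + r)" using assms U_le less_le_trans by metis
    then have "W (q * \<psi>) = W r"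
      using pv_diff_eq[OF W, of r "- (q * \<psi>)"] by (simp add: pv_minus[OF W] add.commute)
    moreover have "U q \<noteq> Infty" using less True by (auto simp: pv_mult[OF U])
    ultimately show False using W_mult_strict[of q] True assms by simp
  qed
  with ge True show ?thesis by (simp add: pv_mult[OF U])
next
  case False
  then show ?thesis by (simp add: pv_add_neq[OF U] pv_mult[OF U] min.commute)
qed

text \<open>Agreement is asked only for the adic coefficients of this particular \<open>g\<close>,
  because at a limit \<open>U\<close> has to be chosen depending on \<open>g\<close>.\<close>

lemma trunc_ge:
  assumes "0 < degree \<psi>" "\<And>i. U (adic_coeff \<psi> g i) = W (adic_coeff \<psi> g i)"
  shows "U g \<le> trunc \<psi> g"
  using assms
proof (induction g rule: poly_div_induct)
  case zero
  then show ?case by (simp add: trunc_0 assms(1))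
next
  case (div g)
  have r: "U (g mod \<psi>) = W (g mod \<psi>)" using div.prems[of 0] by (simp add: adic_coeff_0)
  have q: "U (g div \<psi>) \<le> trunc \<psi> (g div \<psi>)"
    using div.prems[of "Suc _"] by (intro div.IH) (simp add: adic_coeff_Suc)
  have "U g = min (U (g mod \<psi>)) (U (g div \<psi>) + U \<psi>)"
    using division_value[OF r, of "g div \<psi>"] by simp
  also have "\<dots> \<le> min (W (g mod \<psi>)) (trunc \<psi> (g div \<psi>) + W \<psi>)"
    using r q U_less by (intro min.mono add_mono) auto
  also have "\<dots> = trunc \<psi> g" by (rule trunc_rec[symmetric]) (rule assms(1))
  finally show ?case .
qed

text \<open>This delivers the condition under which truncations are multiplicative. If the remainder
  had another value than \<open>a * b\<close>, the minimum in \<open>division_value\<close> would be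
  taken only at the multiple of \<open>\<psi>\<close>, whose \<open>U\<close>- and
  \<open>W\<close>-values would then coincide.\<close>

lemma W_mod_eq:
  assumes "U a = W a" "U b = W b" "U ((a * b) mod \<psi>) = W ((a * b) mod \<psi>)"
  shows "W ((a * b) mod \<psi>) = W (a * b)"
proof (rule ccontr)
  let ?q = "(a * b) div \<psi>" and ?r = "(a * b) mod \<psi>"
  assume neq: "W ?r \<noteq> W (a * b)"
  have ab: "U (a * b) = W (a * b)" by (simp add: pv_mult[OF U] pv_mult[OF W] assms)
  moreover have "U (a * b) = min (U ?r) (U (?q * \<psi>))"
    using division_value[OF assms(3), of ?q] by (simp add: pv_mult[OF U])
  ultimately have *: "U (a * b) = U (?q * \<psi>)" "W (a * b) < W ?r"
    using neq assms(3) by (auto simp: min_def split: if_splits)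
  then have "W (a * b + - ?r) = W (a * b)"
    by (intro pv_add_eq[OF W]) (simp add: pv_minus[OF W])
  then have "W (?q * \<psi>) = U (?q * \<psi>)"
    using * ab by (simp add: minus_mod_eq_div_mult)
  moreover have "U ?q \<noteq> Infty" using * ab by (auto simp: pv_mult[OF U])
  ultimately show False using W_mult_strict[of ?q] by simp
qed

context
  assumes U_Infty: "\<And>g. U g = Infty \<Longrightarrow> g = 0"
    and monic: "lead_coeff \<psi> = 1" and deg: "0 < degree \<psi>"
    and agree: "\<And>g. degree g < degree \<psi> \<Longrightarrow> U g = W g"
begin

text \<open>Forwards, \<open>g\<close> is a multiple of \<open>\<psi>\<close>, which increases, plus
  something of larger value. Backwards, an increase of \<open>g\<close> forces the remainder modulo
  \<open>\<psi>\<close> to have \<open>U\<close>-value above \<open>U g\<close>, so \<open>g\<close>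
  is equivalent to \<open>(g div \<psi>) * \<psi>\<close>. For \<open>g = 0\<close> both values are
  \<open>Infty\<close>, although \<open>\<psi>\<close> divides it.\<close>

lemma divides_in_iff:
  assumes "g \<noteq> 0"
  shows "divides_in U \<psi> g \<longleftrightarrow> U g < W g"
proof
  assume "divides_in U \<psi> g"
  then obtain a where "equiv_in U g (a * \<psi>)" by (auto simp: divides_in_def)
  then have less: "min (U g) (U (a * \<psi>)) < U (g - a * \<psi>)"
    using assms U_Infty by (auto simp: equiv_in_def)
  then have eq: "U (a * \<psi>) = U g"
    using pv_diff_eq[OF U, of g "a * \<psi>"] pv_diff_eq[OF U, of "a * \<psi>" g]
    by (auto simp: min_def pv_minus[OF U, of "g - a * \<psi>", simplified] split: if_splits)
  then have "U a \<noteq> Infty" using U_Infty[of g] assms by (auto simp: pv_mult[OF U])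
  then have 1: "U g < W (a * \<psi>)" using W_mult_strict[of a] eq by simp
  have 2: "U g < W (g - a * \<psi>)" using less eq U_le less_le_trans by fastforce
  show "U g < W g"
    using pv_add_strict[OF W 2 1] by simp
next
  assume less: "U g < W g"
  let ?q = "g div \<psi>" and ?r = "g mod \<psi>"
  have r: "U ?r = W ?r" by (simp add: agree degree_mod_poly deg)
  have *: "U g = min (U ?r) (U (?q * \<psi>))"
    using division_value[OF r, of ?q] by (simp add: pv_mult[OF U])
  have "U g < U ?r"
  proof (rule ccontr)
    assume "\<not> U g < U ?r"
    then have eq: "U g = W ?r" using * r by (auto simp: min_def split: if_splits)
    have "W (?q * \<psi>) = W ?r"
      using pv_diff_eq[OF W, of ?r "- (?q * \<psi>)"] less eq
      by (simp add: pv_minus[OF W] add.commute)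
    moreover have "U g \<le> U (?q * \<psi>)" using * by simp
    ultimately have "W (?q * \<psi>) \<le> U (?q * \<psi>)" using eq by simp
    then have "U ?q = Infty" using W_mult_strict[of ?q] by (meson not_le)
    then have "W (?q * \<psi>) = Infty" using U_le[of ?q] by (simp add: pv_mult[OF W])
    then show False using \<open>W (?q * \<psi>) = W ?r\<close> eq less by simp
  qed
  then have "min (U g) (U (?q * \<psi>)) < U ?r" by (rule min.strict_coboundedI1)
  then have "equiv_in U g (?q * \<psi>)"
    by (simp only: equiv_in_def minus_div_mult_eq_mod simp_thms)
  then show "divides_in U \<psi> g" by (auto simp: divides_in_def)
qed

lemma divides_in_0: "divides_in U \<psi> 0"
  by (auto simp: divides_in_def equiv_in_def pv_0[OF U] intro!: exI[of _ 0])

text \<open>Irreducibility is multiplicativity: as \<open>U \<le> W\<close> and both are additive on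
  products, \<open>a * b\<close> increases only if \<open>a\<close> or \<open>b\<close> does.
  Equivalence with \<open>\<phi>\<close> is impossible because \<open>\<phi>\<close> does not
  increase.\<close>

lemma key_polynomialI:
  assumes "degree \<phi> \<le> degree \<psi>" "U \<phi> = W \<phi>"
  shows "key_polynomial U \<phi> \<psi> (W \<psi>)"
  unfolding key_polynomial_def
proof (intro conjI allI impI)
  show "equiv_irreducible U \<psi>"
    unfolding equiv_irreducible_def
  proof (intro allI impI)
    fix a b assume *: "divides_in U \<psi> (a * b)"
    show "divides_in U \<psi> a \<or> divides_in U \<psi> b"
    proof (cases "a = 0 \<or> b = 0")
      case True
      then show ?thesis using divides_in_0 by auto
    next
      case False
      then have "U (a * b) < W (a * b)" using * divides_in_iff[of "a * b"] by simp
      then have "U a < W a \<or> U b < W b"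
        using U_le[of a] U_le[of b] by (auto simp: pv_mult[OF U] pv_mult[OF W] order_le_less)
      then show ?thesis using False divides_in_iff by blast
    qed
  qed
  show "degree \<psi> \<le> degree g" if "g \<noteq> 0 \<and> divides_in U \<psi> g" for g
    using that divides_in_iff agree by (metis not_le order_less_irrefl)
  show "\<not> equiv_in U \<psi> \<phi>"
  proof
    assume "equiv_in U \<psi> \<phi>"
    moreover have "U \<psi> \<noteq> Infty" using U_less by auto
    ultimately have less: "min (U \<psi>) (U \<phi>) < U (\<psi> - \<phi>)" by (auto simp: equiv_in_def)
    then have eq: "U \<psi> = U \<phi>"
      using pv_diff_eq[OF U, of \<psi> \<phi>] pv_diff_eq[OF U, of \<phi> \<psi>]
      by (auto simp: min_def pv_minus[OF U, of "\<psi> - \<phi>", simplified] split: if_splits)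
    then have "W \<phi> < W (\<psi> - \<phi>)" using less U_le[of "\<psi> - \<phi>"] assms(2) by simp
    then have "W \<psi> = W \<phi>"
      using pv_add_eq'[OF W, of \<phi> "\<psi> - \<phi>"] by simp
    then show False using U_less eq assms(2) by simp
  qed
qed (use assms monic deg U_less in auto)

end

end

text \<open>The valuation \<open>U\<close> may depend on the finite set \<open>G\<close>. It is used
  for \<open>a\<close>, \<open>b\<close> and the remainder of \<open>a * b\<close>; the freedom is
  needed for limit key polynomials.\<close>

lemma goodI:
  assumes "lead_coeff \<psi> = 1" "0 < degree \<psi>" "degree \<psi> \<le> degree f"
    and "\<And>G. finite G \<Longrightarrow> (\<And>g. g \<in> G \<Longrightarrow> degree g < degree \<psi>) \<Longrightarrow>
      \<exists>U. pseudo_valuation U \<and> (\<forall>g. U g \<le> W g) \<and> U \<psi> < W \<psi> \<and> (\<forall>g\<in>G. U g = W g)"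
  shows "good \<psi>"
  unfolding good_def
proof (intro conjI assms pseudo_valuation_trunc)
  fix a b :: "'k poly" assume "degree a < degree \<psi>" "degree b < degree \<psi>"
  then obtain U where "pseudo_valuation U" "\<forall>g. U g \<le> W g" "U \<psi> < W \<psi>"
    "U a = W a" "U b = W b" "U (a * b mod \<psi>) = W (a * b mod \<psi>)"
    using assms(4)[of "{a, b, a * b mod \<psi>}"] degree_mod_poly[OF assms(2)] by auto
  then show "W (a * b mod \<psi>) = W (a * b)"
    by (intro W_mod_eq[of U]) auto
qed

section \<open>Successors of a good polynomial\<close>

definition successor :: "'k poly \<Rightarrow> 'k poly \<Rightarrow> bool" where
  "successor \<phi> \<psi> \<longleftrightarrow> lead_coeff \<psi> = 1 \<and> trunc \<phi> \<psi> < W \<psi> \<and>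
     (\<forall>g. degree g < degree \<psi> \<longrightarrow> trunc \<phi> g = W g)"

lemma good_degree: "good \<phi> \<Longrightarrow> 0 < degree \<phi>"
  by (simp add: good_def)

lemma good_pseudo_valuation: "good \<phi> \<Longrightarrow> pseudo_valuation (trunc \<phi>)"
  by (simp add: good_def)

lemma trunc_f_less:
  assumes "good \<phi>" "W \<phi> \<noteq> Infty"
  shows "trunc \<phi> f < W f"
  using good_valuation[OF assms] f_nonzero W_Infty_iff[of f] by (auto simp: valuation_def)

context
  fixes \<phi> \<psi>
  assumes good: "good \<phi>" and fin: "W \<phi> \<noteq> Infty" and succ: "successor \<phi> \<psi>"
begin

lemma successor_degree: "degree \<phi> \<le> degree \<psi>"
  using succ trunc_small[of \<psi> \<phi>] by (auto simp: successor_def not_less[symmetric])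

text \<open>Here \<open>U = trunc \<phi>\<close> works for every finite set. The degree bound holds
  because \<open>f\<close> itself increases from \<open>trunc \<phi>\<close> to
  \<open>W\<close>.\<close>

lemma successor_good: "good \<psi>"
proof (rule goodI)
  show "0 < degree \<psi>" using good successor_degree by (auto simp: good_def)
  show "degree \<psi> \<le> degree f"
    using trunc_f_less[OF good fin] succ by (auto simp: successor_def not_less[symmetric])
  show "\<exists>U. pseudo_valuation U \<and> (\<forall>g. U g \<le> W g) \<and> U \<psi> < W \<psi> \<and> (\<forall>g\<in>G. U g = W g)"
    if "\<And>g. g \<in> G \<Longrightarrow> degree g < degree \<psi>" for G
    using that good succ trunc_le
    by (intro exI[of _ "trunc \<phi>"]) (auto simp: good_def successor_def)
qed (use succ in \<open>auto simp: successor_def\<close>)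

lemma successor_trunc_le: "trunc \<phi> g \<le> trunc \<psi> g"
  using good succ trunc_le good_degree[OF successor_good]
  by (intro trunc_ge) (auto simp: good_def successor_def adic_coeff_degree)

lemma successor_key_polynomial: "key_polynomial (trunc \<phi>) \<phi> \<psi> (W \<psi>)"
  using good succ trunc_le good_degree[OF successor_good] good_valuation[OF good fin] successor_degree
  by (intro key_polynomialI) (auto simp: good_def successor_def valuation_def trunc_key)

lemma successor_augment: "augment (trunc \<phi>) \<psi> (W \<psi>) = trunc \<psi>"
  unfolding trunc_def[of \<psi>] using succ
  by (intro augment_cong good_degree[OF successor_good]) (auto simp: successor_def)

end

end

section \<open>Algebraicity of values and residues\<close>

text \<open>Dependence in a vector space is a property of sets, so a repetition
  \<open>v i = v j\<close> is treated separately, with coefficients 1 and -1.\<close>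

lemma poly_linear_dependence:
  fixes v :: "nat \<Rightarrow> 'k::field poly"
  assumes "\<And>i. degree (v i) < n"
  obtains a i where "i \<le> n" "a i \<noteq> 0" "(\<Sum>i\<le>n. smult (a i) (v i)) = 0"
proof -
  interpret vector_space "smult :: 'k \<Rightarrow> 'k poly \<Rightarrow> 'k poly"
    by unfold_locales (auto simp: smult_add_right smult_add_left)
  show ?thesis
  proof (cases "inj_on v {..n}")
    case True
    let ?B = "monom (1::'k) ` {..<n}"
    have span: "v i \<in> span ?B" for i
    proof -
      have "v i = (\<Sum>k\<le>n. monom (coeff (v i) k) k)"
        using assms[of i] by (simp add: poly_as_sum_of_monoms')
      also have "\<dots> = (\<Sum>k<n. smult (coeff (v i) k) (monom 1 k))"
        using assms[of i] by (simp add: lessThan_Suc_atMost[symmetric] smult_monom coeff_eq_0)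
      also have "\<dots> \<in> span ?B" by (intro span_sum span_scale span_base) auto
      finally show ?thesis .
    qed
    have "dependent (v ` {..n})"
    proof (rule ccontr)
      assume "\<not> dependent (v ` {..n})"
      then have "card (v ` {..n}) \<le> card ?B"
        using span independent_span_bound[of ?B "v ` {..n}"] by auto
      also have "\<dots> \<le> n" using card_image_le[of "{..<n}" "monom (1::'k)"] by simp
      finally show False using True by (simp add: card_image)
    qed
    then obtain u x where "x \<in> v ` {..n}" "u x \<noteq> 0" "(\<Sum>x\<in>v ` {..n}. smult (u x) x) = 0"
      by (subst (asm) dependent_finite) auto
    then show ?thesis using that[of _ "\<lambda>i. u (v i)"] True by (auto simp: sum.reindex)
  next
    case False
    then obtain i j where ij: "i \<le> n" "j \<le> n" "i \<noteq> j" "v i = v j" by (auto simp: inj_on_def)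
    define a :: "nat \<Rightarrow> 'k" where "a = (\<lambda>k. if k = i then 1 else if k = j then - 1 else 0)"
    have "(\<Sum>k\<le>n. smult (a k) (v k)) = (\<Sum>k\<in>{i, j}. smult (a k) (v k))"
      by (rule sum.mono_neutral_right) (use ij in \<open>auto simp: a_def\<close>)
    also have "\<dots> = 0" using ij by (auto simp: a_def)
    finally show ?thesis using that[of i a] ij by (simp add: a_def)
  qed
qed

lemma pv_sum_unique_min:
  fixes V :: "'b::idom \<Rightarrow> 'g::linordered_ab_group_add vext"
  assumes V: "pseudo_valuation V" and A: "finite A" "i \<in> A"
    and min: "\<And>j. j \<in> A \<Longrightarrow> j \<noteq> i \<Longrightarrow> V (g i) < V (g j)"
  shows "V (sum g A) = V (g i)"
proof (cases "A = {i}")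
  case False
  then obtain j where "j \<in> A" "j \<noteq> i" using A by auto
  then have "V (g i) < V (g j)" by (rule min)
  then have "V (g i) \<noteq> Infty" by auto
  then have "V (g i) < V (sum g (A - {i}))" by (intro pv_sum_strict[OF V]) (use min in auto)
  then show ?thesis using A by (simp add: sum.remove pv_add_eq[OF V])
qed simp

context pseudo_valuation_kernel
begin

text \<open>K[z]/(f) has dimension \<open>degree f\<close>, so the powers of \<open>u\<close> with
  exponents 0 to \<open>degree f\<close> are dependent modulo \<open>f\<close>.\<close>

lemma exists_annihilator:
  obtains p where "p \<noteq> 0" "f dvd pcompose p u"
proof -
  obtain a i where a: "i \<le> degree f" "a i \<noteq> 0"
    and rel: "(\<Sum>i\<le>degree f. smult (a i) (u ^ i mod f)) = 0"
    using poly_linear_dependence[of "\<lambda>i. u ^ i mod f" "degree f"] degree_mod_poly[OF degree_f]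
    by blast
  define p where "p = (\<Sum>i\<le>degree f. monom (a i) i)"
  have "coeff p i = a i" using a(1) by (simp add: p_def coeff_sum)
  then have "p \<noteq> 0" using a(2) by auto
  have "pcompose (monom c k) u = smult c (u ^ k)" for c k
    by (induction k) (simp_all add: monom_0 monom_Suc pcompose_pCons)
  then have "pcompose p u = (\<Sum>i\<le>degree f. smult (a i) (u ^ i))"
    by (simp add: p_def pcompose_sum)
  also have "\<dots> = (\<Sum>i\<le>degree f. smult (a i) (u ^ i - u ^ i mod f))"
    using rel by (simp add: smult_diff_right sum_subtractf)
  also have "f dvd \<dots>" by (intro dvd_sum dvd_smult) simp
  finally show ?thesis using that \<open>p \<noteq> 0\<close> by blast
qed

text \<open>An annihilating polynomial evaluated at \<open>h\<close> has value \<open>Infty\<close>,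
  so its least term value is finite and occurs twice, at exponents k < l say. Then (l - k) times
  \<open>\<gamma>\<close> is the value of the quotient of the two coefficients.\<close>

lemma value_torsion:
  assumes "W h = Fin \<gamma>"
  obtains n c where "0 < n" "c \<noteq> 0" "W [:c:] = Fin (nmul n \<gamma>)"
proof -
  note witness = that
  obtain p where p: "p \<noteq> 0" "f dvd pcompose p h" by (rule exists_annihilator)
  define I where "I = {i. i \<le> degree p \<and> coeff p i \<noteq> 0}"
  define t where "t = (\<lambda>i. smult (coeff p i) (h ^ i))"
  define v where "v = (\<lambda>i. W (t i))"
  have I: "finite I" "degree p \<in> I" using p by (auto simp: I_def)
  have "pcompose p h = (\<Sum>i\<le>degree p. t i)"
    by (simp add: pcompose_altdef poly_altdef coeff_map_poly degree_map_poly t_def)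
  also have "\<dots> = (\<Sum>i\<in>I. t i)"
    by (rule sum.mono_neutral_right) (auto simp: I_def t_def)
  finally have sum: "W (\<Sum>i\<in>I. t i) = Infty" using p W_Infty_iff by simp
  have v: "v i = W [:coeff p i:] + Fin (nmul i \<gamma>)" for i
  proof -
    have "t i = [:coeff p i:] * h ^ i" by (simp add: t_def)
    then show ?thesis by (simp only: v_def pv_mult[OF W] pv_power[OF W] assms nmul_Fin)
  qed
  have const: "W [:c:] \<noteq> Infty" if "c \<noteq> 0" for c using that degree_f by (intro W_finite) auto
  have "Min (v ` I) \<in> v ` I" using I by (intro Min_in) auto
  then obtain i where i: "i \<in> I" "v i = Min (v ` I)" by auto
  have "v i \<noteq> Infty" using i const by (auto simp: v I_def)
  have "\<exists>j\<in>I. j \<noteq> i \<and> v j = v i"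
  proof (rule ccontr)
    assume *: "\<not> ?thesis"
    have "v i < v j" if "j \<in> I" "j \<noteq> i" for j
    proof -
      have "v i \<le> v j" using that I i by simp
      then show ?thesis using * that by force
    qed
    then have "W (\<Sum>i\<in>I. t i) = v i" using pv_sum_unique_min[OF W I(1) i(1), of t] by (simp add: v_def)
    then show False using sum \<open>v i \<noteq> Infty\<close> by simp
  qed
  then obtain j where j: "j \<in> I" "j \<noteq> i" "v j = v i" by blast
  have goal: thesis if kl: "k < l" "k \<in> I" "l \<in> I" "v k = v l" for k l
  proof -
    define c where "c = coeff p k / coeff p l"
    have nz: "coeff p k \<noteq> 0" "coeff p l \<noteq> 0" using kl by (auto simp: I_def)
    obtain x y where xy: "W [:coeff p k:] = Fin x" "W [:coeff p l:] = Fin y"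
      using const[OF nz(1)] const[OF nz(2)] unfolding not_Infty_iff by blast
    have "[:c:] * [:coeff p l:] = [:coeff p k:]" using nz by (simp add: c_def)
    then have "W [:c:] + Fin y = Fin x" using xy pv_mult[OF W, of "[:c:]" "[:coeff p l:]"] by simp
    moreover have "nmul l \<gamma> = nmul (l - k) \<gamma> + nmul k \<gamma>"
      using kl by (simp flip: nmul_add)
    ultimately have "W [:c:] = Fin (nmul (l - k) \<gamma>)"
      using kl(4) xy by (cases "W [:c:]") (auto simp: v algebra_simps)
    then show thesis using witness[of "l - k" c] kl nz by (simp add: c_def)
  qed
  show thesis using goal[of i j] goal[of j i] j i by (cases "i < j") auto
qed

text \<open>An annihilating polynomial \<open>pCons a q\<close> of least degree has
  \<open>a \<noteq> 0\<close>, since otherwise \<open>h\<close> could be cancelled from the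
  relation; solving for 1 gives the inverse.\<close>

lemma exists_inverse_mod:
  assumes "W h \<noteq> Infty"
  obtains h' where "W (h * h' - 1) = Infty"
proof -
  have "\<exists>p. p \<noteq> 0 \<and> f dvd pcompose p h" using exists_annihilator by blast
  then have "\<exists>p. (p \<noteq> 0 \<and> f dvd pcompose p h) \<and>
      (\<forall>q. q \<noteq> 0 \<and> f dvd pcompose q h \<longrightarrow> degree p \<le> degree q)"
    by (rule exE) (rule ex_has_least_nat)
  then obtain p where p: "p \<noteq> 0" "f dvd pcompose p h"
    and least: "\<And>q. q \<noteq> 0 \<Longrightarrow> f dvd pcompose q h \<Longrightarrow> degree p \<le> degree q"
    by blast
  obtain a q where aq: "p = pCons a q" by (cases p) auto
  have "a \<noteq> 0"
  proof
    assume "a = 0"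
    then have "q \<noteq> 0" "W (h * pcompose q h) = Infty"
      using p aq by (auto simp: pcompose_pCons W_Infty_iff)
    then have "f dvd pcompose q h" using assms by (auto simp: pv_mult[OF W] W_Infty_iff)
    then show False using least[of q] aq \<open>q \<noteq> 0\<close> by simp
  qed
  define h' where "h' = smult (- inverse a) (pcompose q h)"
  have "h * h' - 1 = smult (- inverse a) (pcompose p h)"
    using \<open>a \<noteq> 0\<close> by (simp add: h'_def aq pcompose_pCons smult_add_right one_pCons)
  then have "W (h * h' - 1) = Infty" using p W_Infty_iff by (simp add: dvd_smult)
  then show thesis by (rule that)
qed

end

locale residually_closed_extension = pseudo_valuation_kernel W f
  for W :: "'k::field poly \<Rightarrow> 'g::linordered_ab_group_add vext" and f :: "'k poly" +
  fixes \<nu> :: "'k \<Rightarrow> 'g vext"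
  assumes \<nu>: "valuation \<nu>"
    and residue: "\<exists>F. alg_closed_subfield F \<and> residue_field_iso \<nu> F"
    and W_const: "W [:a:] = \<nu> a"
    and f_integral: "in_val_ring_poly \<nu> f"
begin

lemma pv_\<nu>: "pseudo_valuation \<nu>"
  using \<nu> by (simp add: valuation_def)

lemma \<nu>_Infty: "\<nu> a = Infty \<longleftrightarrow> a = 0"
  using \<nu> pv_0[OF pv_\<nu>] by (auto simp: valuation_def)

lemma val_ring_closed:
  "0 \<in> val_ring \<nu>" "1 \<in> val_ring \<nu>"
  "a \<in> val_ring \<nu> \<Longrightarrow> b \<in> val_ring \<nu> \<Longrightarrow> a + b \<in> val_ring \<nu>"
  "a \<in> val_ring \<nu> \<Longrightarrow> b \<in> val_ring \<nu> \<Longrightarrow> a - b \<in> val_ring \<nu>"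
  "a \<in> val_ring \<nu> \<Longrightarrow> b \<in> val_ring \<nu> \<Longrightarrow> a * b \<in> val_ring \<nu>"
  using pv_0[OF pv_\<nu>] pv_1[OF pv_\<nu>] pv_add[OF pv_\<nu>, of a b] pv_diff[OF pv_\<nu>, of a b]
  by (auto simp: val_ring_def pv_mult[OF pv_\<nu>] intro: order_trans[of _ "min _ _"])

lemma W_pcompose_pos:
  assumes "\<And>i. 0 < \<nu> (coeff p i)" "0 \<le> W u"
  shows "0 < W (pcompose p u)"
  using assms(1)
proof (induction p)
  case (pCons a p)
  have "0 < \<nu> a" "\<And>i. 0 < \<nu> (coeff p i)"
    using pCons.prems[of 0] pCons.prems[of "Suc _"] by auto
  then have "0 < W (pcompose p u)" using pCons.IH by blast
  then have "0 < W (u * pcompose p u)"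
    using assms(2) by (simp add: pv_mult[OF W] add_nonneg_pos)
  then show ?case using \<open>0 < \<nu> a\<close> by (simp add: pcompose_pCons pv_add_strict[OF W] W_const)
qed (simp add: pv_0[OF W])

text \<open>The reduction of \<open>p\<close> has a root in the algebraically closed residue field;
  lift it to \<open>c\<close> and split off \<open>z - c\<close>. Either \<open>u\<close> is
  congruent to \<open>c\<close>, or the quotient satisfies the same hypotheses in smaller
  degree.\<close>

lemma residue_root:
  assumes "\<And>i. coeff p i \<in> val_ring \<nu>" "\<not> (\<forall>i. 0 < \<nu> (coeff p i))"
    and u: "0 \<le> W u" and "0 < W (pcompose p u)"
  shows "\<exists>c\<in>val_ring \<nu>. 0 < W (u - [:c:])"
proof -
  obtain F where F: "alg_closed_subfield F" "residue_field_iso \<nu> F" using residue by blast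
  then obtain \<pi> where \<pi>: "\<pi> ` val_ring \<nu> = F" "\<pi> 1 = (1::'k)"
    "\<And>x y. x \<in> val_ring \<nu> \<Longrightarrow> y \<in> val_ring \<nu> \<Longrightarrow> \<pi> (x + y) = \<pi> x + \<pi> y \<and> \<pi> (x * y) = \<pi> x * \<pi> y"
    "{x \<in> val_ring \<nu>. \<pi> x = 0} = val_maxideal \<nu>"
    unfolding residue_field_iso_def by blast
  have "\<pi> (0 + 0) = \<pi> 0 + \<pi> 0" using \<pi>(3) val_ring_closed(1) by blast
  then have \<pi>0: "\<pi> 0 = 0" by (metis add.right_neutral add_left_imp_eq)
  have ker: "\<pi> x = 0 \<longleftrightarrow> 0 < \<nu> x" if "x \<in> val_ring \<nu>" for x
    using \<pi>(4) that by (auto simp: val_maxideal_def)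
  \<comment> \<open>Horner's scheme stays inside the valuation ring, so evaluation commutes with
    \<open>\<pi>\<close> and the quotient by \<open>z - c\<close> is again integral.\<close>
  have poly: "poly q c \<in> val_ring \<nu> \<and> \<pi> (poly q c) = poly (map_poly \<pi> q) (\<pi> c) \<and>
      (\<forall>i. coeff (synthetic_div q c) i \<in> val_ring \<nu>)"
    if "c \<in> val_ring \<nu>" "\<And>i. coeff q i \<in> val_ring \<nu>" for c q
    using that(2)
  proof (induction q)
    case (pCons a q)
    have "a \<in> val_ring \<nu>" and q: "\<And>i. coeff q i \<in> val_ring \<nu>"
      using pCons.prems[of 0] pCons.prems[of "Suc _"] by auto
    have IH: "poly q c \<in> val_ring \<nu>" "\<pi> (poly q c) = poly (map_poly \<pi> q) (\<pi> c)"
      "\<And>i. coeff (synthetic_div q c) i \<in> val_ring \<nu>"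
      using pCons.IH[OF q] by auto
    show ?case
      using \<open>a \<in> val_ring \<nu>\<close> IH that(1) pCons.hyps \<pi>(3) \<pi>0
      by (auto simp: val_ring_closed map_poly_pCons coeff_pCons split: nat.split)
  qed (simp add: val_ring_closed \<pi>0)
  show ?thesis
    using assms(1,2,4)
  proof (induction "degree p" arbitrary: p rule: less_induct)
    case less
    let ?P = "map_poly \<pi> p"
    have cP: "coeff ?P i = \<pi> (coeff p i)" for i using \<pi>0 by (simp add: coeff_map_poly)
    \<comment> \<open>A reduction of degree 0 would be a nonzero constant, since some coefficient of
      \<open>p\<close> is a unit. Then \<open>p\<close> at \<open>u\<close> would be a unit plus
      something of positive value.\<close>
    have "0 < degree ?P"
    proof (rule ccontr)
      assume *: "\<not> 0 < degree ?P"
      obtain a q where aq: "p = pCons a q" by (cases p) auto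
      have q: "0 < \<nu> (coeff q i)" for i
        using * cP[of "Suc i"] less.prems(1)[of "Suc i"] ker by (simp add: aq coeff_eq_0)
      have a: "a \<in> val_ring \<nu>" using less.prems(1)[of 0] aq by simp
      have "\<not> 0 < \<nu> a"
      proof
        assume "0 < \<nu> a"
        then have "0 < \<nu> (coeff p i)" for i using q aq by (cases i) auto
        then show False using less.prems(2) by blast
      qed
      then have "\<nu> a = 0" using a by (simp add: val_ring_def order_le_less)
      have "0 < W (u * pcompose q u)"
        using W_pcompose_pos[OF q u] u by (simp add: pv_mult[OF W] add_nonneg_pos)
      then have "W ([:a:] + u * pcompose q u) = 0"
        using \<open>\<nu> a = 0\<close> by (simp add: pv_add_eq[OF W] W_const)
      then show False using less.prems(3) aq by (simp add: pcompose_pCons)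
    qed
    moreover have "coeff ?P i \<in> F" for i using cP less.prems(1) \<pi>(1) by auto
    ultimately obtain r where "r \<in> F" "poly ?P r = 0"
      using F(1) unfolding alg_closed_subfield_def by blast
    then obtain c where c: "c \<in> val_ring \<nu>" "poly ?P (\<pi> c) = 0" using \<pi>(1) by auto
    define q where "q = synthetic_div p c"
    have q: "coeff q i \<in> val_ring \<nu>" for i using poly[OF c(1) less.prems(1)] by (simp add: q_def)
    have pc: "0 < \<nu> (poly p c)" using poly[OF c(1) less.prems(1)] c(2) ker by metis
    have p: "[:- c, 1:] * q + [:poly p c:] = p" unfolding q_def by (rule synthetic_div_correct')
    have "pcompose [:- c, 1:] u = u - [:c:]"
      by (simp add: pcompose_pCons)
    moreover have "pcompose p u = pcompose ([:- c, 1:] * q + [:poly p c:]) u" by (simp only: p)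
    ultimately have pu: "pcompose p u = (u - [:c:]) * pcompose q u + [:poly p c:]"
      by (simp only: pcompose_add pcompose_mult pcompose_const)
    show ?case
    proof (cases "0 < W (u - [:c:])")
      case True
      then show ?thesis using c by blast
    next
      case False
      have "min (W u) (W [:c:]) \<le> W (u - [:c:])" by (rule pv_diff[OF W])
      moreover have "0 \<le> W [:c:]" using c by (simp add: W_const val_ring_def)
      ultimately have 0: "W (u - [:c:]) = 0"
        using u False by (auto simp: min_def split: if_splits)
      have "0 < W (pcompose p u - [:poly p c:])"
        using less.prems(3) pc by (simp add: pv_diff_strict[OF W] W_const)
      also have "\<dots> = W (pcompose q u)" by (simp add: pu pv_mult[OF W] 0)
      finally have qu: "0 < W (pcompose q u)" .
      \<comment> \<open>Otherwise \<open>p\<close>, which is \<open>(z - c) * q\<close> plus the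
        constant \<open>poly p c\<close> of positive value, would have all its coefficients in the
        maximal ideal.\<close>
      have "\<not> (\<forall>i. 0 < \<nu> (coeff q i))"
      proof
        assume pos: "\<forall>i. 0 < \<nu> (coeff q i)"
        have "0 < \<nu> (coeff p i)" for i
        proof -
          have *: "0 < \<nu> (c * coeff q i)" using pos c
            by (auto simp: pv_mult[OF pv_\<nu>] val_ring_def intro: add_nonneg_pos)
          have **: "0 < \<nu> (coeff (pCons (poly p c) q) i)"
            using pos pc by (auto simp: coeff_pCons split: nat.split)
          have "p = pCons (poly p c) q - smult c q" by (subst p[symmetric]) simp
          then have "coeff p i = coeff (pCons (poly p c) q) i - c * coeff q i"
            by (metis coeff_diff coeff_smult)
          then show ?thesis
            using pv_diff_strict[OF pv_\<nu> ** *] by simp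
        qed
        then show False using less.prems(2) by blast
      qed
      moreover have "degree q < degree p"
      proof -
        have "0 < degree p" using \<open>0 < degree ?P\<close> map_poly_degree_leq[of \<pi> p] by linarith
        then show ?thesis by (simp add: q_def degree_synthetic_div)
      qed
      ultimately show ?thesis using less.hyps[of q] q qu by blast
    qed
  qed
qed

text \<open>Dividing an annihilating polynomial by a coefficient of least value makes it integral
  with one coefficient equal to 1, which is the form that \<open>residue_root\<close> needs.\<close>

lemma exists_residue:
  assumes "W u = 0"
  obtains c where "\<nu> c = 0" "0 < W (u - [:c:])"
proof -
  obtain p where p: "p \<noteq> 0" "f dvd pcompose p u" by (rule exists_annihilator)
  define I where "I = {i. i \<le> degree p \<and> coeff p i \<noteq> 0}"
  have I: "finite I" "degree p \<in> I" using p by (auto simp: I_def)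
  have "Min ((\<lambda>i. \<nu> (coeff p i)) ` I) \<in> (\<lambda>i. \<nu> (coeff p i)) ` I" using I by (intro Min_in) auto
  then obtain k where k: "k \<in> I" "\<nu> (coeff p k) = Min ((\<lambda>i. \<nu> (coeff p i)) ` I)" by auto
  have nz: "coeff p k \<noteq> 0" using k by (simp add: I_def)
  have min: "\<nu> (coeff p k) \<le> \<nu> (coeff p i)" for i
  proof (cases "i \<in> I")
    case False
    then have "coeff p i = 0" using le_degree[of p i] by (auto simp: I_def)
    then show ?thesis by (simp add: pv_0[OF pv_\<nu>])
  qed (use k I in simp)
  define q where "q = smult (inverse (coeff p k)) p"
  have inv: "\<nu> (inverse (coeff p k)) + \<nu> (coeff p k) = 0"
    using nz by (simp add: pv_1[OF pv_\<nu>] flip: pv_mult[OF pv_\<nu>])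
  have "0 \<le> \<nu> (coeff q i)" for i
    using add_left_mono[OF min[of i], of "\<nu> (inverse (coeff p k))"] inv
    by (simp add: q_def pv_mult[OF pv_\<nu>])
  moreover have "\<nu> (coeff q k) = 0" by (simp add: q_def nz pv_1[OF pv_\<nu>])
  then have "\<not> (\<forall>i. 0 < \<nu> (coeff q i))" by (metis order_less_irrefl)
  moreover have "W (pcompose q u) = Infty"
    using p by (simp add: q_def pcompose_smult W_Infty_iff dvd_smult)
  ultimately obtain c where c: "c \<in> val_ring \<nu>" "0 < W (u - [:c:])"
    using residue_root[of q u] assms by (auto simp: val_ring_def)
  then have "\<nu> c = 0" using pv_diff_eq[OF W, of u "[:c:]"] assms by (simp add: W_const)
  then show thesis using that c by blast
qed

text \<open>The quotient of \<open>g\<close> by \<open>h\<close> is realised as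
  \<open>g * h'\<close>, with \<open>h'\<close> an inverse of \<open>h\<close> modulo
  \<open>f\<close>. It has value 0, and \<open>c\<close> is its residue.\<close>

lemma exists_unit_multiple:
  assumes "W g = W h" "W h \<noteq> Infty"
  obtains c where "\<nu> c = 0" "W h < W (g - smult c h)"
proof -
  obtain h' where h': "W (h * h' - 1) = Infty" using exists_inverse_mod assms(2) by blast
  then have "W (h * h') = 0"
    using pv_add_eq[OF W, of 1 "h * h' - 1"] by (simp add: pv_1[OF W])
  then have hh': "W h + W h' = 0" by (simp add: pv_mult[OF W])
  then have fin: "W h' \<noteq> Infty" by auto
  have "W (g * h') = 0" using assms hh' by (simp add: pv_mult[OF W])
  then obtain c where c: "\<nu> c = 0" "0 < W (g * h' - [:c:])" by (rule exists_residue)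
  have "(g - smult c h) * h' = (g * h' - [:c:]) - [:c:] * (h * h' - 1)"
    by (simp add: algebra_simps)
  then have "W (g - smult c h) + W h' = W ((g * h' - [:c:]) - [:c:] * (h * h' - 1))"
    by (simp flip: pv_mult[OF W])
  also have "0 < \<dots>"
    by (rule pv_diff_strict[OF W c(2)]) (simp only: pv_mult[OF W] h', simp)
  finally have "W h + W h' < W (g - smult c h) + W h'" using hh' by simp
  then have "W h < W (g - smult c h)" using fin by (simp add: vext_add_cancel)
  then show thesis using that c by blast
qed

end

section \<open>Cofinality in groups of finite rank\<close>

context
  fixes G :: "'g::linordered_ab_group_add set"
  assumes G0: "0 \<in> G" and G_diff: "\<And>x y. x \<in> G \<Longrightarrow> y \<in> G \<Longrightarrow> x - y \<in> G"
begin

lemma subgroup_minus: "x \<in> G \<Longrightarrow> - x \<in> G"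
  using G_diff[OF G0, of x] by simp

lemma subgroup_add: "x \<in> G \<Longrightarrow> y \<in> G \<Longrightarrow> x + y \<in> G"
  using G_diff[of x "- y"] subgroup_minus[of y] by simp

lemma subgroup_nmul: "x \<in> G \<Longrightarrow> nmul n x \<in> G"
  by (induction n) (simp_all add: nmul_Suc subgroup_add G0)

lemma convex_subgroup_generated:
  assumes "0 \<le> b"
  shows "convex_subgroup G {x \<in> G. \<exists>n. x \<le> nmul n b \<and> - x \<le> nmul n b}" (is "convex_subgroup G ?C")
  unfolding convex_subgroup_def
proof (intro conjI ballI impI)
  fix x y assume "x \<in> ?C" "y \<in> ?C"
  then obtain m n where *: "x \<in> G" "y \<in> G" "x \<le> nmul m b" "- x \<le> nmul m b"
    "y \<le> nmul n b" "- y \<le> nmul n b" by auto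
  have "x - y \<le> nmul (m + n) b" "- (x - y) \<le> nmul (m + n) b"
    using add_mono[OF *(3,6)] add_mono[OF *(4,5)] by (simp_all add: nmul_add)
  then show "x - y \<in> ?C" using * G_diff by blast
next
  fix x y assume "x \<in> ?C" and y: "y \<in> G" "0 \<le> y \<and> y \<le> x"
  then obtain n where n: "x \<le> nmul n b" by auto
  have "- y \<le> nmul n b" using y nmul_nonneg[OF assms, of n] by (meson neg_le_0_iff_le order_trans)
  then show "y \<in> ?C" using y n by (auto intro: order_trans)
qed (auto simp: G0 intro: exI[of _ 0])

lemma finite_rank_cofinal:
  assumes fin: "finite {H. convex_subgroup G H}"
    and L: "L \<subseteq> G" "L \<noteq> {}" and no_max: "\<And>x. x \<in> L \<Longrightarrow> \<exists>y\<in>L. x < y"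
  obtains s :: "nat \<Rightarrow> 'g" where "strict_mono s" "range s \<subseteq> L" "\<And>x. x \<in> L \<Longrightarrow> \<exists>n. x < s n"
proof -
  define tail where "tail = (\<lambda>H. \<exists>x\<in>L. \<forall>y\<in>L. x \<le> y \<longrightarrow> y - x \<in> H)"
  have "tail G" using L G_diff unfolding tail_def by blast
  moreover have "convex_subgroup G G" using G0 G_diff by (simp add: convex_subgroup_def)
  ultimately have "G \<in> {H. convex_subgroup G H \<and> tail H}" by simp
  moreover have "finite {H. convex_subgroup G H \<and> tail H}" by (rule finite_subset[OF _ fin]) auto
  ultimately obtain H where H: "convex_subgroup G H" "tail H"
    and H_min: "\<And>B. convex_subgroup G B \<Longrightarrow> tail B \<Longrightarrow> B \<subseteq> H \<Longrightarrow> H = B"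
    using finite_has_minimal[of "{H. convex_subgroup G H \<and> tail H}"] by auto
  note H' = H(1)[unfolded convex_subgroup_def]
  obtain x0 where x0: "x0 \<in> L" "\<And>y. y \<in> L \<Longrightarrow> x0 \<le> y \<Longrightarrow> y - x0 \<in> H"
    using H(2) by (auto simp: tail_def)
  have H_minus: "- x \<in> H" if "x \<in> H" for x using H' that by (metis diff_0)
  have H_add: "x + y \<in> H" if "x \<in> H" "y \<in> H" for x y
    using H' H_minus[OF that(2)] that(1) by (metis diff_minus_eq_add)
  have H_nmul: "nmul n x \<in> H" if "x \<in> H" for n x
    using that H' by (induction n) (simp_all add: nmul_Suc H_add)
  \<comment> \<open>\<open>H\<close> is nontrivial because \<open>L\<close> has no largest element.
    Thus \<open>{0}\<close> is a proper convex subgroup, and finiteness yields a maximal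
    one.\<close>
  have "\<exists>x\<in>H. x \<noteq> 0"
    using no_max[OF x0(1)] x0(2) by (metis less_imp_le order_less_irrefl right_minus_eq)
  moreover have "convex_subgroup G {0}" using G0 by (auto simp: convex_subgroup_def)
  ultimately have nonempty: "{B. convex_subgroup G B \<and> B \<subset> H} \<noteq> {}" using H' by auto
  have "finite {B. convex_subgroup G B \<and> B \<subset> H}" by (rule finite_subset[OF _ fin]) auto
  from finite_has_maximal[OF this nonempty] obtain M
    where M: "convex_subgroup G M" "M \<subset> H"
      and "\<forall>B\<in>{B. convex_subgroup G B \<and> B \<subset> H}. M \<subseteq> B \<longrightarrow> M = B" by auto
  then have M_max: "\<And>B. convex_subgroup G B \<Longrightarrow> B \<subset> H \<Longrightarrow> M \<subseteq> B \<Longrightarrow> M = B" by simp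
  note M' = M(1)[unfolded convex_subgroup_def]
  have M_minus: "- x \<in> M" if "x \<in> M" for x using M' that by (metis diff_0)
  \<comment> \<open>The convex subgroup generated by \<open>b\<close> lies in \<open>H\<close> and
    contains both \<open>M\<close> and \<open>b\<close>, as \<open>b\<close> is larger than every
    element of \<open>M\<close>; by maximality of \<open>M\<close> it is \<open>H\<close>.\<close>
  have arch: "\<exists>n. h \<le> nmul n b" if b: "b \<in> H" "0 < b" "b \<notin> M" and h: "h \<in> H" for b h
  proof -
    define C where "C = {x \<in> G. \<exists>n. x \<le> nmul n b \<and> - x \<le> nmul n b}"
    have conv: "convex_subgroup G C" unfolding C_def by (rule convex_subgroup_generated) (use b in simp)
    have "C \<subseteq> H"
    proof
      fix x assume "x \<in> C"
      then obtain n where n: "x \<in> G" "x \<le> nmul n b" "- x \<le> nmul n b" by (auto simp: C_def)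
      have *: "y \<in> H" if "y \<in> G" "0 \<le> y" "y \<le> nmul n b" for y
        using H' H_nmul[OF b(1), of n] that by blast
      show "x \<in> H"
      proof (cases "0 \<le> x")
        case False
        then have "- x \<in> H" using n subgroup_minus by (intro *) auto
        then show ?thesis using H_minus[of "- x"] by simp
      qed (use * n in blast)
    qed
    moreover have "M \<subseteq> C"
    proof
      fix x assume x: "x \<in> M"
      have "b \<in> G" using b H' by auto
      then have "\<not> b \<le> x" "\<not> b \<le> - x" using x M_minus[OF x] b M' by (meson less_imp_le)+
      then show "x \<in> C" using x M' by (auto simp: C_def intro!: exI[of _ "Suc 0"])
    qed
    moreover have "b \<in> C" using b H' by (auto simp: C_def intro!: exI[of _ "Suc 0"] order_trans[of "- b" 0 b])
    ultimately have "C = H" using M_max[OF conv] b(3) by blast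
    then show ?thesis using h by (auto simp: C_def)
  qed
  obtain a where a: "a \<in> H" "0 < a" "a \<notin> M"
  proof -
    obtain b where b: "b \<in> H" "b \<notin> M" using M by auto
    then have "b \<noteq> 0" using M' by auto
    then consider "0 < b" | "0 < - b" by (meson neg_0_less_iff_less neqE)
    then show thesis
    proof cases
      case 2
      then show thesis using that[of "- b"] b H_minus M_minus[of "- b"] by auto
    qed (use that b in blast)
  qed
  \<comment> \<open>\<open>H\<close> is minimal among the convex subgroups containing a final segment of \<open>L - x0\<close>; it is archimedean over
    its maximal convex subgroup \<open>M\<close>. Beyond any \<open>z \<in> L\<close> there is \<open>z' \<in> L\<close> with \<open>n (z' - z) \<ge> a\<close>, and rounding
    \<open>n (z' - x0)\<close> down to a multiple of \<open>a\<close> still leaves it above \<open>n (z - x0)\<close>.\<close>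
  define Y where "Y = (\<lambda>p q. if \<exists>y\<in>L. nmul p a \<le> nmul q (y - x0)
    then SOME y. y \<in> L \<and> nmul p a \<le> nmul q (y - x0) else x0)"
  have Y_in: "Y p q \<in> L" for p q
    unfolding Y_def using x0 by (auto intro: someI2)
  have Y_ge: "nmul p a \<le> nmul q (Y p q - x0)" if "y \<in> L" "nmul p a \<le> nmul q (y - x0)" for p q y
    unfolding Y_def using that by (auto intro: someI2)
  have cofinal: "\<exists>p q. z < Y p q" if z: "z \<in> L" "x0 \<le> z" for z
  proof -
    \<comment> \<open>Minimality of \<open>H\<close>: otherwise the smaller subgroup
      \<open>M\<close> would satisfy \<open>tail\<close> too.\<close>
    have "\<not> (\<forall>y\<in>L. z \<le> y \<longrightarrow> y - z \<in> M)" using H_min[OF M(1)] M(2) z by (auto simp: tail_def)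
    then obtain z' where z': "z' \<in> L" "z \<le> z'" "z' - z \<notin> M" by auto
    have "z' - z \<noteq> 0" using z' M' by auto
    then have pos: "0 < z' - z" using z' by simp
    have "z' - z = (z' - x0) - (z - x0)" by simp
    then have "z' - z \<in> H" using x0(2)[of z'] x0(2)[of z] z z' H' by (metis order_trans)
    then obtain n where n: "a \<le> nmul n (z' - z)" using arch[OF _ pos z'(3) a(1)] by blast
    then have "0 < n" using a by (cases n) auto
    define h where "h = nmul n (z' - x0)"
    have "h \<in> H" using H_nmul x0(2)[of z'] z z' by (simp add: h_def)
    then obtain k where k: "h \<le> nmul k a" using arch[OF a] by blast
    have bound: "p \<le> k" if "nmul p a \<le> h" for p
    proof (rule ccontr)
      assume "\<not> p \<le> k"
      then have "nmul (Suc k) a \<le> nmul p a" using a by (intro nmul_mono_left) auto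
      moreover have "nmul k a < nmul (Suc k) a" using a by (simp add: nmul_Suc)
      ultimately show False using that k by (meson not_le order_trans)
    qed
    have h0: "nmul 0 a \<le> h" using z z' by (simp add: h_def nmul_nonneg)
    define p where "p = (GREATEST p. nmul p a \<le> h)"
    have p: "nmul p a \<le> h" unfolding p_def
      using GreatestI_nat[of "\<lambda>p. nmul p a \<le> h" 0 k] h0 bound by blast
    have "\<not> nmul (Suc p) a \<le> h"
      using Greatest_le_nat[of "\<lambda>p. nmul p a \<le> h" "Suc p" k] bound unfolding p_def[symmetric] by fastforce
    then have "h - a < nmul p a" by (simp add: nmul_Suc algebra_simps not_le)
    have "nmul n (z - x0) = h - nmul n (z' - z)" by (simp add: h_def nmul_diff)
    also have "\<dots> \<le> h - a" using n by simp
    also have "\<dots> < nmul p a" by fact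
    also have "\<dots> \<le> nmul n (Y p n - x0)" using Y_ge[OF z'(1)] p by (simp add: h_def)
    finally have "z < Y p n" using \<open>0 < n\<close> by (simp add: nmul_less_iff)
    then show ?thesis by blast
  qed
  \<comment> \<open>There are only countably many pairs \<open>(p, q)\<close>; this is the source of
    the countable cofinal set.\<close>
  define e where "e = (\<lambda>k. Y (fst (prod_decode k)) (snd (prod_decode k)))"
  have e: "e k \<in> L" for k using Y_in by (simp add: e_def)
  have e_cofinal: "\<exists>k. z < e k" if "z \<in> L" for z
  proof -
    have "\<exists>p q. max z x0 < Y p q" using that x0 by (intro cofinal) (auto simp: max_def)
    then obtain p q where "max z x0 < Y p q" by blast
    then show ?thesis by (auto simp: e_def intro!: exI[of _ "prod_encode (p, q)"])
  qed
  have "\<exists>y\<in>L. max x (e k) < y" if "x \<in> L" for x k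
    using that e by (intro no_max) (auto simp: max_def)
  then obtain nx where nx: "\<And>x k. x \<in> L \<Longrightarrow> nx x k \<in> L \<and> max x (e k) < nx x k" by metis
  \<comment> \<open>Each term exceeds both its predecessor and one more element \<open>e k\<close>,
    which gives monotonicity and cofinality at once.\<close>
  define s where "s = rec_nat x0 (\<lambda>k x. nx x k)"
  have s: "s 0 = x0" "\<And>k. s (Suc k) = nx (s k) k" by (simp_all add: s_def)
  have sL: "s k \<in> L" for k by (induction k) (use s x0 nx in auto)
  then have step: "s k < s (Suc k)" "e k < s (Suc k)" for k using nx[of "s k" k] s by auto
  show thesis
  proof (rule that)
    show "strict_mono s" using step by (simp add: strict_mono_Suc_iff)
    show "range s \<subseteq> L" using sL by auto
    show "\<exists>n. x < s n" if "x \<in> L" for x using e_cofinal[OF that] step less_trans by blast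
  qed
qed

end

text \<open>Intersection with \<open>G0\<close> is injective on convex subgroups: \<open>H\<close>
  is recovered as the set of all x in \<open>G\<close> with a positive multiple in
  \<open>H \<inter> G0\<close>, because x with x \<ge> 0 lies between 0 and its multiple.\<close>

lemma finite_rank_torsion_extension:
  fixes G G0 :: "'g::linordered_ab_group_add set"
  assumes fin: "finite {H. convex_subgroup G0 H}" and sub: "0 \<in> G0" "G0 \<subseteq> G"
    and diff: "\<And>x y. x \<in> G0 \<Longrightarrow> y \<in> G0 \<Longrightarrow> x - y \<in> G0"
    and G_minus: "\<And>x. x \<in> G \<Longrightarrow> - x \<in> G"
    and torsion: "\<And>x. x \<in> G \<Longrightarrow> \<exists>n>0. nmul n x \<in> G0"
  shows "finite {H. convex_subgroup G H}"
proof (rule inj_on_finite[OF _ _ fin])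
  have minus: "- x \<in> H" if "convex_subgroup G H" "x \<in> H" for H x
    using that unfolding convex_subgroup_def by (metis diff_0)
  have nmul: "nmul n x \<in> H" if H: "convex_subgroup G H" and x: "x \<in> H" for H n x
  proof (induction n)
    case (Suc n)
    then have "nmul n x - (- x) \<in> H" using H minus[OF H x] unfolding convex_subgroup_def by blast
    then show ?case by (simp add: nmul_Suc)
  qed (use H in \<open>simp add: convex_subgroup_def\<close>)
  have iff: "x \<in> H \<longleftrightarrow> x \<in> G \<and> (\<exists>n>0. nmul n x \<in> H \<inter> G0)" if H: "convex_subgroup G H" for H x
  proof
    assume x: "x \<in> H"
    then show "x \<in> G \<and> (\<exists>n>0. nmul n x \<in> H \<inter> G0)"
      using H torsion[of x] nmul[OF H x] by (auto simp: convex_subgroup_def)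
  next
    assume "x \<in> G \<and> (\<exists>n>0. nmul n x \<in> H \<inter> G0)"
    then obtain n where x: "x \<in> G" and n: "0 < n" "nmul n x \<in> H" by blast
    have *: "y \<in> H" if "y \<in> G" "0 \<le> y" "nmul n y \<in> H" for y
      using nmul_mono_left[of "Suc 0" n y] n(1) that H unfolding convex_subgroup_def
      by (metis Suc_leI nmul_1)
    show "x \<in> H"
    proof (cases "0 \<le> x")
      case True
      then show ?thesis using * x n by blast
    next
      case False
      then have "- x \<in> H" using * x G_minus minus[OF H n(2)] by (simp add: nmul_minus)
      then show ?thesis using minus[OF H, of "- x"] by simp
    qed
  qed
  show "inj_on (\<lambda>H. H \<inter> G0) {H. convex_subgroup G H}"
    by (intro inj_onI set_eqI) (metis iff mem_Collect_eq)
  show "(\<lambda>H. H \<inter> G0) ` {H. convex_subgroup G H} \<subseteq> {H. convex_subgroup G0 H}"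
    using sub diff by (auto simp: convex_subgroup_def)
qed

section \<open>Limit key polynomials\<close>

lemma augment_mono:
  fixes V V' :: "'k::field poly \<Rightarrow> 'g::linordered_ab_group_add vext"
  assumes "\<And>g. V g \<le> V' g"
  shows "augment V \<phi> \<mu> g \<le> augment V' \<phi> \<mu> g"
  unfolding augment_def
proof (rule Min.boundedI)
  fix x assume "x \<in> (\<lambda>i. V' (adic_coeff \<phi> g i) + nmul i \<mu>) ` adic_range \<phi> g"
  then obtain i where i: "i \<in> adic_range \<phi> g" "x = V' (adic_coeff \<phi> g i) + nmul i \<mu>" by auto
  then have "Min ((\<lambda>i. V (adic_coeff \<phi> g i) + nmul i \<mu>) ` adic_range \<phi> g)
      \<le> V (adic_coeff \<phi> g i) + nmul i \<mu>"
    by (intro Min_le) (auto simp: adic_range_def)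
  also have "\<dots> \<le> x" using assms by (simp add: i add_right_mono)
  finally show "Min ((\<lambda>i. V (adic_coeff \<phi> g i) + nmul i \<mu>) ` adic_range \<phi> g) \<le> x" .
qed (auto simp: adic_range_def)

text \<open>These finitely many coefficients are what must reach their \<open>W\<close>-values at a
  common index in a limit.\<close>

lemma finite_adic_coeffs:
  assumes "0 < degree \<phi>"
  shows "finite (range (adic_coeff \<phi> g))"
  using assms
proof (induction g rule: poly_div_induct)
  case zero
  have "range (adic_coeff \<phi> 0) = {0}" by (auto simp: adic_coeff_def)
  then show ?case by simp
next
  case (div g)
  have "adic_coeff \<phi> g i \<in> insert (g mod \<phi>) (range (adic_coeff \<phi> (g div \<phi>)))" for i
    by (cases i) (simp_all add: adic_coeff_0 adic_coeff_Suc)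
  then have "range (adic_coeff \<phi> g) \<subseteq> insert (g mod \<phi>) (range (adic_coeff \<phi> (g div \<phi>)))"
    by blast
  then show ?case by (rule finite_subset) (simp add: div)
qed


lemma value_group_cases:
  assumes "x \<in> value_group V"
  obtains a b p q where "V a = Fin p" "V b = Fin q" "x = p - q"
proof -
  obtain p q where "x = p - q" "Fin p \<in> range V" "Fin q \<in> range V"
    using assms by (auto simp: value_group_def)
  then show thesis using that by (metis rangeE)
qed

lemma value_groupI: "V a = Fin p \<Longrightarrow> V b = Fin q \<Longrightarrow> p - q \<in> value_group V"
  unfolding value_group_def by (metis (mono_tags, lifting) mem_Collect_eq rangeI)

lemma value_group_0: "pseudo_valuation V \<Longrightarrow> 0 \<in> value_group V"
  using value_groupI[of V 1 0 1 0] by (simp add: pv_1 zero_vext_def)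

lemma value_group_diff:
  assumes V: "pseudo_valuation V" and x: "x \<in> value_group V" and y: "y \<in> value_group V"
  shows "x - y \<in> value_group V"
proof -
  obtain a b p q where 1: "V a = Fin p" "V b = Fin q" "x = p - q" using x by (rule value_group_cases)
  obtain c d r s where 2: "V c = Fin r" "V d = Fin s" "y = r - s" using y by (rule value_group_cases)
  have "V (a * d) = Fin (p + s)" "V (b * c) = Fin (q + r)" by (simp_all add: pv_mult[OF V] 1 2)
  then have "(p + s) - (q + r) \<in> value_group V" by (rule value_groupI)
  then show ?thesis by (simp add: 1 2 algebra_simps)
qed

lemma value_in_group: "pseudo_valuation V \<Longrightarrow> V a = Fin p \<Longrightarrow> p \<in> value_group V"
  using value_groupI[of V a p 1 0] pv_1[of V] by (simp add: zero_vext_def)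

context pseudo_valuation_kernel
begin

text \<open>Each element of the value group is the value of a single polynomial, because
  denominators have inverses modulo \<open>f\<close>. Hence \<open>value_torsion\<close> shows that
  the group is torsion over that of \<open>\<nu>\<close>.\<close>

lemma finite_rank_value_group:
  assumes const: "\<And>a. W [:a:] = \<nu> a" and \<nu>: "pseudo_valuation \<nu>" "finite_rank \<nu>"
  shows "finite {H. convex_subgroup (value_group W) H}"
proof (rule finite_rank_torsion_extension)
  show "finite {H. convex_subgroup (value_group \<nu>) H}" using \<nu> by (simp add: finite_rank_def)
  show "0 \<in> value_group \<nu>" using \<nu> by (simp add: value_group_0)
  show "value_group \<nu> \<subseteq> value_group W"
    using value_groupI[of W] const by (metis subsetI value_group_cases)
  show "x - y \<in> value_group \<nu>" if "x \<in> value_group \<nu>" "y \<in> value_group \<nu>" for x y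
    using that \<nu> by (simp add: value_group_diff)
  show "- x \<in> value_group W" if "x \<in> value_group W" for x
    using value_group_diff[OF W value_group_0[OF W] that] by simp
  show "\<exists>n>0. nmul n x \<in> value_group \<nu>" if x: "x \<in> value_group W" for x
  proof -
    obtain a b p q where ab: "W a = Fin p" "W b = Fin q" "x = p - q"
      using x by (rule value_group_cases)
    obtain b' where "W (b * b' - 1) = Infty" using exists_inverse_mod[of b] ab by auto
    then have "W (b * b') = 0" using pv_add_eq[OF W, of 1 "b * b' - 1"] by (simp add: pv_1[OF W])
    then have "W b + W b' = 0" by (simp add: pv_mult[OF W])
    then obtain r where r: "W b' = Fin r" "q + r = 0"
      using ab by (cases "W b'") (simp_all add: zero_vext_def)
    then have "r = - q" by (simp add: minus_unique)
    then have "W (a * b') = Fin x" using ab r by (simp add: pv_mult[OF W])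
    then obtain n c where "0 < n" "W [:c:] = Fin (nmul n x)" by (rule value_torsion)
    then show ?thesis using value_in_group[OF \<nu>(1)] const by metis
  qed
qed

context
  fixes A :: "'i::linorder set" and \<psi> :: "'i \<Rightarrow> 'k poly"
  assumes A: "A \<noteq> {}"
    and good: "\<And>a. a \<in> A \<Longrightarrow> good (\<psi> a)" and fin: "\<And>a. a \<in> A \<Longrightarrow> W (\<psi> a) \<noteq> Infty"
    and mono: "\<And>a b g. a \<in> A \<Longrightarrow> b \<in> A \<Longrightarrow> a \<le> b \<Longrightarrow> trunc (\<psi> a) g \<le> trunc (\<psi> b) g"
begin

text \<open>Agreement persists: later truncations lie between an earlier one and \<open>W\<close>.
  So the larger of two indices serves both.\<close>

lemma trunc_agree_finite:
  assumes "finite G" "\<And>g. g \<in> G \<Longrightarrow> \<exists>a\<in>A. trunc (\<psi> a) g = W g" "a0 \<in> A"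
  shows "\<exists>a\<in>A. a0 \<le> a \<and> (\<forall>g\<in>G. trunc (\<psi> a) g = W g)"
  using assms(1,2)
proof (induction G rule: finite_induct)
  case empty
  then show ?case using assms(3) by auto
next
  case (insert g G)
  obtain a where a: "a \<in> A" "a0 \<le> a" "\<forall>g\<in>G. trunc (\<psi> a) g = W g" using insert by auto
  obtain b where b: "b \<in> A" "trunc (\<psi> b) g = W g" using insert.prems by auto
  have "trunc (\<psi> c) h = W h" if "c \<in> A" "d \<in> A" "c \<ge> d" "trunc (\<psi> d) h = W h" for c d h
    using mono[of d c h] trunc_le[OF good_degree[OF good], of c h] that by (simp add: order_antisym)
  then have "\<forall>h\<in>insert g G. trunc (\<psi> (max a b)) h = W h"
    using a b by (metis insertE max.cobounded1 max.cobounded2 max_def)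
  then show ?case using a b by (intro bexI[of _ "max a b"]) (auto simp: max_def)
qed

text \<open>\<open>f\<close> is a candidate; take one of least degree and make it monic. Below this
  degree every polynomial reaches its \<open>W\<close>-value at some index, finitely many at a
  common one, which is all that \<open>goodI\<close> asks. The maximum in the limit augmentation is
  attained where the adic coefficients of \<open>g\<close> have reached their
  \<open>W\<close>-values.\<close>

lemma exists_limit_key:
  obtains \<phi> where "good \<phi>" "\<phi> \<in> limit_key_polys W A (\<lambda>a. trunc (\<psi> a))"
    "\<And>a g. a \<in> A \<Longrightarrow> trunc (\<psi> a) g \<le> trunc \<phi> g"
    "limit_augmented W A (\<lambda>a. trunc (\<psi> a)) \<phi> (trunc \<phi>)"
proof -
  let ?C = "limit_key_candidates W A (\<lambda>a. trunc (\<psi> a))"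
  have f: "f \<in> ?C" using trunc_f_less[OF good fin] by (simp add: limit_key_candidates_def)
  then obtain \<phi>0 where \<phi>0: "\<phi>0 \<in> ?C" "\<And>g. g \<in> ?C \<Longrightarrow> degree \<phi>0 \<le> degree g"
    using ex_has_least_nat[of "\<lambda>g. g \<in> ?C" f degree] by blast
  have nz: "\<phi>0 \<noteq> 0"
    using \<phi>0(1) A good pv_0 good_pseudo_valuation by (fastforce simp: limit_key_candidates_def)
  define c where "c = inverse (lead_coeff \<phi>0)"
  have c: "c \<noteq> 0" using nz by (simp add: c_def)
  define \<phi> where "\<phi> = [:c:] * \<phi>0"
  have lc: "lead_coeff \<phi> = 1" using nz c by (simp add: \<phi>_def c_def)
  have deg: "degree \<phi> = degree \<phi>0" using c by (simp add: \<phi>_def)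
  have less: "trunc (\<psi> a) \<phi> < W \<phi>" if a: "a \<in> A" for a
  proof -
    have "trunc (\<psi> a) [:c:] = W [:c:]"
      using good_degree[OF good[OF a]] by (simp add: trunc_small)
    moreover have "W [:c:] \<noteq> Infty" using c degree_f by (intro W_finite) auto
    moreover have "trunc (\<psi> a) \<phi>0 < W \<phi>0" using \<phi>0(1) a by (simp add: limit_key_candidates_def)
    ultimately show ?thesis
      unfolding \<phi>_def pv_mult[OF W] pv_mult[OF good_pseudo_valuation[OF good[OF a]]]
      using vext_add_cancel(2)[of "W [:c:]" "trunc (\<psi> a) \<phi>0" "W \<phi>0"] by simp
  qed
  then have "\<phi> \<in> ?C" by (simp add: limit_key_candidates_def)
  then have key: "\<phi> \<in> limit_key_polys W A (\<lambda>a. trunc (\<psi> a))"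
    using lc \<phi>0(2) deg by (simp add: limit_key_polys_def)
  obtain a0 where a0: "a0 \<in> A" using A by auto
  have le: "trunc (\<psi> a) g \<le> W g" if "a \<in> A" for a g
    using trunc_le[OF good_degree[OF good[OF that]]] .
  have agree: "\<exists>a\<in>A. trunc (\<psi> a) g = W g" if "degree g < degree \<phi>" for g
  proof (rule ccontr)
    assume "\<not> ?thesis"
    then have "g \<in> ?C" using le by (auto simp: limit_key_candidates_def order_less_le)
    then show False using \<phi>0(2)[of g] that deg by simp
  qed
  have d0: "0 < degree \<phi>"
  proof (rule ccontr)
    assume "\<not> 0 < degree \<phi>"
    then have "trunc (\<psi> a0) \<phi> = W \<phi>" using good_degree[OF good[OF a0]] by (simp add: trunc_small)
    then show False using less[OF a0] by simp
  qed
  have "good \<phi>"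
  proof (rule goodI[OF lc d0])
    show "degree \<phi> \<le> degree f" using \<phi>0(2)[OF f] deg by simp
    fix G :: "'k poly set" assume "finite G" "\<And>g. g \<in> G \<Longrightarrow> degree g < degree \<phi>"
    then obtain a where "a \<in> A" "\<forall>g\<in>G. trunc (\<psi> a) g = W g"
      using trunc_agree_finite[of G a0] agree a0 by blast
    then show "\<exists>U. pseudo_valuation U \<and> (\<forall>g. U g \<le> W g) \<and> U \<phi> < W \<phi> \<and> (\<forall>g\<in>G. U g = W g)"
      using less le good good_pseudo_valuation by blast
  qed
  have large: "\<exists>b\<in>A. a \<le> b \<and> (\<forall>i. trunc (\<psi> b) (adic_coeff \<phi> g i) = W (adic_coeff \<phi> g i))"
    if a: "a \<in> A" for a g
  proof -
    have "\<exists>b\<in>A. trunc (\<psi> b) h = W h" if "h \<in> range (adic_coeff \<phi> g)" for h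
      using that agree adic_coeff_degree[OF d0] by blast
    from trunc_agree_finite[OF finite_adic_coeffs[OF d0, of g] this a] show ?thesis by blast
  qed
  have mono': "trunc (\<psi> a) g \<le> trunc \<phi> g" if a: "a \<in> A" for a g
  proof -
    obtain b where b: "b \<in> A" "a \<le> b"
      "\<forall>i. trunc (\<psi> b) (adic_coeff \<phi> g i) = W (adic_coeff \<phi> g i)" using large[OF a] by blast
    have "trunc (\<psi> a) g \<le> trunc (\<psi> b) g" using mono a b by blast
    also have "\<dots> \<le> trunc \<phi> g"
      using good_pseudo_valuation[OF good[OF b(1)]] le[OF b(1)] less[OF b(1)] d0 b(3)
      by (intro trunc_ge) auto
    finally show ?thesis .
  qed
  have "limit_augmented W A (\<lambda>a. trunc (\<psi> a)) \<phi> (trunc \<phi>)"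
    unfolding limit_augmented_def
  proof (intro conjI key allI ballI)
    fix g
    obtain b where b: "b \<in> A"
      "\<forall>i. trunc (\<psi> b) (adic_coeff \<phi> g i) = W (adic_coeff \<phi> g i)" using large[OF a0] by blast
    then show "\<exists>a\<in>A. trunc \<phi> g = augment (trunc (\<psi> a)) \<phi> (W \<phi>) g"
      by (intro bexI[of _ b]) (simp_all add: trunc_def[of \<phi>] augment_def)
    show "augment (trunc (\<psi> a)) \<phi> (W \<phi>) g \<le> trunc \<phi> g" if "a \<in> A" for a
      unfolding trunc_def[of \<phi>] by (rule augment_mono) (rule le[OF that])
  qed
  then show thesis using that \<open>good \<phi>\<close> key mono' by blast
qed

end

section \<open>Admissible families of truncations\<close>

definition canonical_stage :: "('k poly, 'g, 'i::linorder) simple_family \<Rightarrow> bool" where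
  "canonical_stage S \<longleftrightarrow>
     fam_val S = (\<lambda>x. trunc (fam_key S x)) \<and> fam_gamma S = (\<lambda>x. W (fam_key S x)) \<and>
     1 \<le> fam_n S \<and> (\<forall>\<alpha>\<in>fam_A S. \<exists>\<beta>\<in>fam_A S. \<alpha> < \<beta>) \<and>
     (\<forall>x\<in>fam_index S. good (fam_key S x)) \<and>
     (\<forall>x\<in>fam_index S. \<forall>y\<in>fam_index S. index_less x y \<longrightarrow>
        W (fam_key S x) \<noteq> Infty \<and> (\<forall>g. trunc (fam_key S x) g \<le> trunc (fam_key S y) g)) \<and>
     (\<forall>i\<in>{2..fam_n S}. successor (fam_key S (Inl (i - 1))) (fam_key S (Inl i))) \<and>
     (\<forall>\<alpha>\<in>fam_A S. successor (fam_key S (Inl (fam_n S))) (fam_key S (Inr \<alpha>)) \<and>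
        degree (fam_key S (Inr \<alpha>)) = degree (fam_key S (Inl (fam_n S))))"

text \<open>The condition on the first key polynomial is left out, so that a resolution may start at
  any good polynomial and be built from its end backwards.\<close>

definition resolution :: "nat \<Rightarrow> (nat \<Rightarrow> ('k poly, 'g, 'i::linorder) simple_family) \<Rightarrow> bool" where
  "resolution t S \<longleftrightarrow>
     1 \<le> t \<and> (\<forall>s\<in>{1..t}. canonical_stage (S s)) \<and>
     (\<forall>s\<in>{2..t}. limit_augmented W (fam_A (S (s - 1))) (\<lambda>\<alpha>. trunc (fam_key (S (s - 1)) (Inr \<alpha>)))
        (fam_key (S s) (Inl 1)) (trunc (fam_key (S s) (Inl 1)))) \<and>
     (\<forall>s\<in>{1..t}. \<forall>s'\<in>{1..t}. s < s' \<longrightarrow>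
        (\<forall>x\<in>fam_index (S s). \<forall>y\<in>fam_index (S s'). \<forall>g.
           trunc (fam_key (S s) x) g \<le> trunc (fam_key (S s') y) g)) \<and>
     fam_A (S t) = {} \<and> W (fam_key (S t) (Inl (fam_n (S t)))) = Infty"

lemma fam_index_simps [simp]:
  "Inl i \<in> fam_index S \<longleftrightarrow> i \<in> {1..fam_n S}" "Inr a \<in> fam_index S \<longleftrightarrow> a \<in> fam_A S"
  by (auto simp: fam_index_def)

lemma canonical_stage_simple_admissible:
  assumes S: "canonical_stage S"
  shows "simple_admissible S"
proof -
  note S' = S[unfolded canonical_stage_def]
  have good: "good (fam_key S x)" if "x \<in> fam_index S" for x using S' that by blast
  have fin: "W (fam_key S x) \<noteq> Infty"
    if "x \<in> fam_index S" "y \<in> fam_index S" "index_less x y" for x y using S' that by blast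
  have step: "good (fam_key S (Inl (i - 1))) \<and> W (fam_key S (Inl (i - 1))) \<noteq> Infty \<and>
      successor (fam_key S (Inl (i - 1))) (fam_key S (Inl i))" if i: "i \<in> {2..fam_n S}" for i
  proof -
    have "Inl (i - 1) \<in> fam_index S" "Inl i \<in> fam_index S" "index_less (Inl (i - 1)) (Inl i)"
      using i by auto
    then show ?thesis using S' i good fin by blast
  qed
  have last: "good (fam_key S (Inl (fam_n S))) \<and> W (fam_key S (Inl (fam_n S))) \<noteq> Infty \<and>
      successor (fam_key S (Inl (fam_n S))) (fam_key S (Inr \<alpha>))" if a: "\<alpha> \<in> fam_A S" for \<alpha>
  proof -
    have "1 \<le> fam_n S" using S' by blast
    then have "Inl (fam_n S) \<in> fam_index S" "Inr \<alpha> \<in> fam_index S" "index_less (Inl (fam_n S)) (Inr \<alpha>)"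
      using a by auto
    then show ?thesis using S' a good fin by blast
  qed
  show ?thesis
    unfolding simple_admissible_def
  proof (intro conjI ballI impI)
    show "pseudo_valuation (fam_val S x)" if "x \<in> fam_index S" for x
      using S' good_pseudo_valuation[OF good[OF that]] by simp
    show "valuation (fam_val S x)" if "x \<in> fam_index S" "y \<in> fam_index S" "index_less x y" for x y
      using S' good_valuation[OF good[OF that(1)] fin[OF that]] by simp
  qed (use S' step last successor_key_polynomial successor_augment in auto)
qed

lemma base_augment_trunc:
  assumes "\<And>a. W [:a:] = \<nu> a"
  shows "base_augment \<nu> zvar (W zvar) = trunc zvar"
  unfolding base_augment_def trunc_def
proof (rule augment_cong)
  fix g :: "'k poly" assume "degree g < degree (zvar :: 'k poly)"
  then obtain c where "g = [:c:]" by (auto elim: degree_eq_zeroE)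
  then show "\<nu> (coeff g 0) = W g" using assms by simp
qed simp

lemma resolution_admissible:
  assumes "resolution t S" "fam_key (S 1) (Inl 1) = zvar" "\<And>a. W [:a:] = \<nu> a"
  shows "admissible_family \<nu> W t S" "family_determines W t S"
proof -
  note R = assms(1)[unfolded resolution_def]
  have stage: "canonical_stage (S s)" if "s \<in> {1..t}" for s using R that by blast
  note stage' = stage[unfolded canonical_stage_def]
  have val: "fam_val (S s) = (\<lambda>x. trunc (fam_key (S s) x))"
    "fam_gamma (S s) = (\<lambda>x. W (fam_key (S s) x))" if "s \<in> {1..t}" for s
    using stage'[OF that] by blast+
  have t: "1 \<in> {1..t}" "t \<in> {1..t}" using R by auto
  have base: "fam_val (S 1) (Inl 1)
      = base_augment \<nu> (fam_key (S 1) (Inl 1)) (fam_gamma (S 1) (Inl 1))"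
    using val[OF t(1)] assms(2) base_augment_trunc[of \<nu>] assms(3) by simp
  have good: "good (fam_key (S s) x)" if "s \<in> {1..t}" "x \<in> fam_index (S s)" for s x
    using stage'[OF that(1)] that(2) by blast
  show "admissible_family \<nu> W t S"
    unfolding admissible_family_def
  proof (intro conjI ballI allI impI)
    show "1 \<le> t" using R by blast
    show "simple_admissible (S s)" if "s \<in> {1..t}" for s
      using stage[OF that] by (rule canonical_stage_simple_admissible)
    show "limit_augmented W (fam_A (S (s - 1))) (\<lambda>\<alpha>. fam_val (S (s - 1)) (Inr \<alpha>))
        (fam_key (S s) (Inl 1)) (fam_val (S s) (Inl 1))"
      and "fam_gamma (S s) (Inl 1) = W (fam_key (S s) (Inl 1))" if "s \<in> {2..t}" for s
    proof -
      have s: "s \<in> {1..t}" "s - 1 \<in> {1..t}" using that by auto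
      show "limit_augmented W (fam_A (S (s - 1))) (\<lambda>\<alpha>. fam_val (S (s - 1)) (Inr \<alpha>))
        (fam_key (S s) (Inl 1)) (fam_val (S s) (Inl 1))"
        unfolding val[OF s(1)] val[OF s(2)] using R that by blast
      show "fam_gamma (S s) (Inl 1) = W (fam_key (S s) (Inl 1))" by (simp add: val[OF s(1)])
    qed
    show "fam_val (S s) x g \<le> fam_val (S s') y g"
      if ss: "s \<in> {1..t}" "s' \<in> {1..t}" and xy: "x \<in> fam_index (S s)" "y \<in> fam_index (S s')"
        and less: "s < s' \<or> s = s' \<and> index_less x y" for s s' x y g
    proof (cases "s < s'")
      case True
      then have "trunc (fam_key (S s) x) g \<le> trunc (fam_key (S s') y) g" using R ss xy by blast
      then show ?thesis by (simp only: val[OF ss(1)] val[OF ss(2)])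
    next
      case False
      then have "s = s'" "index_less x y" using less by auto
      then have "trunc (fam_key (S s) x) g \<le> trunc (fam_key (S s) y) g"
        using stage'[OF ss(1)] xy by blast
      then show ?thesis unfolding \<open>s = s'\<close>[symmetric] by (simp only: val[OF ss(1)])
    qed
    show "fam_val (S s) x g \<le> W g" if "s \<in> {1..t}" "x \<in> fam_index (S s)" for s x g
      using trunc_le[OF good_degree[OF good[OF that]]] val[OF that(1)] by simp
    show "fam_val (S s) x (fam_key (S s) x) = W (fam_key (S s) x)"
      if "s \<in> {1..t}" "x \<in> fam_index (S s)" for s x
      using trunc_key[OF good_degree[OF good[OF that]]] val[OF that(1)] by simp
  qed (use base assms(2) in simp_all)
  have "1 \<le> fam_n (S t)" using stage'[OF t(2)] by blast
  then have "good (fam_key (S t) (Inl (fam_n (S t))))" using good[OF t(2)] by simp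
  then show "family_determines W t S"
    using R good_Infty(2) val[OF t(2)] by (simp add: family_determines_def)
qed

section \<open>Extending a resolution at its front\<close>

lemma canonical_stage_first_le:
  assumes "canonical_stage S" "x \<in> fam_index S"
  shows "trunc (fam_key S (Inl 1)) g \<le> trunc (fam_key S x) g"
proof (cases "x = Inl 1")
  case False
  have "Inl 1 \<in> fam_index S" using assms(1) by (simp add: canonical_stage_def)
  moreover have "index_less (Inl 1) x" using False assms(2) by (cases x) auto
  ultimately show ?thesis using assms unfolding canonical_stage_def by blast
qed simp

text \<open>A valuation put in front thus needs to be compared only with the first member of the
  resolution.\<close>

lemma resolution_first_le:
  assumes "resolution t S" "s \<in> {1..t}" "x \<in> fam_index (S s)"
  shows "trunc (fam_key (S 1) (Inl 1)) g \<le> trunc (fam_key (S s) x) g"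
proof (cases "s = 1")
  case True
  have "canonical_stage (S 1)" using assms(1,2) True unfolding resolution_def by blast
  then show ?thesis using canonical_stage_first_le[of "S 1" x g] assms(3) True by simp
next
  case False
  note R = assms(1)[unfolded resolution_def]
  have t: "1 \<in> {1..t}" "1 < s" using False assms(2) by auto
  then have "canonical_stage (S 1)" using R by blast
  then have "Inl 1 \<in> fam_index (S 1)" by (simp add: canonical_stage_def)
  then show ?thesis using R t assms(2,3) by blast
qed

text \<open>One of two ways to extend: \<open>S0\<close> becomes a family of its own, linked to the
  old first family by a limit augmentation.\<close>

lemma resolution_limit:
  assumes S0: "canonical_stage S0" and R: "resolution t S"
    and lim: "limit_augmented W (fam_A S0) (\<lambda>\<alpha>. trunc (fam_key S0 (Inr \<alpha>)))
        (fam_key (S 1) (Inl 1)) (trunc (fam_key (S 1) (Inl 1)))"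
    and le: "\<And>x g. x \<in> fam_index S0 \<Longrightarrow> trunc (fam_key S0 x) g \<le> trunc (fam_key (S 1) (Inl 1)) g"
  shows "resolution (Suc t) (\<lambda>s. if s = 1 then S0 else S (s - 1))" (is "resolution _ ?S")
  unfolding resolution_def
proof (intro conjI ballI impI allI)
  note R' = R[unfolded resolution_def]
  show "canonical_stage (?S s)" if "s \<in> {1..Suc t}" for s
  proof (cases "s = 1")
    case False
    then have "s - 1 \<in> {1..t}" using that by auto
    then show ?thesis using R' False by simp
  qed (use S0 in simp)
  show "limit_augmented W (fam_A (?S (s - 1))) (\<lambda>\<alpha>. trunc (fam_key (?S (s - 1)) (Inr \<alpha>)))
        (fam_key (?S s) (Inl 1)) (trunc (fam_key (?S s) (Inl 1)))" if "s \<in> {2..Suc t}" for s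
  proof (cases "s = 2")
    case True
    then show ?thesis using lim by simp
  next
    case False
    then have "s - 1 \<in> {2..t}" using that by auto
    then have "limit_augmented W (fam_A (S (s - 1 - 1))) (\<lambda>\<alpha>. trunc (fam_key (S (s - 1 - 1)) (Inr \<alpha>)))
        (fam_key (S (s - 1)) (Inl 1)) (trunc (fam_key (S (s - 1)) (Inl 1)))" using R' by blast
    moreover have "s - 1 \<noteq> 1" "s \<noteq> 1" using that False by auto
    ultimately show ?thesis by simp
  qed
  show "trunc (fam_key (?S s) x) g \<le> trunc (fam_key (?S s') y) g"
    if ss: "s \<in> {1..Suc t}" "s' \<in> {1..Suc t}" "s < s'"
      and xy: "x \<in> fam_index (?S s)" "y \<in> fam_index (?S s')" for s s' x y g
  proof (cases "s = 1")
    case True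
    have s': "s' - 1 \<in> {1..t}" "?S s' = S (s' - 1)" using ss by auto
    have "trunc (fam_key (?S s) x) g \<le> trunc (fam_key (S 1) (Inl 1)) g" using le xy True by simp
    also have "\<dots> \<le> trunc (fam_key (S (s' - 1)) y) g"
      using resolution_first_le[OF R s'(1)] xy s'(2) by simp
    finally show ?thesis using s' by simp
  next
    case False
    then have s: "s - 1 \<in> {1..t}" "?S s = S (s - 1)" "s' - 1 \<in> {1..t}" "?S s' = S (s' - 1)"
      "s - 1 < s' - 1" using ss by auto
    have "x \<in> fam_index (S (s - 1))" "y \<in> fam_index (S (s' - 1))"
      using xy unfolding s(2,4) by auto
    then have "trunc (fam_key (S (s - 1)) x) g \<le> trunc (fam_key (S (s' - 1)) y) g"
      using R' s(1,3,5) by blast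
    then show ?thesis using s by simp
  qed
qed (use R in \<open>auto simp: resolution_def\<close>)

definition stage_of :: "nat \<Rightarrow> 'i set \<Rightarrow> (nat + 'i \<Rightarrow> 'k poly) \<Rightarrow> ('k poly, 'g, 'i) simple_family" where
  "stage_of n A key = \<lparr>fam_n = n, fam_A = A, fam_val = (\<lambda>x. trunc (key x)), fam_key = key,
     fam_gamma = (\<lambda>x. W (key x))\<rparr>"

lemma stage_of_simps [simp]:
  "fam_n (stage_of n A key) = n" "fam_A (stage_of n A key) = A"
  "fam_key (stage_of n A key) = key" "fam_val (stage_of n A key) = (\<lambda>x. trunc (key x))"
  "fam_gamma (stage_of n A key) = (\<lambda>x. W (key x))"
  by (simp_all add: stage_of_def)

text \<open>The finite part is shifted by one and the continuous part kept. Index 0 is outside the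
  family and receives \<open>\<phi>\<close> only as a default.\<close>

definition prepend_key :: "'k poly \<Rightarrow> ('k poly, 'g, 'i) simple_family \<Rightarrow> ('k poly, 'g, 'i) simple_family" where
  "prepend_key \<phi> S = stage_of (Suc (fam_n S)) (fam_A S)
     (\<lambda>x. case x of Inl i \<Rightarrow> if i \<le> 1 then \<phi> else fam_key S (Inl (i - 1)) | Inr a \<Rightarrow> fam_key S (Inr a))"

lemma prepend_key_index:
  "x \<in> fam_index (prepend_key \<phi> S) \<longleftrightarrow> x = Inl 1 \<or> (\<exists>y\<in>fam_index S. x = map_sum Suc id y)"
proof (cases x)
  case (Inl i)
  then show ?thesis by (cases i) (auto simp: prepend_key_def fam_index_def bex_Un image_iff)
qed (auto simp: prepend_key_def fam_index_def bex_Un)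

lemma prepend_key_simps:
  "fam_key (prepend_key \<phi> S) (Inl 1) = \<phi>"
  "y \<in> fam_index S \<Longrightarrow> fam_key (prepend_key \<phi> S) (map_sum Suc id y) = fam_key S y"
  "fam_key (prepend_key \<phi> S) (Inr a) = fam_key S (Inr a)"
  "fam_n (prepend_key \<phi> S) = Suc (fam_n S)" "fam_A (prepend_key \<phi> S) = fam_A S"
  by (auto simp: prepend_key_def fam_index_def)

lemma index_less_map_sum: "index_less (map_sum Suc id x) (map_sum Suc id y) = index_less x y"
  by (cases x; cases y) auto

lemma canonical_stage_prepend_key:
  assumes \<phi>: "good \<phi>" "W \<phi> \<noteq> Infty" and S: "canonical_stage S"
    and succ: "successor \<phi> (fam_key S (Inl 1))"
  shows "canonical_stage (prepend_key \<phi> S)"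
proof -
  note S' = S[unfolded canonical_stage_def]
  have n: "1 \<le> fam_n S" using S' by blast
  have first: "Inl 1 \<in> fam_index S" using n by simp
  have le: "trunc \<phi> g \<le> trunc (fam_key S y) g" if "y \<in> fam_index S" for y g
    using successor_trunc_le[OF \<phi> succ] canonical_stage_first_le[OF S that] order_trans by blast
  have less: "W (fam_key S x) \<noteq> Infty" "trunc (fam_key S x) g \<le> trunc (fam_key S y) g"
    if "x \<in> fam_index S" "y \<in> fam_index S" "index_less x y" for x y g
    using S' that by blast+
  show ?thesis
    unfolding canonical_stage_def
  proof (intro conjI ballI impI)
    show "good (fam_key (prepend_key \<phi> S) x)" if "x \<in> fam_index (prepend_key \<phi> S)" for x
      using that S' \<phi> unfolding prepend_key_index by (metis prepend_key_simps(1,2))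
    fix x y assume "x \<in> fam_index (prepend_key \<phi> S)" "y \<in> fam_index (prepend_key \<phi> S)" "index_less x y"
    then consider "x = Inl 1" "y = Inl 1" "False"
      | y' where "x = Inl 1" "y = map_sum Suc id y'" "y' \<in> fam_index S"
      | x' where "x = map_sum Suc id x'" "y = Inl 1" "x' \<in> fam_index S"
      | x' y' where "x = map_sum Suc id x'" "y = map_sum Suc id y'" "x' \<in> fam_index S" "y' \<in> fam_index S"
        "index_less x' y'"
      unfolding prepend_key_index using index_less_map_sum by fastforce
    then have "W (fam_key (prepend_key \<phi> S) x) \<noteq> Infty \<and>
      (\<forall>g. trunc (fam_key (prepend_key \<phi> S) x) g \<le> trunc (fam_key (prepend_key \<phi> S) y) g)"
    proof cases
      case 2
      then show ?thesis using \<phi> le by (simp only: prepend_key_simps) blast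
    next
      case 3
      then have "False" using \<open>index_less x y\<close> by (cases x') auto
      then show ?thesis ..
    next
      case 4
      then show ?thesis using less by (simp only: prepend_key_simps) blast
    qed simp
    then show "W (fam_key (prepend_key \<phi> S) x) \<noteq> Infty"
      and "\<forall>g. trunc (fam_key (prepend_key \<phi> S) x) g \<le> trunc (fam_key (prepend_key \<phi> S) y) g"
      by blast+
  next
    fix i assume i: "i \<in> {2..fam_n (prepend_key \<phi> S)}"
    show "successor (fam_key (prepend_key \<phi> S) (Inl (i - 1))) (fam_key (prepend_key \<phi> S) (Inl i))"
    proof (cases "i = 2")
      case True
      then show ?thesis using succ by (simp add: prepend_key_def)
    next
      case False
      then have "i - 1 \<in> {2..fam_n S}" using i by (auto simp: prepend_key_simps)
      then have "successor (fam_key S (Inl (i - 1 - 1))) (fam_key S (Inl (i - 1)))" using S' by blast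
      moreover have "\<not> i - 1 \<le> 1" "\<not> i \<le> 1" using False i by auto
      ultimately show ?thesis by (simp add: prepend_key_def)
    qed
  next
    fix \<alpha> assume "\<alpha> \<in> fam_A (prepend_key \<phi> S)"
    then show "successor (fam_key (prepend_key \<phi> S) (Inl (fam_n (prepend_key \<phi> S))))
        (fam_key (prepend_key \<phi> S) (Inr \<alpha>))"
      "degree (fam_key (prepend_key \<phi> S) (Inr \<alpha>))
        = degree (fam_key (prepend_key \<phi> S) (Inl (fam_n (prepend_key \<phi> S))))"
      using S' n by (simp_all add: prepend_key_def)
  qed (use S' in \<open>simp_all add: prepend_key_def\<close>)
qed

text \<open>The other way to extend: \<open>\<phi>\<close> joins the first family by an ordinary
  augmentation, and the number of families stays the same.\<close>

lemma resolution_prepend_key: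
  assumes \<phi>: "good \<phi>" "W \<phi> \<noteq> Infty" and R: "resolution t S"
    and succ: "successor \<phi> (fam_key (S 1) (Inl 1))"
  shows "resolution t (S(1 := prepend_key \<phi> (S 1)))" (is "resolution t ?S")
  unfolding resolution_def
proof (intro conjI ballI impI allI)
  note R' = R[unfolded resolution_def]
  have t: "1 \<in> {1..t}" using R' by simp
  have S1: "canonical_stage (S 1)" using R' t by blast
  then have n: "1 \<le> fam_n (S 1)" by (simp add: canonical_stage_def)
  show "canonical_stage (?S s)" if "s \<in> {1..t}" for s
    using canonical_stage_prepend_key[OF \<phi> S1 succ] R' that by simp
  show "limit_augmented W (fam_A (?S (s - 1))) (\<lambda>\<alpha>. trunc (fam_key (?S (s - 1)) (Inr \<alpha>)))
        (fam_key (?S s) (Inl 1)) (trunc (fam_key (?S s) (Inl 1)))" if s: "s \<in> {2..t}" for s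
  proof -
    have "limit_augmented W (fam_A (S (s - 1))) (\<lambda>\<alpha>. trunc (fam_key (S (s - 1)) (Inr \<alpha>)))
        (fam_key (S s) (Inl 1)) (trunc (fam_key (S s) (Inl 1)))" using R' s by blast
    then show ?thesis using s by (auto simp: prepend_key_simps)
  qed
  show "trunc (fam_key (?S s) x) g \<le> trunc (fam_key (?S s') y) g"
    if ss: "s \<in> {1..t}" "s' \<in> {1..t}" "s < s'"
      and xy: "x \<in> fam_index (?S s)" "y \<in> fam_index (?S s')" for s s' x y g
  proof -
    have s': "?S s' = S s'" using ss by auto
    have le: "trunc (fam_key (S s) z) g \<le> trunc (fam_key (S s') y) g" if "z \<in> fam_index (S s)" for z
      using R' ss xy(2) that s' by auto
    show ?thesis
    proof (cases "s = 1")
      case True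
      then consider "x = Inl 1" | z where "x = map_sum Suc id z" "z \<in> fam_index (S 1)"
        using xy(1) unfolding True by (auto simp only: fun_upd_same prepend_key_index)
      then show ?thesis
      proof cases
        case 1
        have "trunc \<phi> g \<le> trunc (fam_key (S 1) (Inl 1)) g" by (rule successor_trunc_le[OF \<phi> succ])
        also have "\<dots> \<le> trunc (fam_key (S s') y) g"
          using resolution_first_le[OF R ss(2)] xy(2) s' by simp
        finally show ?thesis unfolding s' True 1 by (simp only: fun_upd_same prepend_key_simps)
      next
        case 2
        then show ?thesis using le[of z] unfolding s' True by (simp only: fun_upd_same prepend_key_simps)
      qed
    next
      case False
      then show ?thesis using le xy s' by simp
    qed
  qed
  show "fam_A (?S t) = {}" using R' by (cases "t = 1") (auto simp: prepend_key_simps)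
  show "W (fam_key (?S t) (Inl (fam_n (?S t)))) = Infty"
    using R' n by (cases "t = 1") (auto simp: prepend_key_def)
qed (use R in \<open>auto simp: resolution_def\<close>)

text \<open>Write \<open>g = \<psi> + h\<close> with \<open>h\<close> of smaller degree, so that
  \<open>trunc \<psi> g = min (W h) (W \<psi>)\<close>. Consequently a \<open>\<psi>\<close> of
  maximal value in its degree leaves nothing of that degree that still increases.\<close>

lemma trunc_monic_same_degree:
  assumes "lead_coeff \<psi> = 1" "lead_coeff g = 1" "degree g = degree \<psi>" "0 < degree \<psi>"
  shows "trunc \<psi> g \<le> W \<psi>" "trunc \<psi> g < W g \<Longrightarrow> W \<psi> < W g"
proof -
  define h where "h = g - \<psi>"
  have "degree h < degree \<psi>"
  proof (cases "h = 0")
    case False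
    have "degree h \<le> degree \<psi>" unfolding h_def using assms(3) by (simp add: degree_diff_le)
    moreover have "coeff h (degree \<psi>) = 0" using assms by (simp add: h_def)
    ultimately show ?thesis using False by (metis leading_coeff_0_iff order_le_less)
  qed (use assms in simp)
  then have "g mod \<psi> = h" "g div \<psi> = 1"
  proof -
    have g: "g = \<psi> + h" by (simp add: h_def)
    have "\<psi> \<noteq> 0" using assms by auto
    then show "g mod \<psi> = h" "g div \<psi> = 1"
      using \<open>degree h < degree \<psi>\<close>
      by (simp_all add: g mod_poly_less div_poly_less poly_div_add_left poly_mod_add_left)
  qed
  then have eq: "trunc \<psi> g = min (W h) (W \<psi>)"
    by (subst trunc_rec[OF assms(4)]) (simp add: trunc_1 assms(4))
  then show "trunc \<psi> g \<le> W \<psi>" by simp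
  show "W \<psi> < W g" if "trunc \<psi> g < W g"
  proof (cases "W h < W \<psi>")
    case True
    then have "W g = W h" using pv_add_eq[OF W True] by (simp add: h_def)
    then show ?thesis using that eq True by simp
  qed (use that eq in \<open>simp add: min_def split: if_splits\<close>)
qed

lemma monic_witness:
  assumes good: "good \<phi>" and "trunc \<phi> g < W g"
  obtains h where "lead_coeff h = 1" "degree h = degree g" "trunc \<phi> h < W h"
proof -
  have "g \<noteq> 0" using assms pv_0[OF good_pseudo_valuation[OF good]] by auto
  define c where "c = inverse (lead_coeff g)"
  have c: "c \<noteq> 0" using \<open>g \<noteq> 0\<close> by (simp add: c_def)
  have "trunc \<phi> [:c:] = W [:c:]" using good_degree[OF good] by (simp add: trunc_small)
  moreover have "W [:c:] \<noteq> Infty" using c degree_f by (intro W_finite) auto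
  ultimately have "trunc \<phi> ([:c:] * g) < W ([:c:] * g)"
    unfolding pv_mult[OF W] pv_mult[OF good_pseudo_valuation[OF good]]
    using vext_add_cancel(2)[of "W [:c:]" "trunc \<phi> g" "W g"] assms(2) by simp
  moreover have "degree ([:c:] * g) = degree g" using c by simp
  moreover have "lead_coeff ([:c:] * g) = 1"
    using \<open>g \<noteq> 0\<close> by (simp add: c_def)
  ultimately show thesis using that by blast
qed

text \<open>A polynomial of degree \<open>d\<close> that still increases over \<open>\<chi>\<close>
  can be made monic, and it increases over \<open>\<phi>\<close> as well because
  \<open>trunc \<phi> \<le> trunc \<chi>\<close>.\<close>

lemma agree_Suc:
  assumes "good \<chi>" "\<And>g. trunc \<phi> g \<le> trunc \<chi> g"
    and below: "\<And>g. degree g < d \<Longrightarrow> trunc \<phi> g = W g"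
    and monic: "\<And>g. lead_coeff g = 1 \<Longrightarrow> degree g = d \<Longrightarrow> trunc \<phi> g < W g \<Longrightarrow> \<not> trunc \<chi> g < W g"
    and deg: "degree g < Suc d"
  shows "trunc \<chi> g = W g"
proof (rule ccontr)
  assume "trunc \<chi> g \<noteq> W g"
  then have less: "trunc \<chi> g < W g" using trunc_le[OF good_degree[OF assms(1)], of g] by simp
  then have "\<not> degree g < d" using below[of g] assms(2)[of g] by auto
  obtain h where h: "lead_coeff h = 1" "degree h = degree g" "trunc \<chi> h < W h"
    using monic_witness[OF assms(1) less] by blast
  then have "trunc \<phi> h < W h" using assms(2)[of h] by simp
  then show False using monic[of h] h \<open>\<not> degree g < d\<close> deg by auto
qed

text \<open>\<open>d\<close> bounds the degrees in which \<open>trunc \<phi>\<close> is known to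
  agree with \<open>W\<close>. It never exceeds \<open>degree f\<close> while
  \<open>W \<phi>\<close> is finite, since \<open>f\<close> increases, and every recursive call
  raises it by one.\<close>

lemma exists_resolution:
  assumes fin_rank: "finite {H. convex_subgroup (value_group W) H}"
    and "good \<phi>" "\<And>g. degree g < d \<Longrightarrow> trunc \<phi> g = W g"
  shows "\<exists>t (S :: nat \<Rightarrow> ('k poly, 'g, nat) simple_family).
    resolution t S \<and> fam_key (S 1) (Inl 1) = \<phi>"
  using assms(2,3)
proof (induction "Suc (degree f) - d" arbitrary: \<phi> d rule: less_induct)
  case less
  note \<phi> = less.prems(1) and below = less.prems(2)
  show ?case
  proof (cases "W \<phi> = Infty")
    case True
    let ?S = "\<lambda>_::nat. stage_of 1 {} (\<lambda>_. \<phi>) :: ('k poly, 'g, nat) simple_family"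
    have "resolution 1 ?S"
      using True \<phi> by (auto simp: resolution_def canonical_stage_def fam_index_def)
    then show ?thesis by (intro exI[of _ 1] exI[of _ ?S]) simp
  next
    case fin: False
    have d: "d \<le> degree f" using trunc_f_less[OF \<phi> fin] below[of f] by force
    have IH: "\<exists>t (S :: nat \<Rightarrow> ('k poly, 'g, nat) simple_family).
        resolution t S \<and> fam_key (S 1) (Inl 1) = \<chi>"
      if "good \<chi>" "\<And>g. degree g < Suc d \<Longrightarrow> trunc \<chi> g = W g" for \<chi>
      using d that by (intro less.hyps[of "Suc d" \<chi>]) auto
    \<comment> \<open>The successors of degree exactly \<open>d\<close>. If there are none, the
      recursion keeps \<open>\<phi>\<close> and only raises \<open>d\<close>.\<close>
    define P where "P = {g. lead_coeff g = 1 \<and> degree g = d \<and> trunc \<phi> g < W g}"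
    have succ: "successor \<phi> g" if "g \<in> P" for g
      using that below by (auto simp: successor_def P_def)
    note P_good = successor_good[OF \<phi> fin succ]
    note P_le = successor_trunc_le[OF \<phi> fin succ]
    have agree: "trunc \<chi> g = W g"
      if "good \<chi>" "\<And>g. trunc \<phi> g \<le> trunc \<chi> g" "\<And>g. g \<in> P \<Longrightarrow> \<not> trunc \<chi> g < W g" "degree g < Suc d"
      for \<chi> g
      using that below by (intro agree_Suc[of \<chi> \<phi> d]) (auto simp: P_def)
    have d0: "0 < d" if "g \<in> P" for g
      using good_degree[OF P_good[OF that]] that by (simp add: P_def)
    have same_degree: "trunc \<psi> g \<le> W \<psi>" "trunc \<psi> g < W g \<Longrightarrow> W \<psi> < W g"
      if "\<psi> \<in> P" "g \<in> P" for \<psi> g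
      using trunc_monic_same_degree[of \<psi> g] that d0[OF that(1)] by (auto simp: P_def)
    consider (none) "P = {}" | (max) \<psi> where "\<psi> \<in> P" "\<And>g. g \<in> P \<Longrightarrow> W g \<le> W \<psi>"
      | (no_max) "P \<noteq> {}" "\<And>\<psi>. \<psi> \<in> P \<Longrightarrow> \<exists>g\<in>P. W \<psi> < W g"
      by (meson not_le)
    then show ?thesis
    proof cases
      case none
      then show ?thesis using IH[OF \<phi>] agree[OF \<phi>] by blast
    next
      case max
      have "\<not> trunc \<psi> g < W g" if "g \<in> P" for g
        using same_degree(2)[OF max(1) that] max(2)[OF that] by auto
      then obtain t and S :: "nat \<Rightarrow> ('k poly, 'g, nat) simple_family"
        where S: "resolution t S" "fam_key (S 1) (Inl 1) = \<psi>"
        using IH[OF P_good[OF max(1)]] agree[OF P_good[OF max(1)] P_le[OF max(1)]] by blast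
      then have "resolution t (S(1 := prepend_key \<phi> (S 1)))"
        using resolution_prepend_key[OF \<phi> fin] succ[OF max(1)] by blast
      then show ?thesis
        by (intro exI[of _ t] exI[of _ "S(1 := prepend_key \<phi> (S 1))"])
          (simp only: fun_upd_same prepend_key_simps simp_thms)
    next
      case no_max
      define L where "L = {\<gamma>. \<exists>g\<in>P. W g = Fin \<gamma>}"
      have P_fin: "W g \<noteq> Infty" if "g \<in> P" for g using no_max(2)[OF that] by auto
      obtain s :: "nat \<Rightarrow> 'g" where s: "strict_mono s" "range s \<subseteq> L" "\<And>x. x \<in> L \<Longrightarrow> \<exists>n. x < s n"
      proof (rule finite_rank_cofinal[OF _ _ fin_rank, of L])
        show "0 \<in> value_group W" "\<And>x y. x \<in> value_group W \<Longrightarrow> y \<in> value_group W \<Longrightarrow> x - y \<in> value_group W"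
          using value_group_0[OF W] value_group_diff[OF W] by auto
        show "L \<subseteq> value_group W" using value_in_group[OF W] by (auto simp: L_def)
        show "L \<noteq> {}" using no_max(1) P_fin by (force simp: L_def not_Infty_iff)
        show "\<exists>y\<in>L. x < y" if x: "x \<in> L" for x
        proof -
          obtain \<psi> where "\<psi> \<in> P" "W \<psi> = Fin x" using x by (auto simp: L_def)
          then obtain g where g: "g \<in> P" "Fin x < W g" using no_max(2) by force
          then obtain y where "W g = Fin y" using P_fin[OF g(1)] unfolding not_Infty_iff by blast
          then show ?thesis using g by (auto simp: L_def)
        qed
      qed blast
      have "\<forall>n. \<exists>g. g \<in> P \<and> W g = Fin (s n)" using s(2) by (auto simp: L_def)
      then obtain \<psi> where \<psi>: "\<And>n. \<psi> n \<in> P" "\<And>n. W (\<psi> n) = Fin (s n)" by metis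
      have \<psi>_less: "W (\<psi> m) < W (\<psi> n)" if "m < n" for m n
        using that s(1) by (simp add: \<psi>(2) strict_mono_def)
      have \<psi>_good: "good (\<psi> n)" and \<psi>_fin: "W (\<psi> n) \<noteq> Infty" for n
        using P_good[OF \<psi>(1)] \<psi>(2) by auto
      have \<psi>_succ: "successor (\<psi> m) (\<psi> n)" if "m < n" for m n
        unfolding successor_def
      proof (intro conjI allI impI)
        show "lead_coeff (\<psi> n) = 1" using \<psi>(1)[of n] unfolding P_def by blast
        show "trunc (\<psi> m) (\<psi> n) < W (\<psi> n)"
          using same_degree(1)[OF \<psi>(1) \<psi>(1)] \<psi>_less[OF that] by (rule le_less_trans)
        fix g :: "'k poly" assume "degree g < degree (\<psi> n)"
        then have "degree g < degree (\<psi> m)" using \<psi>(1)[of n] \<psi>(1)[of m] by (simp add: P_def)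
        then show "trunc (\<psi> m) g = W g" by (rule trunc_small)
      qed
      have \<psi>_mono: "trunc (\<psi> m) g \<le> trunc (\<psi> n) g" if "m \<le> n" for m n g
        using that successor_trunc_le[OF \<psi>_good \<psi>_fin \<psi>_succ, of m n g] by (cases "m = n") auto
      obtain \<chi> where \<chi>: "good \<chi>" "\<And>a g. trunc (\<psi> (Suc a)) g \<le> trunc \<chi> g"
        "limit_augmented W (UNIV :: nat set) (\<lambda>a. trunc (\<psi> (Suc a))) \<chi> (trunc \<chi>)"
        by (rule exists_limit_key[of "UNIV :: nat set" "\<lambda>a. \<psi> (Suc a)"])
          (use \<psi>_good \<psi>_fin \<psi>_mono in auto)
      have \<psi>\<chi>: "trunc (\<psi> n) g \<le> trunc \<chi> g" for n g
        using \<psi>_mono[of n "Suc n" g] \<chi>(2)[of n g] by simp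
      have \<phi>\<chi>: "trunc \<phi> g \<le> trunc \<chi> g" for g
        using P_le[OF \<psi>(1)] \<psi>\<chi> order_trans by blast
      \<comment> \<open>Such a \<open>g\<close> would increase over every \<open>\<psi> n\<close> as
        well and so have value above all \<open>s n\<close>, against cofinality.\<close>
      have "\<not> trunc \<chi> g < W g" if g: "g \<in> P" for g
      proof
        assume "trunc \<chi> g < W g"
        then have less: "W (\<psi> n) < W g" for n
          using same_degree(2)[OF \<psi>(1) g] \<psi>\<chi>[of n g] by (meson le_less_trans)
        obtain x where x: "W g = Fin x" using P_fin[OF g] unfolding not_Infty_iff by blast
        then obtain n where "x < s n" using s(3)[of x] g by (auto simp: L_def)
        then show False using less[of n] x \<psi>(2)[of n] by simp
      qed
      then obtain t and S :: "nat \<Rightarrow> ('k poly, 'g, nat) simple_family"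
        where S: "resolution t S" "fam_key (S 1) (Inl 1) = \<chi>"
        using IH[OF \<chi>(1)] agree[OF \<chi>(1) \<phi>\<chi>] by blast
      \<comment> \<open>\<open>\<psi> 0\<close> closes the finite part because the keys of the
        continuous part must have the degree of the last key before them, and \<open>\<phi>\<close>
        may have smaller degree.\<close>
      define key :: "nat + nat \<Rightarrow> 'k poly" where
        "key = (\<lambda>x. case x of Inl i \<Rightarrow> if i = 1 then \<phi> else \<psi> 0 | Inr a \<Rightarrow> \<psi> (Suc a))"
      have key: "key (Inl (Suc 0)) = \<phi>" "key (Inl 2) = \<psi> 0" "key (Inr a) = \<psi> (Suc a)" for a
        by (simp_all add: key_def)
      define S0 where "S0 = stage_of 2 UNIV key"
      have index: "x \<in> fam_index S0 \<longleftrightarrow> x = Inl 1 \<or> x = Inl 2 \<or> (\<exists>a. x = Inr a)" for x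
        by (cases x) (auto simp: S0_def fam_index_def)
      have S0: "fam_key S0 = key" "fam_n S0 = 2" "fam_A S0 = UNIV" by (simp_all add: S0_def)
      have "canonical_stage S0"
        unfolding canonical_stage_def
      proof (intro conjI ballI impI allI)
        show "good (fam_key S0 x)" if "x \<in> fam_index S0" for x
          using that \<phi> \<psi>_good by (auto simp: index S0 key)
        fix x y assume xy: "x \<in> fam_index S0" "y \<in> fam_index S0" "index_less x y"
        then show "W (fam_key S0 x) \<noteq> Infty" using fin \<psi>_fin by (auto simp: index S0 key)
        fix g show "trunc (fam_key S0 x) g \<le> trunc (fam_key S0 y) g"
          using xy P_le[OF \<psi>(1)] \<psi>_mono by (auto simp: index S0 key)
      next
        fix i assume "i \<in> {2..fam_n S0}"
        then have "i = 2" by (simp add: S0)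
        then show "successor (fam_key S0 (Inl (i - 1))) (fam_key S0 (Inl i))"
          using succ[OF \<psi>(1)] by (simp add: S0 key)
      next
        fix \<alpha> show "successor (fam_key S0 (Inl (fam_n S0))) (fam_key S0 (Inr \<alpha>))"
          using \<psi>_succ by (simp add: S0 key)
        show "degree (fam_key S0 (Inr \<alpha>)) = degree (fam_key S0 (Inl (fam_n S0)))"
          using \<psi>(1)[of 0] \<psi>(1)[of "Suc \<alpha>"] by (simp add: S0 key P_def)
      qed (auto simp: S0_def)
      moreover have "trunc (fam_key S0 x) g \<le> trunc (fam_key (S 1) (Inl 1)) g"
        if "x \<in> fam_index S0" for x g
        using that \<phi>\<chi> \<psi>\<chi> by (auto simp: index S0 key S(2)[simplified])
      moreover have "limit_augmented W (fam_A S0) (\<lambda>\<alpha>. trunc (fam_key S0 (Inr \<alpha>)))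
          (fam_key (S 1) (Inl 1)) (trunc (fam_key (S 1) (Inl 1)))"
        unfolding S(2) using \<chi>(3) by (simp add: S0 key)
      ultimately have "resolution (Suc t) (\<lambda>s. if s = 1 then S0 else S (s - 1))"
        using S(1) by (intro resolution_limit)
      then show ?thesis
        by (intro exI[of _ "Suc t"] exI[of _ "\<lambda>s. if s = 1 then S0 else S (s - 1)"])
          (simp add: S0 key)
    qed
  qed
qed

end

section \<open>One stage of the algorithm\<close>

text \<open>For a subgroup \<open>G\<close> and \<open>n > 0\<close> with
  \<open>nmul n \<mu>\<close> in \<open>G\<close>, this is the subgroup generated by
  \<open>G\<close> and \<open>\<mu>\<close>.\<close>

definition cyclic_extension :: "'g::ab_group_add set \<Rightarrow> 'g \<Rightarrow> nat \<Rightarrow> 'g set" where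
  "cyclic_extension G \<mu> n = {\<gamma> + nmul k \<mu> | \<gamma> k. \<gamma> \<in> G \<and> k < n}"

context
  fixes G :: "'g::linordered_ab_group_add set" and \<mu> :: 'g and n :: nat
  assumes G0: "0 \<in> G" and G_diff: "\<And>x y. x \<in> G \<Longrightarrow> y \<in> G \<Longrightarrow> x - y \<in> G"
    and n: "0 < n" "nmul n \<mu> \<in> G" and n_min: "\<And>k. 0 < k \<Longrightarrow> k < n \<Longrightarrow> nmul k \<mu> \<notin> G"
begin

lemma cyclic_extension_nmul: "\<gamma> \<in> G \<Longrightarrow> \<gamma> + nmul k \<mu> \<in> cyclic_extension G \<mu> n"
proof -
  assume \<gamma>: "\<gamma> \<in> G"
  have "nmul k \<mu> = nmul (k div n) (nmul n \<mu>) + nmul (k mod n) \<mu>"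
    by (simp flip: nmul_mult nmul_add)
  moreover have "\<gamma> + nmul (k div n) (nmul n \<mu>) \<in> G"
    using \<gamma> subgroup_add[OF G0 G_diff] subgroup_nmul[OF G0 G_diff n(2)] by blast
  ultimately show ?thesis
    using n unfolding cyclic_extension_def by (metis (mono_tags, lifting) add.assoc mem_Collect_eq mod_less_divisor)
qed

lemma cyclic_extension_diff:
  assumes "x \<in> cyclic_extension G \<mu> n" "y \<in> cyclic_extension G \<mu> n"
  shows "x - y \<in> cyclic_extension G \<mu> n"
proof -
  obtain \<gamma> k \<gamma>' k' where *: "x = \<gamma> + nmul k \<mu>" "\<gamma> \<in> G" "y = \<gamma>' + nmul k' \<mu>" "\<gamma>' \<in> G"
    using assms by (auto simp: cyclic_extension_def)
  \<comment> \<open>With natural multiples only, subtracting k' times \<open>\<mu>\<close> means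
    adding k' (n - 1) times \<open>\<mu>\<close> and subtracting k' n times \<open>\<mu>\<close>,
    the latter an element of \<open>G\<close>.\<close>
  obtain m where m: "n = Suc m" using n by (cases n) auto
  have "nmul k' (nmul n \<mu>) = nmul (k' * m) \<mu> + nmul k' \<mu>"
    by (simp add: m add.commute flip: nmul_mult nmul_add)
  then have "x - y = (\<gamma> - \<gamma>' - nmul k' (nmul n \<mu>)) + nmul (k + k' * m) \<mu>"
    by (simp add: * nmul_add algebra_simps)
  moreover have "\<gamma> - \<gamma>' - nmul k' (nmul n \<mu>) \<in> G"
    using * G_diff subgroup_nmul[OF G0 G_diff n(2)] by blast
  ultimately show ?thesis using cyclic_extension_nmul by metis
qed

text \<open>The cosets of the multiples k \<open>\<mu>\<close> with k < n exhaust the quotient; two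
  equal ones would put a smaller positive multiple of \<open>\<mu>\<close> into
  \<open>G\<close>.\<close>

lemma group_index_cyclic_extension: "group_index (cyclic_extension G \<mu> n) G = n"
proof -
  have coset: "(+) (\<gamma> + x) ` G = (+) x ` G" if "\<gamma> \<in> G" for \<gamma> x
  proof
    show "(+) (\<gamma> + x) ` G \<subseteq> (+) x ` G"
      using that subgroup_add[OF G0 G_diff] by (auto simp: image_iff add.assoc add.left_commute[of _ x])
    show "(+) x ` G \<subseteq> (+) (\<gamma> + x) ` G"
    proof
      fix y assume "y \<in> (+) x ` G"
      then obtain g where "g \<in> G" "y = x + g" by auto
      then have "y = (\<gamma> + x) + (g - \<gamma>)" "g - \<gamma> \<in> G" using G_diff that by (simp_all add: algebra_simps)
      then show "y \<in> (+) (\<gamma> + x) ` G" by blast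
    qed
  qed
  have "(\<lambda>x. (+) x ` G) ` cyclic_extension G \<mu> n = (\<lambda>k. (+) (nmul k \<mu>) ` G) ` {..<n}"
  proof
    show "(\<lambda>x. (+) x ` G) ` cyclic_extension G \<mu> n \<subseteq> (\<lambda>k. (+) (nmul k \<mu>) ` G) ` {..<n}"
      by (auto simp: cyclic_extension_def coset)
    show "(\<lambda>k. (+) (nmul k \<mu>) ` G) ` {..<n} \<subseteq> (\<lambda>x. (+) x ` G) ` cyclic_extension G \<mu> n"
      using cyclic_extension_nmul[OF G0] by (auto intro: image_eqI)
  qed
  moreover have "inj_on (\<lambda>k. (+) (nmul k \<mu>) ` G) {..<n}"
  proof (rule linorder_inj_onI)
    fix k l assume kl: "k < l" "k \<in> {..<n}" "l \<in> {..<n}"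
    show "(+) (nmul k \<mu>) ` G \<noteq> (+) (nmul l \<mu>) ` G"
    proof
      assume "(+) (nmul k \<mu>) ` G = (+) (nmul l \<mu>) ` G"
      moreover have "nmul k \<mu> + 0 \<in> (+) (nmul k \<mu>) ` G" using G0 by blast
      ultimately obtain g where g: "g \<in> G" "nmul k \<mu> = nmul l \<mu> + g" by auto
      have "nmul l \<mu> = nmul (l - k) \<mu> + nmul k \<mu>" using kl by (simp flip: nmul_add)
      then have "nmul (l - k) \<mu> + nmul k \<mu> + g = nmul k \<mu>" using g by simp
      then have "nmul (l - k) \<mu> = 0 - g" by (simp add: algebra_simps eq_neg_iff_add_eq_0)
      then show False using n_min[of "l - k"] kl G_diff[OF G0 g(1)] by auto
    qed
  qed auto
  ultimately show ?thesis by (simp add: group_index_def card_image)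
qed

end

context pseudo_valuation_kernel
begin

text \<open>In the algorithm, with \<open>d\<close> the degree of the current key, this is the value
  group of the preceding stage.\<close>

definition low_values :: "nat \<Rightarrow> 'g set" where
  "low_values d = {\<gamma>. \<exists>g. degree g < d \<and> W g = Fin \<gamma>}"

context
  fixes \<phi> :: "'k poly" and \<mu> :: 'g
  assumes good: "good \<phi>" and \<mu>: "W \<phi> = Fin \<mu>"
    and G0: "0 \<in> low_values (degree \<phi>)"
    and G_diff: "\<And>x y. x \<in> low_values (degree \<phi>) \<Longrightarrow> y \<in> low_values (degree \<phi>) \<Longrightarrow>
      x - y \<in> low_values (degree \<phi>)"
begin

text \<open>The order \<open>n\<close> is finite by \<open>value_torsion\<close>. Every value of
  \<open>trunc \<phi>\<close> is some \<gamma> + k \<mu>, which can be reduced to k < n; it is then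
  the value of \<open>h * \<phi> ^ k\<close> with \<open>h\<close> of degree below
  \<open>degree \<phi>\<close>. Hence degrees below \<open>n * degree \<phi>\<close> already give
  the full value group.\<close>

lemma stage_structure:
  obtains n where "0 < n" "nmul n \<mu> \<in> low_values (degree \<phi>)"
    "group_index (value_group (trunc \<phi>)) (low_values (degree \<phi>)) = n"
    "value_group (trunc \<phi>) = low_values (n * degree \<phi>)"
    "\<And>g. degree g < n * degree \<phi> \<Longrightarrow> trunc \<phi> g = W g"
    "\<And>x. x \<in> low_values (n * degree \<phi>) \<Longrightarrow> \<exists>\<gamma>\<in>low_values (degree \<phi>). \<exists>k<n. x = \<gamma> + nmul k \<mu>"
proof -
  let ?G = "low_values (degree \<phi>)"
  note deg = good_degree[OF good]
  obtain n' c where n': "0 < n'" "W [:c:] = Fin (nmul n' \<mu>)" using value_torsion[OF \<mu>] by blast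
  then have "nmul n' \<mu> \<in> ?G" using deg by (auto simp: low_values_def intro!: exI[of _ "[:c:]"])
  then obtain n where n: "0 < n" "nmul n \<mu> \<in> ?G"
    and n_min: "\<And>k. 0 < k \<Longrightarrow> nmul k \<mu> \<in> ?G \<Longrightarrow> n \<le> k"
    using n'(1) ex_has_least_nat[of "\<lambda>n. 0 < n \<and> nmul n \<mu> \<in> ?G" n' id] by auto
  then have n_min': "\<And>k. 0 < k \<Longrightarrow> k < n \<Longrightarrow> nmul k \<mu> \<notin> ?G" by (meson not_le)
  let ?E = "cyclic_extension ?G \<mu> n"
  note E_nmul = cyclic_extension_nmul[OF G0 G_diff n n_min']
    and E_diff = cyclic_extension_diff[OF G0 G_diff n n_min']
    and E_index = group_index_cyclic_extension[OF G0 G_diff n n_min']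
  have small: "W g = Infty \<or> (\<exists>\<gamma>\<in>?G. W g = Fin \<gamma>)" if "degree g < degree \<phi>" for g
    using that by (cases "W g") (auto simp: low_values_def)
  have agree: "trunc \<phi> g = W g \<and> (W g = Infty \<or> (\<exists>\<gamma>\<in>?G. \<exists>i<k. W g = Fin (\<gamma> + nmul i \<mu>)))"
    if "k \<le> n" "degree g < k * degree \<phi>" for k g
    using that
  proof (induction k arbitrary: g)
    case (Suc k)
    let ?q = "g div \<phi>" and ?r = "g mod \<phi>"
    have r: "W ?r = Infty \<or> (\<exists>\<gamma>\<in>?G. W ?r = Fin \<gamma>)" by (rule small) (simp add: degree_mod_poly deg)
    show ?case
    proof (cases "k = 0")
      case True
      then have d: "degree g < degree \<phi>" using Suc.prems by simp
      then have "?r = g" by (rule mod_poly_less)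
      then show ?thesis using r True trunc_small[OF d] by auto
    next
      case False
      then have "0 < k * degree \<phi>" using deg by simp
      then have "degree ?q < k * degree \<phi>" using Suc.prems(2) mult_Suc[of k "degree \<phi>"]
        unfolding degree_div_poly[OF deg] by linarith
      then have q: "trunc \<phi> ?q = W ?q"
        "W ?q = Infty \<or> (\<exists>\<gamma>\<in>?G. \<exists>i<k. W ?q = Fin (\<gamma> + nmul i \<mu>))"
        using Suc.IH[of ?q] Suc.prems(1) by auto
      \<comment> \<open>Here \<open>0 < i \<le> k < n\<close> keeps this value out of
        \<open>low_values (degree \<phi>)\<close>, where the value of the remainder lies, so the two
        can agree only if both are \<open>Infty\<close>.\<close>
      have q\<phi>: "W (?q * \<phi>) = Infty \<or> (\<exists>\<gamma>\<in>?G. \<exists>i<Suc k. 0 < i \<and> W (?q * \<phi>) = Fin (\<gamma> + nmul i \<mu>))"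
      proof (cases "W ?q = Infty")
        case False
        then obtain \<gamma> i where "\<gamma> \<in> ?G" "i < k" "W ?q = Fin (\<gamma> + nmul i \<mu>)" using q(2) by auto
        then show ?thesis
          by (intro disjI2 bexI[of _ \<gamma>] exI[of _ "Suc i"])
            (auto simp: pv_mult[OF W] \<mu> nmul_Suc add.assoc)
      qed (simp add: pv_mult[OF W])
      have t: "trunc \<phi> g = min (W ?r) (W (?q * \<phi>))"
        by (subst trunc_rec[OF deg]) (simp add: q(1) pv_mult[OF W])
      have g: "?r + ?q * \<phi> = g" by simp
      have Wg: "W g = min (W ?r) (W (?q * \<phi>))"
      proof (cases "W ?r = W (?q * \<phi>)")
        case True
        have "W ?r = Infty"
        proof (rule ccontr)
          assume "W ?r \<noteq> Infty"
          then obtain \<gamma> \<gamma>' i where *: "\<gamma> \<in> ?G" "\<gamma>' \<in> ?G" "i < Suc k" "0 < i" "\<gamma> = \<gamma>' + nmul i \<mu>"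
            using r q\<phi> True by auto
          then have "nmul i \<mu> \<in> ?G" using G_diff[OF *(1,2)] by (simp add: algebra_simps)
          then show False using n_min[of i] * Suc.prems(1) by simp
        qed
        then show ?thesis using pv_add[OF W, of ?r "?q * \<phi>"] True g by simp
      next
        case False
        then show ?thesis using pv_add_neq[OF W False] g by simp
      qed
      have "\<exists>\<gamma>\<in>?G. \<exists>i<Suc k. W ?r = Fin (\<gamma> + nmul i \<mu>)" if "W ?r \<noteq> Infty"
        using r that by (force intro: exI[of _ 0])
      then show ?thesis using q\<phi> Wg t by (auto simp: min_def)
    qed
  qed simp
  have trunc_values: "trunc \<phi> g = Infty \<or> (\<exists>x\<in>?E. trunc \<phi> g = Fin x)" for g
  proof -
    have "trunc \<phi> g = Infty \<or> (\<exists>\<gamma>\<in>?G. \<exists>k. trunc \<phi> g = Fin (\<gamma> + nmul k \<mu>))"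
      using deg
    proof (induction g rule: poly_div_induct)
      case zero
      then show ?case by (simp add: trunc_0 deg)
    next
      case (div g)
      have "trunc \<phi> g = W (g mod \<phi>) \<or> trunc \<phi> g = trunc \<phi> (g div \<phi>) + W \<phi>"
        using trunc_rec[OF deg, of g] by (auto simp: min_def split: if_splits)
      then show ?case
      proof
        assume *: "trunc \<phi> g = W (g mod \<phi>)"
        have "W (g mod \<phi>) = Infty \<or> (\<exists>\<gamma>\<in>?G. W (g mod \<phi>) = Fin \<gamma>)"
          by (rule small) (simp add: degree_mod_poly deg)
        then show ?thesis
        proof
          assume "\<exists>\<gamma>\<in>?G. W (g mod \<phi>) = Fin \<gamma>"
          then obtain \<gamma> where "\<gamma> \<in> ?G" "W (g mod \<phi>) = Fin \<gamma>" by blast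
          then show ?thesis using * by (intro disjI2 bexI[of _ \<gamma>] exI[of _ 0]) simp_all
        qed (simp add: *)
      next
        assume *: "trunc \<phi> g = trunc \<phi> (g div \<phi>) + W \<phi>"
        show ?thesis
        proof (cases "trunc \<phi> (g div \<phi>) = Infty")
          case False
          then obtain \<gamma> k where "\<gamma> \<in> ?G" "trunc \<phi> (g div \<phi>) = Fin (\<gamma> + nmul k \<mu>)"
            using div.IH by auto
          then show ?thesis using *
            by (intro disjI2 bexI[of _ \<gamma>] exI[of _ "Suc k"]) (auto simp: \<mu> nmul_Suc add.assoc)
        qed (simp add: *)
      qed
    qed
    then show ?thesis using E_nmul by blast
  qed
  have elem: "\<exists>g. degree g < n * degree \<phi> \<and> W g = Fin x \<and> trunc \<phi> g = Fin x" if x: "x \<in> ?E" for x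
  proof -
    obtain \<gamma> k where \<gamma>: "x = \<gamma> + nmul k \<mu>" "\<gamma> \<in> ?G" "k < n" using x unfolding cyclic_extension_def by blast
    then obtain h where h: "degree h < degree \<phi>" "W h = Fin \<gamma>" by (auto simp: low_values_def)
    have "degree (h * \<phi> ^ k) \<le> degree h + k * degree \<phi>"
      using degree_mult_le[of h "\<phi> ^ k"] degree_power_le[of \<phi> k] by (simp add: mult.commute)
    also have "\<dots> < Suc k * degree \<phi>" using h by simp
    also have "\<dots> \<le> n * degree \<phi>" using \<gamma>(3) by (intro mult_le_mono1) simp
    finally have "degree (h * \<phi> ^ k) < n * degree \<phi>" .
    moreover have "W (h * \<phi> ^ k) = Fin x"
      by (simp add: pv_mult[OF W] pv_power[OF W] h \<mu> nmul_Fin \<gamma>)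
    moreover have "trunc \<phi> (h * \<phi> ^ k) = Fin x"
      by (simp add: trunc_mult_key_power deg trunc_small h \<mu> nmul_Fin \<gamma>)
    ultimately show ?thesis by blast
  qed
  have low: "low_values (n * degree \<phi>) = ?E"
  proof
    show "low_values (n * degree \<phi>) \<subseteq> ?E"
      using agree[OF order_refl] E_nmul by (fastforce simp: low_values_def)
    show "?E \<subseteq> low_values (n * degree \<phi>)" using elem by (auto simp: low_values_def)
  qed
  have vg: "value_group (trunc \<phi>) = ?E"
  proof
    show "value_group (trunc \<phi>) \<subseteq> ?E"
    proof
      fix x assume "x \<in> value_group (trunc \<phi>)"
      then obtain a b p q where "trunc \<phi> a = Fin p" "trunc \<phi> b = Fin q" "x = p - q"
        by (rule value_group_cases)
      then show "x \<in> ?E" using trunc_values[of a] trunc_values[of b] E_diff[of p q] by auto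
    qed
    show "?E \<subseteq> value_group (trunc \<phi>)"
      using elem value_in_group[OF good_pseudo_valuation[OF good]] by blast
  qed
  show thesis
  proof (rule that[OF n])
    show "group_index (value_group (trunc \<phi>)) ?G = n" unfolding vg by (rule E_index)
    show "value_group (trunc \<phi>) = low_values (n * degree \<phi>)" by (simp add: low vg)
    show "trunc \<phi> g = W g" if "degree g < n * degree \<phi>" for g using agree[OF order_refl that] by simp
    show "\<exists>\<gamma>\<in>?G. \<exists>k<n. x = \<gamma> + nmul k \<mu>" if "x \<in> low_values (n * degree \<phi>)" for x
      using that unfolding low cyclic_extension_def by blast
  qed
qed

end

text \<open>If \<open>W \<phi>\<close> is finite, \<open>trunc \<phi> f\<close> is strictly below
  \<open>W f\<close>. This can only come from cancellation in the adic expansion, so the least term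
  value occurs at two exponents.\<close>

lemma proj_pos:
  assumes good: "good \<phi>"
  shows "0 < proj f \<phi> (trunc \<phi>)"
proof -
  note deg = good_degree[OF good]
  let ?E = "proj_exponents f \<phi> (trunc \<phi>)"
  have fin: "finite ?E" by (simp add: proj_exponents_def adic_range_def)
  have "\<exists>i\<in>?E. \<exists>j\<in>?E. i < j"
  proof (cases "W \<phi> = Infty")
    case True
    then have "\<phi> = f" by (rule good_Infty(1)[OF good])
    \<comment> \<open>Now \<open>f = \<phi>\<close> has value \<open>Infty\<close>; exponent 0
      counts with coefficient 0 and exponent 1 with coefficient 1.\<close>
    then have "0 \<in> ?E" "1 \<in> ?E"
      using True deg by (auto simp: proj_exponents_def adic_range_def adic_coeff_def trunc_mult_key trunc_key trunc_0)
    then show ?thesis by force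
  next
    case False
    define t where "t = (\<lambda>i. adic_coeff \<phi> f i * \<phi> ^ i)"
    let ?R = "adic_range \<phi> f"
    have R: "finite ?R" "?R \<noteq> {}" by (auto simp: adic_range_def)
    have f: "f = sum t ?R" unfolding t_def by (rule adic_expansion[OF deg])
    have t: "trunc \<phi> (t i) = W (t i)" "trunc \<phi> (t i) = W (adic_coeff \<phi> f i) + nmul i (W \<phi>)" for i
      by (simp_all add: t_def trunc_mult_key_power deg trunc_small adic_coeff_degree
          pv_mult[OF W] pv_power[OF W])
    have Min_eq: "trunc \<phi> f = Min ((\<lambda>i. trunc \<phi> (t i)) ` ?R)"
      by (simp add: t(2)) (simp add: trunc_def augment_def)
    moreover have "Min ((\<lambda>i. trunc \<phi> (t i)) ` ?R) \<in> (\<lambda>i. trunc \<phi> (t i)) ` ?R"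
      using R by (intro Min_in) auto
    ultimately obtain i where i: "i \<in> ?R" "trunc \<phi> f = trunc \<phi> (t i)" by auto
    have min: "trunc \<phi> f \<le> trunc \<phi> (t j)" if "j \<in> ?R" for j
      unfolding Min_eq using R that by (intro Min_le) auto
    have "\<exists>j\<in>?R. j \<noteq> i \<and> trunc \<phi> (t j) = trunc \<phi> f"
    proof (rule ccontr)
      assume *: "\<not> ?thesis"
      have "W (t i) < W (t j)" if "j \<in> ?R" "j \<noteq> i" for j
        using * that min[of j] i by (force simp flip: t(1))
      then have "W (sum t ?R) = W (t i)" using R i(1) by (intro pv_sum_unique_min[OF W]) auto
      then have "W f = W (t i)" by (simp only: f[symmetric])
      then show False using trunc_f_less[OF good False] i(2) t(1) by simp
    qed
    then obtain j where j: "j \<in> ?R" "j \<noteq> i" "trunc \<phi> (t j) = trunc \<phi> f" by blast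
    then have "i \<in> ?E" "j \<in> ?E" using i by (auto simp: proj_exponents_def t_def)
    then show ?thesis using j(2) by (metis neqE)
  qed
  then obtain i j where ij: "i \<in> ?E" "j \<in> ?E" "i < j" by blast
  then have "Min ?E \<le> i" "j \<le> Max ?E" using fin by auto
  then show ?thesis using ij by (simp add: proj_def)
qed

end

section \<open>The algorithm\<close>

context residually_closed_extension
begin

abbreviation stage_count :: "(nat \<Rightarrow> 'k poly) \<Rightarrow> nat \<Rightarrow> nat" where
  "stage_count \<phi> \<equiv> stage_index \<nu> (\<lambda>i. trunc (\<phi> i))"

text \<open>The last clause is the increase of value that makes \<open>\<psi>\<close> a successor of
  \<open>\<phi> m\<close>. \<open>c \<noteq> 0\<close> is recorded for the homogeneity proof, where
  the support of the expansion is determined.\<close>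

definition algorithm_step ::
  "(nat \<Rightarrow> 'k poly) \<Rightarrow> nat \<Rightarrow> 'k poly \<Rightarrow> 'k \<Rightarrow> (nat \<Rightarrow> nat) \<Rightarrow> bool" where
  "algorithm_step \<phi> m \<psi> c j \<longleftrightarrow>
     c \<noteq> 0 \<and> c \<in> val_ring \<nu> \<and> (\<forall>l\<in>{1..m - 1}. j l < stage_count \<phi> l) \<and>
     \<psi> = \<phi> m ^ stage_count \<phi> m - smult c (\<Prod>l=1..m - 1. \<phi> l ^ j l) \<and>
     nmul (stage_count \<phi> m) (W (\<phi> m)) < W \<psi>"

definition algorithm_run :: "nat \<Rightarrow> (nat \<Rightarrow> 'k poly) \<Rightarrow> bool" where
  "algorithm_run m \<phi> \<longleftrightarrow> 1 \<le> m \<and> \<phi> 1 = zvar \<and>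
     (\<forall>i\<in>{1..<m}. W (\<phi> i) \<noteq> Infty \<and> (\<exists>c j. algorithm_step \<phi> i (\<phi> (Suc i)) c j))"

text \<open>If \<open>W zvar\<close> were negative, the leading term of the monic integral
  \<open>f\<close> would have the strictly least value among all terms, and \<open>W f\<close> would
  be finite.\<close>

lemma W_zvar_nonneg: "0 \<le> W zvar"
proof (rule ccontr)
  assume neg: "\<not> 0 \<le> W zvar"
  then obtain w where w: "W zvar = Fin w" "w < 0" by (cases "W zvar") (auto simp: zero_vext_def)
  define t where "t = (\<lambda>i. monom (coeff f i) i)"
  have t: "W (t i) = \<nu> (coeff f i) + Fin (nmul i w)" for i
  proof -
    have "t i = [:coeff f i:] * zvar ^ i" by (simp add: t_def monom_altdef)
    then show ?thesis by (simp only: pv_mult[OF W] pv_power[OF W] W_const w nmul_Fin)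
  qed
  have f: "f = sum t {..degree f}" by (simp add: t_def poly_as_sum_of_monoms)
  have "W (t (degree f)) < W (t i)" if "i \<in> {..degree f}" "i \<noteq> degree f" for i
  proof -
    have "nmul (degree f) w = nmul (degree f - i) w + nmul i w"
      using that by (simp flip: nmul_add)
    moreover have "nmul (degree f - i) w < 0"
      using nmul_strict_mono[OF w(2), of "degree f - i"] that by simp
    ultimately have "Fin (nmul (degree f) w) < Fin (nmul i w)" by simp
    also have "\<dots> \<le> \<nu> (coeff f i) + Fin (nmul i w)"
      using f_integral by (intro add_increasing) (auto simp: in_val_ring_poly_def val_ring_def)
    finally show ?thesis by (simp add: t monic_f pv_1[OF pv_\<nu>])
  qed
  then have "W f = W (t (degree f))" by (subst (1) f) (rule pv_sum_unique_min[OF W], auto)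
  also have "\<dots> \<noteq> Infty" by (simp add: t monic_f pv_1[OF pv_\<nu>])
  finally show False using W_Infty_iff[of f] by simp
qed

lemma in_val_ring_poly_1: "in_val_ring_poly \<nu> 1"
  by (simp add: in_val_ring_poly_def val_ring_closed)

lemma in_val_ring_poly_diff:
  "in_val_ring_poly \<nu> p \<Longrightarrow> in_val_ring_poly \<nu> q \<Longrightarrow> in_val_ring_poly \<nu> (p - q)"
  by (simp add: in_val_ring_poly_def val_ring_closed)

lemma in_val_ring_poly_smult:
  "c \<in> val_ring \<nu> \<Longrightarrow> in_val_ring_poly \<nu> p \<Longrightarrow> in_val_ring_poly \<nu> (smult c p)"
  by (simp add: in_val_ring_poly_def val_ring_closed)

lemma in_val_ring_poly_mult:
  assumes "in_val_ring_poly \<nu> p" "in_val_ring_poly \<nu> q"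
  shows "in_val_ring_poly \<nu> (p * q)"
proof -
  have sum: "sum h B \<in> val_ring \<nu>" if "\<And>i. i \<in> B \<Longrightarrow> h i \<in> val_ring \<nu>" for h :: "nat \<Rightarrow> 'k" and B
    using that by (induction B rule: infinite_finite_induct) (simp_all add: val_ring_closed)
  show ?thesis
    unfolding in_val_ring_poly_def coeff_mult
    using assms by (intro allI sum val_ring_closed(5)) (auto simp: in_val_ring_poly_def)
qed

lemma in_val_ring_poly_power: "in_val_ring_poly \<nu> p \<Longrightarrow> in_val_ring_poly \<nu> (p ^ n)"
  by (induction n) (simp_all add: in_val_ring_poly_1 in_val_ring_poly_mult)

lemma in_val_ring_poly_prod:
  "(\<And>i. i \<in> A \<Longrightarrow> in_val_ring_poly \<nu> (g i)) \<Longrightarrow> in_val_ring_poly \<nu> (prod g A)"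
  by (induction A rule: infinite_finite_induct)
    (simp_all add: in_val_ring_poly_1 in_val_ring_poly_mult)

definition reduced_exponents :: "(nat \<Rightarrow> 'k poly) \<Rightarrow> nat \<Rightarrow> (nat \<Rightarrow> nat) set" where
  "reduced_exponents \<phi> m = {j. \<forall>l\<in>{1..m - 1}. j l < stage_count \<phi> l}"

abbreviation key_monomial :: "(nat \<Rightarrow> 'k poly) \<Rightarrow> nat \<Rightarrow> (nat \<Rightarrow> nat) \<Rightarrow> 'k poly" where
  "key_monomial \<phi> m j \<equiv> (\<Prod>l=1..m - 1. \<phi> l ^ j l)"

text \<open>The invariant of the algorithm. Every value below the degree of \<open>\<phi> m\<close>
  comes from a scalar times a reduced monomial, which supplies the subtracted term of the next step;
  the bound of monomial values by \<open>W (\<phi> m)\<close> puts the scalar of that term into the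
  valuation ring.\<close>

definition key_stage :: "(nat \<Rightarrow> 'k poly) \<Rightarrow> nat \<Rightarrow> bool" where
  "key_stage \<phi> m \<longleftrightarrow> good (\<phi> m) \<and> 0 \<le> W (\<phi> m) \<and>
     0 \<in> low_values (degree (\<phi> m)) \<and>
     (\<forall>x\<in>low_values (degree (\<phi> m)). \<forall>y\<in>low_values (degree (\<phi> m)).
        x - y \<in> low_values (degree (\<phi> m))) \<and>
     low_values (degree (\<phi> m)) = (if m = 1 then value_group \<nu> else value_group (trunc (\<phi> (m - 1)))) \<and>
     (\<forall>j\<in>reduced_exponents \<phi> m. W (key_monomial \<phi> m j) \<le> W (\<phi> m) \<and>
        degree (key_monomial \<phi> m j) < degree (\<phi> m)) \<and>
     (\<forall>\<gamma>\<in>low_values (degree (\<phi> m)). \<exists>c. \<exists>j\<in>reduced_exponents \<phi> m.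
        Fin \<gamma> = W (smult c (key_monomial \<phi> m j)))"

lemma W_smult: "W (smult c g) = \<nu> c + W g"
  using pv_mult[OF W, of "[:c:]" g] by (simp add: W_const)

lemma good_zvar: "good zvar"
  unfolding good_def
proof (intro conjI pseudo_valuation_trunc)
  show "W (a * b mod zvar) = W (a * b)"
    if ab: "degree a < degree (zvar :: 'k poly)" "degree b < degree (zvar :: 'k poly)" for a b :: "'k poly"
  proof -
    have "degree (a * b) < degree (zvar :: 'k poly)" using ab degree_mult_le[of a b] by simp
    then show ?thesis by (simp only: mod_poly_less)
  qed
qed (use degree_f in auto)

lemma low_values_1: "low_values 1 = value_group \<nu>"
proof
  show "low_values 1 \<subseteq> value_group \<nu>"
  proof
    fix x assume "x \<in> low_values 1"
    then obtain g where g: "degree g = 0" "W g = Fin x" by (auto simp: low_values_def)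
    then obtain a where "g = [:a:]" by (auto elim: degree_eq_zeroE)
    then show "x \<in> value_group \<nu>" using g W_const value_in_group[OF pv_\<nu>] by simp
  qed
  show "value_group \<nu> \<subseteq> low_values 1"
  proof
    fix x assume "x \<in> value_group \<nu>"
    then obtain a b p q where ab: "\<nu> a = Fin p" "\<nu> b = Fin q" "x = p - q" by (rule value_group_cases)
    then have "b \<noteq> 0" using \<nu>_Infty[of b] by auto
    then have "\<nu> (a / b) + \<nu> b = \<nu> a" by (simp flip: pv_mult[OF pv_\<nu>])
    then have "\<nu> (a / b) = Fin x" using ab by (cases "\<nu> (a / b)") auto
    then show "x \<in> low_values 1" by (auto simp: low_values_def W_const intro!: exI[of _ "[:a / b:]"])
  qed
qed

text \<open>The only monomial is 1, so its bound amounts to \<open>0 \<le> W zvar\<close>.\<close>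

lemma key_stage_1:
  assumes "\<phi> 1 = zvar"
  shows "key_stage \<phi> 1"
proof -
  have "\<exists>c. Fin \<gamma> = W (smult c 1)" if \<gamma>: "\<gamma> \<in> low_values 1" for \<gamma>
  proof -
    obtain g where g: "degree g = 0" "W g = Fin \<gamma>" using \<gamma> by (auto simp: low_values_def)
    then obtain a where "g = [:a:]" by (auto elim: degree_eq_zeroE)
    then show ?thesis using g by (intro exI[of _ a]) (simp add: one_pCons)
  qed
  then show ?thesis
    using good_zvar W_zvar_nonneg low_values_1 assms pv_1[OF W]
      value_group_0[OF pv_\<nu>] value_group_diff[OF pv_\<nu>]
    by (auto simp: key_stage_def reduced_exponents_def)
qed

context
  fixes \<phi> :: "nat \<Rightarrow> 'k poly" and m :: nat and \<mu> :: 'g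
  assumes m: "1 \<le> m" and stage: "key_stage \<phi> m" and \<mu>: "W (\<phi> m) = Fin \<mu>"
begin

text \<open>\<open>key_stage\<close> identifies \<open>low_values (degree (\<phi> m))\<close> with
  the preceding value group, so the order n of \<open>stage_structure\<close> is the index
  \<open>stage_count \<phi> m\<close>.\<close>

lemma stage_facts:
  "0 < stage_count \<phi> m" "nmul (stage_count \<phi> m) \<mu> \<in> low_values (degree (\<phi> m))"
  "value_group (trunc (\<phi> m)) = low_values (stage_count \<phi> m * degree (\<phi> m))"
  "degree g < stage_count \<phi> m * degree (\<phi> m) \<Longrightarrow> trunc (\<phi> m) g = W g"
  "x \<in> low_values (stage_count \<phi> m * degree (\<phi> m)) \<Longrightarrow>
    \<exists>\<gamma>\<in>low_values (degree (\<phi> m)). \<exists>k<stage_count \<phi> m. x = \<gamma> + nmul k \<mu>"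
proof -
  have S: "good (\<phi> m)" "0 \<in> low_values (degree (\<phi> m))"
    "\<And>x y. x \<in> low_values (degree (\<phi> m)) \<Longrightarrow> y \<in> low_values (degree (\<phi> m)) \<Longrightarrow>
      x - y \<in> low_values (degree (\<phi> m))"
    "low_values (degree (\<phi> m)) = (if m = 1 then value_group \<nu> else value_group (trunc (\<phi> (m - 1))))"
    using stage by (auto simp: key_stage_def)
  obtain n' where n': "0 < n'" "nmul n' \<mu> \<in> low_values (degree (\<phi> m))"
    "group_index (value_group (trunc (\<phi> m))) (low_values (degree (\<phi> m))) = n'"
    "value_group (trunc (\<phi> m)) = low_values (n' * degree (\<phi> m))"
    "\<And>g. degree g < n' * degree (\<phi> m) \<Longrightarrow> trunc (\<phi> m) g = W g"
    "\<And>x. x \<in> low_values (n' * degree (\<phi> m)) \<Longrightarrow>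
      \<exists>\<gamma>\<in>low_values (degree (\<phi> m)). \<exists>k<n'. x = \<gamma> + nmul k \<mu>"
    using stage_structure[OF S(1) \<mu> S(2,3)] by blast
  have "stage_count \<phi> m = n'" using n'(3) S(4) by (simp add: stage_index_def)
  then show "0 < stage_count \<phi> m" "nmul (stage_count \<phi> m) \<mu> \<in> low_values (degree (\<phi> m))"
    "value_group (trunc (\<phi> m)) = low_values (stage_count \<phi> m * degree (\<phi> m))"
    "degree g < stage_count \<phi> m * degree (\<phi> m) \<Longrightarrow> trunc (\<phi> m) g = W g"
    "x \<in> low_values (stage_count \<phi> m * degree (\<phi> m)) \<Longrightarrow>
      \<exists>\<gamma>\<in>low_values (degree (\<phi> m)). \<exists>k<stage_count \<phi> m. x = \<gamma> + nmul k \<mu>"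
    using n' by simp_all
qed

text \<open>A scaled monomial with the value of \<open>\<phi> m ^ n\<close> exists by the invariant,
  and a unit \<open>d\<close> adjusts its residue. With \<mu> the value of \<open>\<phi> m\<close>,
  the scalar is integral because the monomial has value at most \<mu>, and \<mu> \<le> n \<mu>, the
  value of the scaled monomial.\<close>

lemma exists_algorithm_step: "\<exists>\<psi> c j. algorithm_step \<phi> m \<psi> c j"
proof -
  obtain c j where j: "j \<in> reduced_exponents \<phi> m"
    and val: "Fin (nmul (stage_count \<phi> m) \<mu>) = W (smult c (key_monomial \<phi> m j))"
    using stage stage_facts(2) unfolding key_stage_def by blast
  let ?h = "smult c (key_monomial \<phi> m j)"
  have "W (\<phi> m ^ stage_count \<phi> m) = W ?h" by (simp only: pv_power[OF W] \<mu> nmul_Fin val)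
  then obtain d where d: "\<nu> d = 0" "W ?h < W (\<phi> m ^ stage_count \<phi> m - smult d ?h)"
    using exists_unit_multiple[of "\<phi> m ^ stage_count \<phi> m" ?h] val by force
  have "c \<noteq> 0" using val pv_0[OF W] by auto
  moreover have "d \<noteq> 0" using d(1) \<nu>_Infty[of d] by auto
  moreover have "0 \<le> \<nu> c"
  proof (rule ccontr)
    assume "\<not> 0 \<le> \<nu> c"
    then have neg: "\<nu> c < 0" by simp
    have le: "W (key_monomial \<phi> m j) \<le> Fin \<mu>" using stage j \<mu> by (auto simp: key_stage_def)
    then have fin: "W (key_monomial \<phi> m j) \<noteq> Infty" by auto
    have "\<nu> c + W (key_monomial \<phi> m j) < 0 + W (key_monomial \<phi> m j)"
      using vext_add_cancel(5)[OF fin] neg by blast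
    then have "Fin (nmul (stage_count \<phi> m) \<mu>) < Fin \<mu>" using le by (simp add: val W_smult)
    moreover have "nmul 1 \<mu> \<le> nmul (stage_count \<phi> m) \<mu>"
      using stage stage_facts(1) by (intro nmul_mono_left) (auto simp: key_stage_def \<mu> zero_vext_def)
    ultimately show False by simp
  qed
  ultimately have "algorithm_step \<phi> m (\<phi> m ^ stage_count \<phi> m - smult d ?h) (d * c) j"
    using d j val by (simp add: algorithm_step_def reduced_exponents_def val_ring_def
        pv_mult[OF pv_\<nu>] \<mu> nmul_Fin)
  then show ?thesis by blast
qed

context
  fixes c :: 'k and j :: "nat \<Rightarrow> nat"
  assumes step: "algorithm_step \<phi> m (\<phi> (Suc m)) c j"
begin

lemma step_exponents: "j \<in> reduced_exponents \<phi> m"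
  using step by (simp add: algorithm_step_def reduced_exponents_def)

lemma step_eq: "\<phi> (Suc m) = \<phi> m ^ stage_count \<phi> m - smult c (key_monomial \<phi> m j)"
  using step by (simp add: algorithm_step_def)

lemma step_less: "Fin (nmul (stage_count \<phi> m) \<mu>) < W (\<phi> (Suc m))"
  using step unfolding algorithm_step_def \<mu> nmul_Fin by blast

lemma step_monomial_degree: "degree (smult c (key_monomial \<phi> m j)) < degree (\<phi> m)"
  using stage step_exponents degree_smult_le[of c "key_monomial \<phi> m j"]
  by (auto simp: key_stage_def)

lemma step_degree: "degree (\<phi> (Suc m)) = stage_count \<phi> m * degree (\<phi> m)" "lead_coeff (\<phi> (Suc m)) = 1"
proof -
  have lc: "lead_coeff (\<phi> m) = 1" using stage by (simp add: key_stage_def good_def)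
  then have "\<phi> m \<noteq> 0" by auto
  then have pow: "degree (\<phi> m ^ stage_count \<phi> m) = stage_count \<phi> m * degree (\<phi> m)" by (simp add: degree_power_eq)
  define p where "p = - smult c (key_monomial \<phi> m j)"
  have "1 * degree (\<phi> m) \<le> stage_count \<phi> m * degree (\<phi> m)" using stage_facts(1) by (intro mult_le_mono1) simp
  then have less: "degree p < degree (\<phi> m ^ stage_count \<phi> m)"
    unfolding p_def degree_minus pow using step_monomial_degree by linarith
  have eq: "\<phi> (Suc m) = p + \<phi> m ^ stage_count \<phi> m" unfolding step_eq p_def by simp
  show "degree (\<phi> (Suc m)) = stage_count \<phi> m * degree (\<phi> m)"
    unfolding eq using less pow by (subst degree_add_eq_right) simp_all
  show "lead_coeff (\<phi> (Suc m)) = 1"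
    unfolding eq using less lc by (subst lead_coeff_add_le) (simp_all add: lead_coeff_power)
qed

lemma step_monomial_value: "W (smult c (key_monomial \<phi> m j)) = Fin (nmul (stage_count \<phi> m) \<mu>)"
proof -
  have "W (\<phi> m ^ stage_count \<phi> m) = Fin (nmul (stage_count \<phi> m) \<mu>)" by (simp add: pv_power[OF W] \<mu> nmul_Fin)
  moreover have "Fin (nmul (stage_count \<phi> m) \<mu>) < W (\<phi> m ^ stage_count \<phi> m - smult c (key_monomial \<phi> m j))"
    using step_less unfolding step_eq .
  ultimately show ?thesis using pv_diff_eq[OF W, of "\<phi> m ^ stage_count \<phi> m"] by metis
qed

text \<open>The remainder of \<open>\<phi> (Suc m)\<close> modulo \<open>\<phi> m\<close> is minus
  the scaled monomial. Its value n \<mu> bounds the truncated value from above, strictly below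
  \<open>W (\<phi> (Suc m))\<close>.\<close>

lemma step_successor: "successor (\<phi> m) (\<phi> (Suc m))"
  unfolding successor_def
proof (intro conjI allI impI)
  have deg: "0 < degree (\<phi> m)" using stage by (simp add: key_stage_def good_def)
  have "\<phi> m ^ stage_count \<phi> m = \<phi> m ^ (stage_count \<phi> m - 1) * \<phi> m" using stage_facts(1) by (simp flip: power_Suc2)
  then have "\<phi> m ^ stage_count \<phi> m mod \<phi> m = 0" by simp
  then have md: "\<phi> (Suc m) mod \<phi> m = - smult c (key_monomial \<phi> m j)"
    using step_monomial_degree
    by (simp add: step_eq poly_mod_diff_left mod_poly_less del: degree_smult_eq mod_smult_left)
  have "trunc (\<phi> m) (\<phi> (Suc m)) \<le> Fin (nmul (stage_count \<phi> m) \<mu>)"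
    by (subst trunc_rec[OF deg]) (simp only: md pv_minus[OF W] step_monomial_value min.cobounded1)
  then show "trunc (\<phi> m) (\<phi> (Suc m)) < W (\<phi> (Suc m))" using step_less by simp
  show "lead_coeff (\<phi> (Suc m)) = 1" by (rule step_degree)
  show "trunc (\<phi> m) g = W g" if "degree g < degree (\<phi> (Suc m))" for g :: "'k poly"
    using that unfolding step_degree(1) by (rule stage_facts(4))
qed

lemma key_monomial_Suc: "key_monomial \<phi> (Suc m) i = key_monomial \<phi> m i * \<phi> m ^ i m"
  using m by (cases m) simp_all

lemma reduced_exponents_Suc:
  "i \<in> reduced_exponents \<phi> (Suc m) \<longleftrightarrow> i \<in> reduced_exponents \<phi> m \<and> i m < stage_count \<phi> m"
proof -
  have "{1..Suc m - 1} = insert m {1..m - 1}" using m by auto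
  then show ?thesis by (auto simp: reduced_exponents_def)
qed

text \<open>A new monomial is an old one times \<open>\<phi> m ^ k\<close> with k < n, of value at
  most \<mu> + k \<mu> \<le> n \<mu>, which is below the new key value; degrees are estimated in the
  same way. A new value \<gamma> + k \<mu> is realised by taking the monomial for \<gamma> and
  setting exponent m to k.\<close>

lemma step_key_stage: "key_stage \<phi> (Suc m)"
proof -
  note S = stage[unfolded key_stage_def]
  have good: "good (\<phi> m)" and \<mu>0: "0 \<le> \<mu>" using S by (auto simp: \<mu> zero_vext_def)
  have "W (\<phi> m) \<noteq> Infty" using \<mu> by simp
  then have good': "good (\<phi> (Suc m))" using successor_good[OF good _ step_successor] by blast
  have low: "low_values (degree (\<phi> (Suc m))) = value_group (trunc (\<phi> m))"
    by (simp add: step_degree stage_facts)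
  have c: "c \<in> val_ring \<nu>" using step by (simp add: algorithm_step_def)
  show ?thesis
    unfolding key_stage_def
  proof (intro conjI ballI good')
    show "0 \<le> W (\<phi> (Suc m))" using step_less nmul_nonneg[OF \<mu>0, of "stage_count \<phi> m"]
      by (cases "W (\<phi> (Suc m))") (auto simp: zero_vext_def)
    show "low_values (degree (\<phi> (Suc m))) = (if Suc m = 1 then value_group \<nu>
        else value_group (trunc (\<phi> (Suc m - 1))))"
      using low m by simp
    show "0 \<in> low_values (degree (\<phi> (Suc m)))"
      unfolding low by (rule value_group_0[OF good_pseudo_valuation[OF good]])
    show "x - y \<in> low_values (degree (\<phi> (Suc m)))"
      if "x \<in> low_values (degree (\<phi> (Suc m)))" "y \<in> low_values (degree (\<phi> (Suc m)))" for x y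
      using that unfolding low by (rule value_group_diff[OF good_pseudo_valuation[OF good]])
    fix i assume "i \<in> reduced_exponents \<phi> (Suc m)"
    then have i: "i \<in> reduced_exponents \<phi> m" "Suc (i m) \<le> stage_count \<phi> m"
      by (auto simp: reduced_exponents_Suc Suc_le_eq)
    have le: "W (key_monomial \<phi> m i) \<le> Fin \<mu>" "degree (key_monomial \<phi> m i) < degree (\<phi> m)"
      using S i(1) \<mu> by auto
    have "W (key_monomial \<phi> (Suc m) i) \<le> Fin \<mu> + Fin (nmul (i m) \<mu>)"
      unfolding key_monomial_Suc pv_mult[OF W] pv_power[OF W] \<mu> nmul_Fin
      by (rule add_right_mono) (rule le(1))
    also have "\<dots> \<le> Fin (nmul (stage_count \<phi> m) \<mu>)"
      using nmul_mono_left[OF i(2) \<mu>0] by (simp add: nmul_Suc add.commute)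
    finally show "W (key_monomial \<phi> (Suc m) i) \<le> W (\<phi> (Suc m))" using step_less by simp
    have "degree (key_monomial \<phi> (Suc m) i) \<le> degree (key_monomial \<phi> m i) + i m * degree (\<phi> m)"
      unfolding key_monomial_Suc
      using degree_mult_le[of "key_monomial \<phi> m i" "\<phi> m ^ i m"] degree_power_le[of "\<phi> m" "i m"]
      by (simp add: mult.commute)
    also have "\<dots> < Suc (i m) * degree (\<phi> m)" using le by simp
    also have "\<dots> \<le> stage_count \<phi> m * degree (\<phi> m)" using i(2) by (rule mult_le_mono1)
    finally show "degree (key_monomial \<phi> (Suc m) i) < degree (\<phi> (Suc m))" by (simp add: step_degree)
  next
    fix x assume "x \<in> low_values (degree (\<phi> (Suc m)))"
    then obtain \<gamma> k where x: "x = \<gamma> + nmul k \<mu>" "\<gamma> \<in> low_values (degree (\<phi> m))" "k < stage_count \<phi> m"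
      using stage_facts(5)[of x] by (auto simp: step_degree)
    then obtain d i where i: "i \<in> reduced_exponents \<phi> m" "Fin \<gamma> = W (smult d (key_monomial \<phi> m i))"
      using S by blast
    define i' where "i' = i(m := k)"
    have mono: "key_monomial \<phi> m i' = key_monomial \<phi> m i"
      by (rule prod.cong) (use m in \<open>auto simp: i'_def\<close>)
    have "i' \<in> reduced_exponents \<phi> (Suc m)"
      unfolding reduced_exponents_Suc using i x(3) m by (auto simp: reduced_exponents_def i'_def)
    moreover have "Fin x = W (smult d (key_monomial \<phi> (Suc m) i'))"
    proof -
      have "smult d (key_monomial \<phi> (Suc m) i') = smult d (key_monomial \<phi> m i) * \<phi> m ^ k"
        unfolding key_monomial_Suc mono by (simp add: i'_def)
      then show ?thesis
        by (simp only: pv_mult[OF W] pv_power[OF W] i(2)[symmetric] \<mu> nmul_Fin x(1) plus_vext.simps)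
    qed
    ultimately show "\<exists>d. \<exists>i\<in>reduced_exponents \<phi> (Suc m). Fin x = W (smult d (key_monomial \<phi> (Suc m) i))"
      by blast
  qed
qed

lemma step_in_val_ring:
  assumes "\<And>l. l \<in> {1..m} \<Longrightarrow> in_val_ring_poly \<nu> (\<phi> l)"
  shows "in_val_ring_poly \<nu> (\<phi> (Suc m))"
  unfolding step_eq
  using step m by (intro in_val_ring_poly_diff in_val_ring_poly_power in_val_ring_poly_smult
      in_val_ring_poly_prod assms) (auto simp: algorithm_step_def)

end

end

end

section \<open>Realizations\<close>

context residually_closed_extension
begin

lemma stage_index_cong:
  assumes "\<And>i. i \<in> {1..m} \<Longrightarrow> \<phi> i = \<psi> i" "l \<in> {1..m}"
  shows "stage_count \<phi> l = stage_count \<psi> l"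
proof -
  have "l \<noteq> 1 \<Longrightarrow> l - 1 \<in> {1..m}" using assms(2) by auto
  then have "\<phi> l = \<psi> l" "l \<noteq> 1 \<Longrightarrow> \<phi> (l - 1) = \<psi> (l - 1)" using assms by blast+
  then show ?thesis by (simp add: stage_index_def)
qed

text \<open>A step depends only on the keys up to \<open>m\<close>. This allows later keys to be
  changed, both when a run is extended and when infinitely many runs are glued.\<close>

lemma algorithm_step_cong:
  assumes "\<And>i. i \<in> {1..m} \<Longrightarrow> \<phi> i = \<psi> i" "1 \<le> m"
  shows "algorithm_step \<phi> m = algorithm_step \<psi> m"
proof (intro ext)
  fix \<chi> c j
  have s: "stage_count \<phi> l = stage_count \<psi> l" if "l \<in> {1..m}" for l
    using assms(1) that by (rule stage_index_cong)
  have "key_monomial \<phi> m j = key_monomial \<psi> m j" by (rule prod.cong) (use assms in auto)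
  moreover have "\<phi> m = \<psi> m" "stage_count \<phi> m = stage_count \<psi> m" using assms s by auto
  moreover have "(\<forall>l\<in>{1..m - 1}. j l < stage_count \<phi> l) \<longleftrightarrow> (\<forall>l\<in>{1..m - 1}. j l < stage_count \<psi> l)"
    by (intro ball_cong refl) (use s in auto)
  ultimately show "algorithm_step \<phi> m \<chi> c j = algorithm_step \<psi> m \<chi> c j"
    unfolding algorithm_step_def by simp
qed

lemma algorithm_run_cong:
  assumes "\<And>i. i \<in> {1..m} \<Longrightarrow> \<phi> i = \<psi> i" and run: "algorithm_run m \<phi>"
  shows "algorithm_run m \<psi>"
proof -
  have m: "1 \<le> m" using run by (simp add: algorithm_run_def)
  have "W (\<psi> i) \<noteq> Infty \<and> (\<exists>c j. algorithm_step \<psi> i (\<psi> (Suc i)) c j)" if i: "i \<in> {1..<m}" for i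
  proof -
    have "algorithm_step \<phi> i = algorithm_step \<psi> i"
      by (rule algorithm_step_cong) (use assms(1) i in auto)
    moreover have "\<phi> i = \<psi> i" "\<phi> (Suc i) = \<psi> (Suc i)" using assms(1) i by auto
    ultimately show ?thesis using run i unfolding algorithm_run_def by metis
  qed
  moreover have "\<psi> 1 = \<phi> 1" using assms(1)[of 1] m by simp
  ultimately show ?thesis using run unfolding algorithm_run_def by metis
qed

lemma algorithm_run_le: "algorithm_run m \<phi> \<Longrightarrow> 1 \<le> i \<Longrightarrow> i \<le> m \<Longrightarrow> algorithm_run i \<phi>"
  by (auto simp: algorithm_run_def)

lemma algorithm_run_step:
  assumes "algorithm_run m \<phi>" "1 \<le> i" "i < m"
  obtains \<mu> c j where "W (\<phi> i) = Fin \<mu>" "algorithm_step \<phi> i (\<phi> (Suc i)) c j"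
proof -
  have "W (\<phi> i) \<noteq> Infty \<and> (\<exists>c j. algorithm_step \<phi> i (\<phi> (Suc i)) c j)"
    using assms unfolding algorithm_run_def by (metis atLeastLessThan_iff)
  then show thesis using that unfolding not_Infty_iff by blast
qed

lemma algorithm_run_key_stage:
  assumes "algorithm_run m \<phi>" "1 \<le> i" "i \<le> m"
  shows "key_stage \<phi> i"
  using assms(2,3)
proof (induction i rule: dec_induct)
  case base
  show ?case using assms(1) by (intro key_stage_1) (simp add: algorithm_run_def)
next
  case (step i)
  then obtain \<mu> c j where "W (\<phi> i) = Fin \<mu>" "algorithm_step \<phi> i (\<phi> (Suc i)) c j"
    using algorithm_run_step[OF assms(1), of i] by auto
  then show ?case using step_key_stage step by simp
qed

lemma algorithm_run_good:
  assumes "algorithm_run m \<phi>" "1 \<le> i" "i \<le> m"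
  shows "good (\<phi> i)"
  using algorithm_run_key_stage[OF assms] by (simp add: key_stage_def)

lemma algorithm_run_in_val_ring:
  assumes "algorithm_run m \<phi>" "1 \<le> i" "i \<le> m"
  shows "in_val_ring_poly \<nu> (\<phi> i)"
  using assms(2,3)
proof (induction i rule: less_induct)
  case (less i)
  show ?case
  proof (cases "i = 1")
    case True
    then show ?thesis
      using assms(1) by (auto simp: algorithm_run_def in_val_ring_poly_def coeff_pCons val_ring_closed split: nat.split)
  next
    case False
    then obtain k where k: "i = Suc k" "1 \<le> k" using less.prems by (cases i) auto
    then obtain \<mu> c j where "W (\<phi> k) = Fin \<mu>" "algorithm_step \<phi> k (\<phi> (Suc k)) c j"
      using algorithm_run_step[OF assms(1), of k] less.prems by auto
    moreover have "key_stage \<phi> k" using algorithm_run_key_stage[OF assms(1)] k less.prems by simp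
    moreover have "\<And>l. l \<in> {1..k} \<Longrightarrow> in_val_ring_poly \<nu> (\<phi> l)" using less.IH less.prems k by auto
    ultimately show ?thesis using step_in_val_ring k by blast
  qed
qed

lemma algorithm_run_successor:
  assumes "algorithm_run m \<phi>" "1 \<le> i" "i < m"
  shows "successor (\<phi> i) (\<phi> (Suc i))" "W (\<phi> i) \<noteq> Infty"
    "degree (\<phi> (Suc i)) = stage_count \<phi> i * degree (\<phi> i)"
proof -
  obtain \<mu> c j where "W (\<phi> i) = Fin \<mu>" "algorithm_step \<phi> i (\<phi> (Suc i)) c j"
    using algorithm_run_step[OF assms] by blast
  moreover have "key_stage \<phi> i" using algorithm_run_key_stage[OF assms(1)] assms by simp
  ultimately show "successor (\<phi> i) (\<phi> (Suc i))" "W (\<phi> i) \<noteq> Infty"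
    "degree (\<phi> (Suc i)) = stage_count \<phi> i * degree (\<phi> i)"
    using step_successor step_degree assms(2) by auto
qed

lemma algorithm_run_trunc_le:
  assumes "algorithm_run m \<phi>" "1 \<le> i" "i \<le> k" "k \<le> m"
  shows "trunc (\<phi> i) g \<le> trunc (\<phi> k) g"
  using assms(3,4)
proof (induction k rule: dec_induct)
  case (step k)
  have k: "1 \<le> k" "k < m" using step assms(2) by auto
  have "trunc (\<phi> k) g \<le> trunc (\<phi> (Suc k)) g"
    using successor_trunc_le algorithm_run_good[OF assms(1) k(1)] algorithm_run_successor[OF assms(1) k] k
    by simp
  then show ?case using step by simp
qed simp

text \<open>Both terms of \<open>\<phi> (Suc m)\<close> are standard terms of value n \<mu>. The
  power n of \<open>\<phi> m\<close> is admissible because \<open>std_exponents\<close> leaves the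
  last exponent unbounded.\<close>

lemma algorithm_run_homogeneous:
  assumes run: "algorithm_run (Suc m) \<phi>" and m: "1 \<le> m"
  shows "homogeneous \<phi> m (trunc (\<phi> m)) (\<phi> (Suc m))"
proof -
  obtain \<mu> c j where \<mu>: "W (\<phi> m) = Fin \<mu>" and step: "algorithm_step \<phi> m (\<phi> (Suc m)) c j"
    using algorithm_run_step[OF run m] by auto
  have stage: "key_stage \<phi> m" using algorithm_run_key_stage[OF run] m by simp
  let ?n = "stage_count \<phi> m"
  have n: "0 < ?n" by (rule stage_facts(1)[OF m stage \<mu>])
  have c: "c \<noteq> 0" using step by (simp add: algorithm_step_def)
  have deg: "0 < degree (\<phi> i)" if "i \<in> {1..m}" for i
    using algorithm_run_good[OF run, of i] that by (simp add: good_def)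
  \<comment> \<open>\<open>e2\<close> cuts \<open>j\<close> off outside 1 to m - 1, where
    \<open>algorithm_step\<close> leaves it arbitrary but standard exponents must vanish.\<close>
  define e1 e2 where "e1 = (\<lambda>i. if i = m then ?n else 0)"
    and "e2 = (\<lambda>i. if i \<in> {1..m - 1} then j i else 0)"
  define a where "a = (\<lambda>e. if e = e1 then 1 else if e = e2 then - c else 0)"
  have "e1 m \<noteq> e2 m" using n m by (auto simp: e1_def e2_def)
  then have ne: "e1 \<noteq> e2" by auto
  have supp: "{e. a e \<noteq> 0} = {e1, e2}" using c by (auto simp: a_def)
  \<comment> \<open>The degree quotients bounding standard exponents are the indices bounding
    \<open>j\<close>; their positivity admits the zero entries of \<open>e1\<close>.\<close>
  have ratio: "degree (\<phi> (Suc i)) div degree (\<phi> i) = stage_count \<phi> i" "0 < stage_count \<phi> i"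
    if "i \<in> {1..<m}" for i
  proof -
    have i: "1 \<le> i" "i < Suc m" using that by auto
    then have eq: "degree (\<phi> (Suc i)) = stage_count \<phi> i * degree (\<phi> i)"
      using algorithm_run_successor[OF run] by simp
    then show "degree (\<phi> (Suc i)) div degree (\<phi> i) = stage_count \<phi> i" using deg[of i] that by simp
    show "0 < stage_count \<phi> i"
    proof (rule ccontr)
      assume "\<not> 0 < stage_count \<phi> i"
      then have "degree (\<phi> (Suc i)) = 0" using eq by simp
      then show False using deg[of "Suc i"] that by simp
    qed
  qed
  have std: "{e. a e \<noteq> 0} \<subseteq> std_exponents \<phi> m"
    unfolding supp using ratio m step
    by (auto simp: std_exponents_def e1_def e2_def algorithm_step_def)
  have "{1..m} = insert m {1..m - 1}" using m by auto
  then have prods: "(\<Prod>i=1..m. \<phi> i ^ e i) = \<phi> m ^ e m * key_monomial \<phi> m e" for e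
    using m by (simp add: prod.insert)
  have "key_monomial \<phi> m e1 = 1" by (rule prod.neutral) (auto simp: e1_def)
  then have t1: "std_term \<phi> m (a e1) e1 = \<phi> m ^ ?n"
    unfolding std_term_def prods by (simp add: a_def e1_def)
  have "key_monomial \<phi> m e2 = key_monomial \<phi> m j" by (rule prod.cong) (auto simp: e2_def)
  moreover have "e2 m = 0" using m by (simp add: e2_def)
  ultimately have t2: "std_term \<phi> m (a e2) e2 = - smult c (key_monomial \<phi> m j)"
    unfolding std_term_def prods using ne by (simp add: a_def)
  have v1: "trunc (\<phi> m) (std_term \<phi> m (a e1) e1) = Fin (nmul ?n \<mu>)"
  proof -
    have "trunc (\<phi> m) (1 * \<phi> m ^ ?n) = Fin (nmul ?n \<mu>)"
      using deg[of m] m by (subst trunc_mult_key_power) (simp_all add: trunc_1 \<mu> nmul_Fin)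
    then show ?thesis by (simp add: t1)
  qed
  have v2: "trunc (\<phi> m) (std_term \<phi> m (a e2) e2) = Fin (nmul ?n \<mu>)"
  proof -
    have "trunc (\<phi> m) (- smult c (key_monomial \<phi> m j)) = W (- smult c (key_monomial \<phi> m j))"
      using step_monomial_degree[OF m stage \<mu> step] by (intro trunc_small) (simp only: degree_minus)
    then show ?thesis unfolding t2 pv_minus[OF W] step_monomial_value[OF m stage \<mu> step] .
  qed
  have "\<phi> (Suc m) = \<phi> m ^ ?n - smult c (key_monomial \<phi> m j)" by (rule step_eq[OF m stage \<mu> step])
  then have "\<phi> (Suc m) = (\<Sum>e | a e \<noteq> 0. std_term \<phi> m (a e) e)"
    unfolding supp using ne by (simp add: t1 t2)
  moreover have "trunc (\<phi> m) (std_term \<phi> m (a e) e) = Fin (nmul ?n \<mu>)" if "a e \<noteq> 0" for e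
  proof -
    have "e = e1 \<or> e = e2" using that supp by blast
    then show ?thesis using v1 v2 by blast
  qed
  ultimately show ?thesis
    unfolding homogeneous_def using std by (intro exI[of _ a] conjI) (auto simp: supp)
qed

lemma algorithm_run_approximant:
  assumes "algorithm_run m \<phi>"
  shows "approximant \<nu> f \<phi> (\<lambda>i. W (\<phi> i)) (\<lambda>i. trunc (\<phi> i)) m"
  unfolding approximant_def
proof (intro conjI ballI)
  show "1 \<le> m" "\<phi> 1 = zvar" using assms by (simp_all add: algorithm_run_def)
  then show "trunc (\<phi> 1) = base_augment \<nu> (\<phi> 1) (W (\<phi> 1))"
    using base_augment_trunc[of \<nu>] W_const by simp
  show "W (\<phi> i) \<noteq> Infty" if "i \<in> {1..<m}" for i
    using algorithm_run_successor(2)[OF assms, of i] that by simp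
  show "0 < proj f (\<phi> m) (trunc (\<phi> m))"
    using algorithm_run_good[OF assms \<open>1 \<le> m\<close>] by (simp add: proj_pos)
  fix i assume "i \<in> {2..m}"
  then obtain k where k: "i = Suc k" "1 \<le> k" "k < m" by (cases i) auto
  note succ = algorithm_run_good[OF assms k(2) less_imp_le[OF k(3)]]
    algorithm_run_successor(2,1)[OF assms k(2,3)]
  show "key_polynomial (trunc (\<phi> (i - 1))) (\<phi> (i - 1)) (\<phi> i) (W (\<phi> i))"
    using successor_key_polynomial[OF succ] k by simp
  show "trunc (\<phi> i) = augment (trunc (\<phi> (i - 1))) (\<phi> i) (W (\<phi> i))"
    using successor_augment[OF succ] k by simp
  show "homogeneous \<phi> (i - 1) (trunc (\<phi> (i - 1))) (\<phi> i)"
    using algorithm_run_homogeneous[of k \<phi>] algorithm_run_le[OF assms, of "Suc k"] k by simp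
qed

lemma algorithm_run_realization:
  assumes "sequence_index_set I" "\<And>i. i \<in> I \<Longrightarrow> algorithm_run i \<phi>"
  shows "realization \<nu> W f I \<phi> (\<lambda>i. trunc (\<phi> i))"
  unfolding realization_def
proof (intro conjI ballI assms)
  show "approximant \<nu> f \<phi> (\<lambda>m. W (\<phi> m)) (\<lambda>i. trunc (\<phi> i)) i" if "i \<in> I" for i
    using algorithm_run_approximant[OF assms(2)[OF that]] .
  have "\<exists>c j. i \<in> I \<and> 2 \<le> i \<longrightarrow> algorithm_step \<phi> (i - 1) (\<phi> i) c j" for i
  proof (cases "i \<in> I \<and> 2 \<le> i")
    case True
    then have "algorithm_run i \<phi>" "1 \<le> i - 1" "i - 1 < i" "Suc (i - 1) = i" using assms(2) by auto
    then have "\<exists>c j. algorithm_step \<phi> (i - 1) (\<phi> i) c j" by (metis algorithm_run_step)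
    then show ?thesis by blast
  qed auto
  then obtain c j where step: "\<And>i. i \<in> I \<and> 2 \<le> i \<longrightarrow> algorithm_step \<phi> (i - 1) (\<phi> i) (c i) (j i)"
    by metis
  have two: "i - 1 - 1 = i - 2" for i :: nat by simp
  show "\<exists>c j. \<forall>i\<in>I. 2 \<le> i \<longrightarrow> c (i - 1) \<in> val_ring \<nu> \<and>
      (\<forall>l\<in>{1..i - 2}. j l (i - 1) < stage_count \<phi> l) \<and>
      \<phi> i = \<phi> (i - 1) ^ stage_count \<phi> (i - 1) - smult (c (i - 1)) (\<Prod>l=1..i - 2. \<phi> l ^ j l (i - 1))"
  \<comment> \<open>\<open>realization\<close> labels the data of the step leading to
    \<open>\<phi> i\<close> by i - 1 and puts the key number first among the arguments of the
    exponents.\<close>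
  proof (intro exI[of _ "\<lambda>k. c (Suc k)"] exI[of _ "\<lambda>l k. j (Suc k) l"] ballI impI)
    fix i assume i: "i \<in> I" "2 \<le> i"
    then have "algorithm_step \<phi> (i - 1) (\<phi> i) (c i) (j i)" using step by blast
    moreover have "Suc (i - 1) = i" using i by simp
    ultimately show "c (Suc (i - 1)) \<in> val_ring \<nu> \<and>
      (\<forall>l\<in>{1..i - 2}. j (Suc (i - 1)) l < stage_count \<phi> l) \<and>
      \<phi> i = \<phi> (i - 1) ^ stage_count \<phi> (i - 1)
        - smult (c (Suc (i - 1))) (\<Prod>l=1..i - 2. \<phi> l ^ j (Suc (i - 1)) l)"
      unfolding algorithm_step_def two by metis
  qed
qed

text \<open>If no run reaches the value \<open>Infty\<close>, every run can be extended without
  changing its keys; dependent choice gives a chain of runs, glued to one sequence.\<close>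

lemma exists_algorithm_run:
  obtains (finite) m \<phi> where "algorithm_run m \<phi>" "W (\<phi> m) = Infty"
  | (infinite) \<phi> where "\<And>m. 1 \<le> m \<Longrightarrow> algorithm_run m \<phi>"
proof (cases "\<exists>m \<phi>. algorithm_run m \<phi> \<and> W (\<phi> m) = Infty")
  case False
  have "\<exists>F. \<forall>m. algorithm_run (Suc m) (F m) \<and> (\<forall>i\<in>{1..Suc m}. F (Suc m) i = F m i)"
  proof (rule dependent_nat_choice[of "\<lambda>m. algorithm_run (Suc m)" "\<lambda>m F G. \<forall>i\<in>{1..Suc m}. G i = F i"])
    show "\<exists>\<phi>. algorithm_run (Suc 0) \<phi>"
      by (intro exI[of _ "\<lambda>_. zvar"]) (simp add: algorithm_run_def)
    fix \<phi> m assume run: "algorithm_run (Suc m) \<phi>"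
    then obtain \<mu> where \<mu>: "W (\<phi> (Suc m)) = Fin \<mu>" using False not_Infty_iff by metis
    moreover have "key_stage \<phi> (Suc m)" using algorithm_run_key_stage[OF run] by simp
    ultimately obtain \<psi> c j where step: "algorithm_step \<phi> (Suc m) \<psi> c j"
      using exists_algorithm_step[of "Suc m" \<phi> \<mu>] by auto
    define \<phi>' where "\<phi>' = \<phi>(Suc (Suc m) := \<psi>)"
    have eq: "\<phi>' i = \<phi> i" if "i \<in> {1..Suc m}" for i using that by (simp add: \<phi>'_def)
    have run': "algorithm_run (Suc m) \<phi>'" by (rule algorithm_run_cong[OF _ run]) (simp add: eq)
    have "algorithm_step \<phi> (Suc m) = algorithm_step \<phi>' (Suc m)"
      by (rule algorithm_step_cong) (simp_all add: eq)
    then have "\<exists>c j. algorithm_step \<phi>' (Suc m) (\<phi>' (Suc (Suc m))) c j"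
      using step by (auto simp: \<phi>'_def)
    moreover have "W (\<phi>' (Suc m)) \<noteq> Infty" using \<mu> eq[of "Suc m"] by simp
    ultimately have last: "W (\<phi>' (Suc m)) \<noteq> Infty \<and>
      (\<exists>c j. algorithm_step \<phi>' (Suc m) (\<phi>' (Suc (Suc m))) c j)" by blast
    have "W (\<phi>' i) \<noteq> Infty \<and> (\<exists>c j. algorithm_step \<phi>' i (\<phi>' (Suc i)) c j)"
      if i: "i \<in> {1..<Suc (Suc m)}" for i
    proof (cases "i = Suc m")
      case True
      show ?thesis unfolding True by (rule last)
    next
      case False
      then have "i \<in> {1..<Suc m}" using i by auto
      then show ?thesis using run' unfolding algorithm_run_def by blast
    qed
    then have "algorithm_run (Suc (Suc m)) \<phi>'" using run' unfolding algorithm_run_def by simp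
    then show "\<exists>\<phi>'. algorithm_run (Suc (Suc m)) \<phi>' \<and> (\<forall>i\<in>{1..Suc m}. \<phi>' i = \<phi> i)" using eq by blast
  qed
  then obtain F where F: "\<And>m. algorithm_run (Suc m) (F m)"
    "\<And>m i. i \<in> {1..Suc m} \<Longrightarrow> F (Suc m) i = F m i" by blast
  \<comment> \<open>\<open>F m\<close> is a run of length m + 1, so the key with number i is settled
    from \<open>F (i - 1)\<close> on.\<close>
  define \<phi> where "\<phi> = (\<lambda>i. F (i - 1) i)"
  have eq: "F m i = \<phi> i" if "i \<in> {1..Suc m}" for m i
    using that
  proof (induction m)
    case 0
    then show ?case by (simp add: \<phi>_def)
  next
    case (Suc m)
    then show ?case using F(2)[of i m] by (cases "i = Suc (Suc m)") (auto simp: \<phi>_def)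
  qed
  show thesis
  proof (rule infinite)
    fix m :: nat assume "1 \<le> m"
    then obtain k where k: "m = Suc k" by (cases m) auto
    show "algorithm_run m \<phi>" unfolding k by (rule algorithm_run_cong[OF _ F(1)]) (rule eq)
  qed
qed (use finite in blast)

lemma family_is_sequence_stage_of:
  assumes "{1..n} \<subseteq> I"
  shows "family_is_sequence (stage_of n (I - {1..n}) (case_sum \<phi> \<phi>)) I \<phi> (\<lambda>i. trunc (\<phi> i))"
  using assms by (simp add: family_is_sequence_def)

theorem exists_realization:
  assumes fin_rank: "finite_rank \<nu>"
  shows "\<exists>I \<phi> V. realization \<nu> W f I \<phi> V \<and> (\<forall>i\<in>I. in_val_ring_poly \<nu> (\<phi> i)) \<and>
    (\<exists>t (S :: nat \<Rightarrow> ('k poly, 'g, nat) simple_family).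
      admissible_family \<nu> W t S \<and> family_determines W t S \<and> family_is_sequence (S 1) I \<phi> V)"
proof (rule exists_algorithm_run)
  fix m \<phi> assume run: "algorithm_run m \<phi>" and Infty: "W (\<phi> m) = Infty"
  \<comment> \<open>The continuous part is empty; it is written as a difference to match
    \<open>family_is_sequence_stage_of\<close>.\<close>
  let ?S = "\<lambda>_::nat. stage_of m ({1..m} - {1..m}) (case_sum \<phi> \<phi>) :: ('k poly, 'g, nat) simple_family"
  have m: "1 \<le> m" and z: "\<phi> 1 = zvar" using run by (simp_all add: algorithm_run_def)
  have "canonical_stage (?S 1)"
    unfolding canonical_stage_def
  proof (intro conjI ballI impI allI)
    show "good (fam_key (?S 1) x)" if "x \<in> fam_index (?S 1)" for x
      using that algorithm_run_good[OF run] by (cases x) auto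
    fix x y assume xy: "x \<in> fam_index (?S 1)" "y \<in> fam_index (?S 1)" "index_less x y"
    then show "W (fam_key (?S 1) x) \<noteq> Infty"
      using algorithm_run_successor(2)[OF run] by (cases x; cases y) auto
    show "trunc (fam_key (?S 1) x) g \<le> trunc (fam_key (?S 1) y) g" for g
      using xy algorithm_run_trunc_le[OF run] by (cases x; cases y) auto
  next
    fix i assume "i \<in> {2..fam_n (?S 1)}"
    then obtain k where "i = Suc k" "1 \<le> k" "k < m" by (cases i) auto
    then show "successor (fam_key (?S 1) (Inl (i - 1))) (fam_key (?S 1) (Inl i))"
      using algorithm_run_successor(1)[OF run] by simp
  qed (use m in auto)
  then have "resolution 1 ?S" using Infty by (simp add: resolution_def)
  then have "admissible_family \<nu> W 1 ?S" "family_determines W 1 ?S"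
    using resolution_admissible[of 1 ?S \<nu>] z W_const by simp_all
  moreover have "realization \<nu> W f {1..m} \<phi> (\<lambda>i. trunc (\<phi> i))"
    using algorithm_run_le[OF run] m
    by (intro algorithm_run_realization) (auto simp: sequence_index_set_def)
  moreover have "family_is_sequence (?S 1) {1..m} \<phi> (\<lambda>i. trunc (\<phi> i))"
    by (rule family_is_sequence_stage_of) simp
  moreover have "\<forall>i\<in>{1..m}. in_val_ring_poly \<nu> (\<phi> i)" using algorithm_run_in_val_ring[OF run] by simp
  ultimately show ?thesis by blast
next
  fix \<phi> assume run: "\<And>m. 1 \<le> m \<Longrightarrow> algorithm_run m \<phi>"
  have good: "good (\<phi> i)" if "1 \<le> i" for i using algorithm_run_good[OF run] that by blast
  have succ: "successor (\<phi> i) (\<phi> (Suc i))" "W (\<phi> i) \<noteq> Infty" if "1 \<le> i" for i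
    using algorithm_run_successor[OF run[of "Suc i"], of i] that by auto
  have le: "trunc (\<phi> i) g \<le> trunc (\<phi> k) g" if "1 \<le> i" "i \<le> k" for i k g
    using algorithm_run_trunc_le[OF run[of k], of i k g] that by simp
  \<comment> \<open>\<open>N\<close> is an index of greatest degree, which exists because good
    polynomials have degree at most \<open>degree f\<close>. Degrees never decrease along the run,
    so they are constant from \<open>N\<close> on.\<close>
  have "\<exists>N. 1 \<le> N \<and> (\<forall>i. 1 \<le> i \<longrightarrow> degree (\<phi> i) \<le> degree (\<phi> N))"
    using ex_has_greatest_nat[of "\<lambda>i. 1 \<le> i" 1 "\<lambda>i. degree (\<phi> i)" "Suc (degree f)"] good
    by (auto simp: good_def less_Suc_eq_le)
  then obtain N where N: "1 \<le> N" and max: "\<And>i. 1 \<le> i \<Longrightarrow> degree (\<phi> i) \<le> degree (\<phi> N)" by blast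
  have mono_deg: "degree (\<phi> N) \<le> degree (\<phi> i)" if "N \<le> i" for i
    using that
  proof (induction i rule: dec_induct)
    case (step i)
    then have "1 \<le> i" using N by simp
    then show ?case using step successor_degree[OF good succ(2) succ(1)] by (meson order_trans)
  qed simp
  then have deg: "degree (\<phi> i) = degree (\<phi> N)" if "N \<le> i" for i
    using max[of i] that N by (simp add: order_antisym)
  define A where "A = {1::nat..} - {1..N}"
  have A: "i \<in> A \<longleftrightarrow> N < i" for i using N by (auto simp: A_def)
  obtain \<chi> where \<chi>: "good \<chi>" "\<And>a g. a \<in> A \<Longrightarrow> trunc (\<phi> a) g \<le> trunc \<chi> g"
    "limit_augmented W A (\<lambda>a. trunc (\<phi> a)) \<chi> (trunc \<chi>)"
  proof (rule exists_limit_key[of A \<phi>])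
    show "A \<noteq> {}" using A by blast
    show "good (\<phi> a)" "W (\<phi> a) \<noteq> Infty" if "a \<in> A" for a using that A N good succ by auto
    show "trunc (\<phi> a) g \<le> trunc (\<phi> b) g" if "a \<in> A" "a \<le> b" for a b g using that A N le by auto
  qed blast
  \<comment> \<open>The bound 0 makes the initial agreement with \<open>W\<close> vacuous; only the
    goodness of the limit key is needed to continue.\<close>
  obtain t and S :: "nat \<Rightarrow> ('k poly, 'g, nat) simple_family"
    where S: "resolution t S" "fam_key (S 1) (Inl 1) = \<chi>"
    using exists_resolution[of \<chi> 0]
      finite_rank_value_group[OF W_const pv_\<nu> fin_rank] \<chi>(1) by auto
  let ?first = "stage_of N A (case_sum \<phi> \<phi>)"
  let ?S = "\<lambda>s. if s = 1 then ?first else S (s - 1)"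
  have "canonical_stage ?first"
    unfolding canonical_stage_def
  proof (intro conjI ballI impI allI)
    show "good (fam_key ?first x)" if "x \<in> fam_index ?first" for x
      using that good A N by (cases x) auto
    fix x y assume xy: "x \<in> fam_index ?first" "y \<in> fam_index ?first" "index_less x y"
    then show "W (fam_key ?first x) \<noteq> Infty" using succ(2) A N by (cases x) auto
    show "trunc (fam_key ?first x) g \<le> trunc (fam_key ?first y) g" for g
      using xy le A N by (cases x; cases y) auto
  next
    fix i assume "i \<in> {2..fam_n ?first}"
    then obtain k where "i = Suc k" "1 \<le> k" by (cases i) auto
    then show "successor (fam_key ?first (Inl (i - 1))) (fam_key ?first (Inl i))" using succ(1) by simp
  next
    fix \<alpha> assume "\<alpha> \<in> fam_A ?first"
    then have \<alpha>: "N < \<alpha>" using A by simp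
    then obtain k where k: "\<alpha> = Suc k" "N \<le> k" by (cases \<alpha>) auto
    then have k1: "1 \<le> k" using N by simp
    \<comment> \<open>The run makes \<open>\<phi> \<alpha>\<close> a successor of its predecessor
      \<open>\<phi> k\<close>, whereas the family needs it as a successor of
      \<open>\<phi> N\<close>. It increases over the smaller \<open>trunc (\<phi> N)\<close> too,
      and equality of degrees gives minimality.\<close>
    have "trunc (\<phi> N) (\<phi> \<alpha>) \<le> trunc (\<phi> k) (\<phi> \<alpha>)" using le N k by blast
    also have "\<dots> < W (\<phi> \<alpha>)" using succ(1)[OF k1] k by (simp add: successor_def)
    finally have less: "trunc (\<phi> N) (\<phi> \<alpha>) < W (\<phi> \<alpha>)" .
    have d: "degree (\<phi> \<alpha>) = degree (\<phi> N)" by (rule deg) (use \<alpha> in simp)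
    then have "degree g < degree (\<phi> \<alpha>) \<longrightarrow> trunc (\<phi> N) g = W g" for g
      using trunc_small[of g "\<phi> N"] by simp
    moreover have "lead_coeff (\<phi> \<alpha>) = 1"
      using succ(1)[OF k1] unfolding k successor_def by blast
    ultimately have "successor (\<phi> N) (\<phi> \<alpha>)"
      unfolding successor_def using less by blast
    then show "successor (fam_key ?first (Inl (fam_n ?first))) (fam_key ?first (Inr \<alpha>))" by simp
    show "degree (fam_key ?first (Inr \<alpha>)) = degree (fam_key ?first (Inl (fam_n ?first)))" using d by simp
  next
    fix \<alpha> assume "\<alpha> \<in> fam_A ?first"
    then show "\<exists>\<beta>\<in>fam_A ?first. \<alpha> < \<beta>" using A by (intro bexI[of _ "Suc \<alpha>"]) auto
  qed (use N in auto)
  moreover have "trunc (fam_key ?first x) g \<le> trunc (fam_key (S 1) (Inl 1)) g"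
    if x: "x \<in> fam_index ?first" for x g
  proof -
    obtain i where i: "fam_key ?first x = \<phi> i" "1 \<le> i" using x A N by (cases x) auto
    have "trunc (\<phi> i) g \<le> trunc (\<phi> (Suc (max i N))) g" using i(2) by (intro le) auto
    also have "\<dots> \<le> trunc \<chi> g" by (rule \<chi>(2)) (simp add: A)
    finally show ?thesis unfolding i(1) S(2) .
  qed
  moreover have "limit_augmented W (fam_A ?first) (\<lambda>\<alpha>. trunc (fam_key ?first (Inr \<alpha>)))
      (fam_key (S 1) (Inl 1)) (trunc (fam_key (S 1) (Inl 1)))"
    unfolding S(2) using \<chi>(3) by simp
  ultimately have "resolution (Suc t) ?S" using S(1) by (intro resolution_limit)
  moreover have "\<phi> 1 = zvar" using run[of 1] by (simp add: algorithm_run_def)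
  ultimately have "admissible_family \<nu> W (Suc t) ?S" "family_determines W (Suc t) ?S"
    using resolution_admissible[of "Suc t" ?S \<nu>] W_const by simp_all
  moreover have "realization \<nu> W f {1..} \<phi> (\<lambda>i. trunc (\<phi> i))"
    using run by (intro algorithm_run_realization) (auto simp: sequence_index_set_def)
  moreover have "family_is_sequence (?S 1) {1..} \<phi> (\<lambda>i. trunc (\<phi> i))"
    using family_is_sequence_stage_of[of N "{1..}" \<phi>] by (auto simp: A_def)
  moreover have "\<forall>i\<in>{1..}. in_val_ring_poly \<nu> (\<phi> i)" using algorithm_run_in_val_ring[OF run] by auto
  ultimately show ?thesis by blast
qed

end

theorem proposition7p1:
  fixes \<nu> :: "'k::field \<Rightarrow> 'g::linordered_ab_group_add vext"
    and W :: "'k poly \<Rightarrow> 'g vext"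
    and f :: "'k poly"
  assumes "valuation \<nu>" and "finite_rank \<nu>"
    and "\<exists>F. alg_closed_subfield F \<and> F \<subseteq> val_ring \<nu> \<and> residue_field_iso \<nu> F"
    and "in_val_ring_poly \<nu> f" and "lead_coeff f = 1" and "irreducible f"
    and "pseudo_valuation W" and "\<forall>a. W [:a:] = \<nu> a"
    and "infty_ideal W = {g. f dvd g}"
  shows "\<exists>I \<phi> V. realization \<nu> W f I \<phi> V \<and>
           (\<forall>i\<in>I. in_val_ring_poly \<nu> (\<phi> i)) \<and>
           (\<exists>t (S :: nat \<Rightarrow> ('k poly, 'g, nat) simple_family).
              admissible_family \<nu> W t S \<and> family_determines W t S \<and>
              family_is_sequence (S 1) I \<phi> V)"
proof -
  interpret residually_closed_extension W f \<nu>
    by unfold_locales (use assms in blast)+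
  show ?thesis using \<open>finite_rank \<nu>\<close> by (rule exists_realization)
qed

end
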